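(* Let $H$ be a Hopf algebra admitting a finite PBW generating system $\mathbb G=(\{z_\xi\}_{\xi\in\Xi},<)$ which is $\mathfrak d_H$-minimal, $\mathfrak d_H$-triangular and $(\Delta_H,\mathfrak d_H)$-dominated, where $\mathfrak d_H\colon\Xi\to\mathbb N$ is the positive map $\mathfrak d_H(\xi)=\min\{m\ge1\mid z_\xi\in H_{(m)}\}$. If $\mathfrak d_H$ is order-preserving, then $H$ is an IHOE of its primitive part $U(P(H))$, the universal enveloping algebra of the Lie algebra $P(H)$ of primitive elements of $H$ (viewed as a Hopf subalgebra of $H$).
   Context: $\Bbbk$ is a field of characteristic zero; algebras, Hopf algebras and tensor products are over $\Bbbk$. $H_{(m)}$ ($m\ge0$) is the $m$-th layer of the coradical filtration of $H$ ($H_{(0)}$ is the coradical). An ordered family $\mathbb G=(\{z_\xi\}_{\xi\in\Xi},<)$ in $H$ is a family of elements together with a total order $<$ on $\Xi$. $\mathcal P(\Xi,<)$ is the set of non-decreasing words on $\Xi$ (including the empty word $\emptyset$), $\mathcal P_+(\Xi,<)$ the nonempty ones. For $V=\xi_1\cdots\xi_n$ put $z_V=z_{\xi_1}\cdots z_{\xi_n}$, $z_\emptyset=1$. $\mathbb G$ is a PBW generating system if $\{z_V\}_{V\in\mathcal P(\Xi,<)}$ is a basis of $H$; it is finite if $\Xi$ is finite. $U<_{\mathfrak r}V$ iff $U=W_1\eta W_3$, $V=W_2\xi W_3$ for some words $W_i$ and letters $\eta<\xi$; $U<_{\mathfrak r,\mathrm{lex}}V$ iff $U$ is a proper suffix of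 $V$ or $U<_{\mathfrak r}V$. A positive map $\mathfrak d\colon\Xi\to\mathbb N$ (all values $>0$) extends additively to words; it is order-preserving if $\eta<\xi$ implies $\mathfrak d(\eta)\le\mathfrak d(\xi)$. $\mathbb G$ is: - $\mathfrak d$-minimal if $(z_\xi+H_+[\mathbb G,\xi,\mathfrak d])\cap H_{(\mathfrak d(\xi)-1)}=\emptyset$ for all $\xi\in\Xi$, where $H_+[\mathbb G,\xi,\mathfrak d]=\operatorname{Span}\{z_W\mid W\in\mathcal P_+(\Xi,<),\ \mathfrak d(W)\le\mathfrak d(\xi),\ W<_{\mathfrak r,\mathrm{lex}}\xi\}$; - $\mathfrak d$-triangular (for finite $\Xi$) if for all $\eta<\xi$: $z_\xi z_\eta\in\Bbbk^\times z_\eta z_\xi+\operatorname{Span}\{z_W\mid W\in\mathcal P_+(\Xi,<),\ \mathfrak d(W)\le\mathfrak d(\eta\xi),\ W<_{\mathfrak r,\mathrm{lex}}\eta\xi\}$; - $(\Delta_H,\mathfrak d)$-dominated if for all $\xi$: $\Delta_H(z_\xi)\in1\otimes z_\xi+z_\xi\otimes1+\operatorname{Span}\{z_P\otimes z_Q\mid P,Q\in\mathcal P_+(\Xi,<),\ \mathfrak d(PQ)\le\mathfrak d(\xi),\ P,Q<_{\mathfrak r}\xi\}$. IHOE: $H$ is an IHOE of a Hopf subalgebra $R$ if there is a finite chain of Hopf subalgebras $R=H_0\subset\cdots\subset H_n=H$ ($n\ge0$) such that each $H_i$ is, as an algebra, an Ore extension $H_{i-1}[X;\sigma,\delta]$ of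 $H_{i-1}$ with $\sigma$ an automorphism and $\delta$ a $\sigma$-derivation of $H_{i-1}$ (free left $H_{i-1}$-module with basis the powers of $X$, and $Xr=\sigma(r)X+\delta(r)$). *)

theory Defs
  imports Complex_Main "HOL-Library.Poly_Mapping" "HOL-Library.Sublist"
begin

section \<open>Free vector spaces and quotients\<close>

text \<open>
  A vector space over a field \<open>'k\<close> is given by an additive group type together with a scalar
  multiplication satisfying the locale \<^locale>\<open>vector_space\<close>.  Its subspaces, linear spans etc. are
  those of that locale, written \<^const>\<open>module.span\<close> with the scalar multiplication as first argument.
  The free vector space on a set of generators \<open>'x\<close> is the type \<open>'x \<Rightarrow>\<^sub>0 'k\<close>.
\<close>

abbreviation gen :: "'x \<Rightarrow> ('x \<Rightarrow>\<^sub>0 'k::field)"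
  where "gen x \<equiv> Poly_Mapping.single x 1"

abbreviation fscale :: "'k::field \<Rightarrow> ('x \<Rightarrow>\<^sub>0 'k) \<Rightarrow> ('x \<Rightarrow>\<^sub>0 'k)"
  where "fscale c \<equiv> Poly_Mapping.map ((*) c)"

lemma lookup_fscale [simp]: "Poly_Mapping.lookup (fscale c p) x = c * Poly_Mapping.lookup p x"
  by (simp add: map.rep_eq when_def)

lemma vector_space_fscale: "vector_space (fscale :: 'k::field \<Rightarrow> ('x \<Rightarrow>\<^sub>0 'k) \<Rightarrow> ('x \<Rightarrow>\<^sub>0 'k))"
  by unfold_locales (auto intro!: poly_mapping_eqI simp: lookup_add algebra_simps)

definition lin_ext ::
  "('k::field \<Rightarrow> 'v::ab_group_add \<Rightarrow> 'v) \<Rightarrow> ('x \<Rightarrow> 'v) \<Rightarrow> ('x \<Rightarrow>\<^sub>0 'k) \<Rightarrow> 'v"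
  where "lin_ext scl f p = (\<Sum>x\<in>Poly_Mapping.keys p. scl (Poly_Mapping.lookup p x) (f x))"

lemma lin_ext_superset:
  assumes "vector_space scl" "finite X" "Poly_Mapping.keys p \<subseteq> X"
  shows "lin_ext scl f p = (\<Sum>x\<in>X. scl (Poly_Mapping.lookup p x) (f x))"
proof -
  interpret vector_space scl by fact
  show ?thesis
    unfolding lin_ext_def using assms(2,3)
    by (intro sum.mono_neutral_left) (auto simp: in_keys_iff)
qed

lemma linear_lin_ext:
  assumes "vector_space scl"
  shows "Vector_Spaces.linear fscale scl (lin_ext scl f)"
proof -
  interpret V: vector_space scl by fact
  interpret F: vector_space "fscale :: 'a \<Rightarrow> ('c \<Rightarrow>\<^sub>0 'a) \<Rightarrow> ('c \<Rightarrow>\<^sub>0 'a)"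
    by (rule vector_space_fscale)
  show ?thesis
  proof unfold_locales
    fix p q :: "'c \<Rightarrow>\<^sub>0 'a"
    let ?X = "Poly_Mapping.keys p \<union> Poly_Mapping.keys q"
    show "lin_ext scl f (p + q) = lin_ext scl f p + lin_ext scl f q"
      by (simp add: lin_ext_superset[OF assms, where X = ?X] keys_add lookup_add
          V.scale_left_distrib sum.distrib)
  next
    fix c and p :: "'c \<Rightarrow>\<^sub>0 'a"
    have "Poly_Mapping.keys (fscale c p) \<subseteq> Poly_Mapping.keys p"
      by (auto simp: in_keys_iff)
    then show "lin_ext scl f (fscale c p) = scl c (lin_ext scl f p)"
      by (simp add: lin_ext_superset[OF assms, where X = "Poly_Mapping.keys p"] V.scale_sum_right)
  qed
qed

lemma lin_ext_single:
  assumes "vector_space scl"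
  shows "lin_ext scl f (Poly_Mapping.single x c) = scl c (f x)"
proof -
  interpret vector_space scl by fact
  show ?thesis by (simp add: lin_ext_def)
qed

definition coset :: "'v::ab_group_add set \<Rightarrow> 'v \<Rightarrow> 'v set"
  where "coset N p = {q. q - p \<in> N}"


section \<open>Tensor products\<close>

text \<open>
  \<open>V \<otimes> V\<close> is the free vector space on \<open>V \<times> V\<close> modulo the bilinearity relations; its elements are
  cosets, so for a tensor \<open>t\<close> the statement \<open>p \<in> t\<close> says that \<open>t\<close> is represented by the
  formal sum \<open>p\<close> of pairs.  \<open>V \<otimes> V \<otimes> V\<close> is obtained likewise from triples.
\<close>

definition tensor2_rel ::
  "('k::field \<Rightarrow> 'v::ab_group_add \<Rightarrow> 'v) \<Rightarrow> ('v \<times> 'v \<Rightarrow>\<^sub>0 'k) set"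
  where "tensor2_rel scl = module.span fscale
    ({gen (x + x', y) - gen (x, y) - gen (x', y) | x x' y. True} \<union>
     {gen (x, y + y') - gen (x, y) - gen (x, y') | x y y'. True} \<union>
     {gen (scl c x, y) - fscale c (gen (x, y)) | c x y. True} \<union>
     {gen (x, scl c y) - fscale c (gen (x, y)) | c x y. True})"

lemma lin_ext_tensor2_rel:
  assumes "vector_space scl" "p - q \<in> tensor2_rel scl'"
    and "\<And>x x' y. f (x + x', y) = f (x, y) + f (x', y)"
    and "\<And>x y y'. f (x, y + y') = f (x, y) + f (x, y')"
    and "\<And>c x y. f (scl' c x, y) = scl c (f (x, y))"
    and "\<And>c x y. f (x, scl' c y) = scl c (f (x, y))"
  shows "lin_ext scl f p = lin_ext scl f q"
proof -
  interpret E: Vector_Spaces.linear fscale scl "lin_ext scl f"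
    by (rule linear_lin_ext[OF assms(1)])
  have "module.subspace fscale {r. lin_ext scl f r = 0}"
    by (auto simp: E.vs1.subspace_def E.add E.scale)
  with assms(2)[unfolded tensor2_rel_def] have "lin_ext scl f (p - q) = 0"
    by (rule E.vs1.span_induct)
      (elim UnE CollectE exE conjE; hypsubst;
        simp add: E.diff lin_ext_single[OF assms(1)] assms(3-6))+
  then show ?thesis by (simp add: E.diff)
qed

definition tensor3_rel ::
  "('k::field \<Rightarrow> 'v::ab_group_add \<Rightarrow> 'v) \<Rightarrow> ('v \<times> 'v \<times> 'v \<Rightarrow>\<^sub>0 'k) set"
  where "tensor3_rel scl = module.span fscale
    ({gen (x + x', y, z) - gen (x, y, z) - gen (x', y, z) | x x' y z. True} \<union>
     {gen (x, y + y', z) - gen (x, y, z) - gen (x, y', z) | x y y' z. True} \<union>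
     {gen (x, y, z + z') - gen (x, y, z) - gen (x, y, z') | x y z z'. True} \<union>
     {gen (scl c x, y, z) - fscale c (gen (x, y, z)) | c x y z. True} \<union>
     {gen (x, scl c y, z) - fscale c (gen (x, y, z)) | c x y z. True} \<union>
     {gen (x, y, scl c z) - fscale c (gen (x, y, z)) | c x y z. True})"

definition tensor ::
  "('k::field \<Rightarrow> 'v::ab_group_add \<Rightarrow> 'v) \<Rightarrow> ('v \<times> 'v \<Rightarrow>\<^sub>0 'k) \<Rightarrow> ('v \<times> 'v \<Rightarrow>\<^sub>0 'k) set"
  where "tensor scl = coset (tensor2_rel scl)"

text \<open>The linear span in \<open>V \<otimes> V\<close> of the pure tensors \<open>a \<otimes> b\<close> with \<open>(a, b) \<in> A\<close>.\<close>

definition tensor_span ::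
  "('k::field \<Rightarrow> 'v::ab_group_add \<Rightarrow> 'v) \<Rightarrow> ('v \<times> 'v) set \<Rightarrow> ('v \<times> 'v \<Rightarrow>\<^sub>0 'k) set set"
  where "tensor_span scl A = tensor scl ` module.span fscale (gen ` A)"

text \<open>On representatives: \<open>(a \<otimes> b) (c \<otimes> d) = a c \<otimes> b d\<close>.\<close>

definition tensor_mult ::
  "('v::ring_1 \<times> 'v \<Rightarrow>\<^sub>0 'k::field) \<Rightarrow> ('v \<times> 'v \<Rightarrow>\<^sub>0 'k) \<Rightarrow> ('v \<times> 'v \<Rightarrow>\<^sub>0 'k)"
  where "tensor_mult p q =
    lin_ext fscale (\<lambda>(a, b). lin_ext fscale (\<lambda>(c, d). gen (a * c, b * d)) q) p"


section \<open>Coalgebras and Hopf algebras\<close>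

locale hopf_algebra = vector_space scl
  for scl :: "'k::field \<Rightarrow> 'h::ring_1 \<Rightarrow> 'h" +
  fixes comult :: "'h \<Rightarrow> ('h \<times> 'h \<Rightarrow>\<^sub>0 'k) set"
    and counit :: "'h \<Rightarrow> 'k"
    and antipode :: "'h \<Rightarrow> 'h"
  assumes scl_mult_left: "scl c x * y = scl c (x * y)"
    and scl_mult_right: "x * scl c y = scl c (x * y)"
    and comult_tensor: "comult x \<in> range (tensor scl)"
    and comult_add: "p \<in> comult x \<Longrightarrow> q \<in> comult y \<Longrightarrow> p + q \<in> comult (x + y)"
    and comult_scl: "p \<in> comult x \<Longrightarrow> fscale c p \<in> comult (scl c x)"
    and comult_one: "comult 1 = tensor scl (gen (1, 1))"
    and comult_mult: "p \<in> comult x \<Longrightarrow> q \<in> comult y \<Longrightarrow> tensor_mult p q \<in> comult (x * y)"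
    \<comment> \<open>\<open>(\<Delta> \<otimes> id) \<circ> \<Delta> = (id \<otimes> \<Delta>) \<circ> \<Delta>\<close>, where \<open>D\<close> chooses representatives of the values of \<open>\<Delta>\<close>\<close>
    and coassoc: "(\<And>a. D a \<in> comult a) \<Longrightarrow> p \<in> comult x \<Longrightarrow>
      lin_ext fscale (\<lambda>(a, b). lin_ext fscale (\<lambda>(a1, a2). gen (a1, a2, b)) (D a)) p -
      lin_ext fscale (\<lambda>(a, b). lin_ext fscale (\<lambda>(b1, b2). gen (a, b1, b2)) (D b)) p
        \<in> tensor3_rel scl"
    and counit_linear: "Vector_Spaces.linear scl (*) counit"
    and counit_one: "counit 1 = 1"
    and counit_mult: "counit (x * y) = counit x * counit y"
    and counit_left: "p \<in> comult x \<Longrightarrow> lin_ext scl (\<lambda>(a, b). scl (counit a) b) p = x"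
    and counit_right: "p \<in> comult x \<Longrightarrow> lin_ext scl (\<lambda>(a, b). scl (counit b) a) p = x"
    and antipode_linear: "Vector_Spaces.linear scl scl antipode"
    and antipode_left:
      "p \<in> comult x \<Longrightarrow> lin_ext scl (\<lambda>(a, b). antipode a * b) p = scl (counit x) 1"
    and antipode_right:
      "p \<in> comult x \<Longrightarrow> lin_ext scl (\<lambda>(a, b). a * antipode b) p = scl (counit x) 1"

definition subcoalgebra ::
  "('k::field \<Rightarrow> 'h::ring_1 \<Rightarrow> 'h) \<Rightarrow> ('h \<Rightarrow> ('h \<times> 'h \<Rightarrow>\<^sub>0 'k) set) \<Rightarrow> 'h set \<Rightarrow> bool"
  where "subcoalgebra scl comult C \<longleftrightarrow>
    module.subspace scl C \<and> (\<forall>x\<in>C. comult x \<in> tensor_span scl (C \<times> C))"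

definition simple_subcoalgebra ::
  "('k::field \<Rightarrow> 'h::ring_1 \<Rightarrow> 'h) \<Rightarrow> ('h \<Rightarrow> ('h \<times> 'h \<Rightarrow>\<^sub>0 'k) set) \<Rightarrow> 'h set \<Rightarrow> bool"
  where "simple_subcoalgebra scl comult C \<longleftrightarrow>
    subcoalgebra scl comult C \<and> C \<noteq> {0} \<and>
    (\<forall>B. subcoalgebra scl comult B \<and> B \<subseteq> C \<longrightarrow> B = {0} \<or> B = C)"

definition coradical ::
  "('k::field \<Rightarrow> 'h::ring_1 \<Rightarrow> 'h) \<Rightarrow> ('h \<Rightarrow> ('h \<times> 'h \<Rightarrow>\<^sub>0 'k) set) \<Rightarrow> 'h set"
  where "coradical scl comult = module.span scl (\<Union>{C. simple_subcoalgebra scl comult C})"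

text \<open>\<open>H\<^bsub>(m+1)\<^esub> = \<Delta>\<^sup>-\<^sup>1(H \<otimes> H\<^bsub>(m)\<^esub> + H\<^bsub>(0)\<^esub> \<otimes> H)\<close>\<close>

primrec corad_filt ::
  "('k::field \<Rightarrow> 'h::ring_1 \<Rightarrow> 'h) \<Rightarrow> ('h \<Rightarrow> ('h \<times> 'h \<Rightarrow>\<^sub>0 'k) set) \<Rightarrow> nat \<Rightarrow> 'h set"
  where
    "corad_filt scl comult 0 = coradical scl comult"
  | "corad_filt scl comult (Suc m) =
      {x. comult x \<in> tensor_span scl (UNIV \<times> corad_filt scl comult m \<union> coradical scl comult \<times> UNIV)}"

definition primitives ::
  "('k::field \<Rightarrow> 'h::ring_1 \<Rightarrow> 'h) \<Rightarrow> ('h \<Rightarrow> ('h \<times> 'h \<Rightarrow>\<^sub>0 'k) set) \<Rightarrow> 'h set"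
  where "primitives scl comult = {x. comult x = tensor scl (gen (1, x) + gen (x, 1))}"

definition subalgebra :: "('k::field \<Rightarrow> 'h::ring_1 \<Rightarrow> 'h) \<Rightarrow> 'h set \<Rightarrow> bool"
  where "subalgebra scl A \<longleftrightarrow> module.subspace scl A \<and> 1 \<in> A \<and> (\<forall>x\<in>A. \<forall>y\<in>A. x * y \<in> A)"

definition hopf_subalgebra ::
  "('k::field \<Rightarrow> 'h::ring_1 \<Rightarrow> 'h) \<Rightarrow> ('h \<Rightarrow> ('h \<times> 'h \<Rightarrow>\<^sub>0 'k) set) \<Rightarrow> ('h \<Rightarrow> 'h) \<Rightarrow> 'h set \<Rightarrow> bool"
  where "hopf_subalgebra scl comult antipode A \<longleftrightarrow>
    subalgebra scl A \<and> subcoalgebra scl comult A \<and> antipode ` A \<subseteq> A"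


section \<open>Iterated Hopf Ore extensions\<close>

definition algebra_automorphism ::
  "('k::field \<Rightarrow> 'h::ring_1 \<Rightarrow> 'h) \<Rightarrow> 'h set \<Rightarrow> ('h \<Rightarrow> 'h) \<Rightarrow> bool"
  where "algebra_automorphism scl A \<sigma> \<longleftrightarrow>
    bij_betw \<sigma> A A \<and> \<sigma> 1 = 1 \<and> (\<forall>c. \<forall>x\<in>A. \<sigma> (scl c x) = scl c (\<sigma> x)) \<and>
    (\<forall>x\<in>A. \<forall>y\<in>A. \<sigma> (x + y) = \<sigma> x + \<sigma> y \<and> \<sigma> (x * y) = \<sigma> x * \<sigma> y)"

definition skew_derivation ::
  "('k::field \<Rightarrow> 'h::ring_1 \<Rightarrow> 'h) \<Rightarrow> 'h set \<Rightarrow> ('h \<Rightarrow> 'h) \<Rightarrow> ('h \<Rightarrow> 'h) \<Rightarrow> bool"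
  where "skew_derivation scl A \<sigma> \<delta> \<longleftrightarrow>
    \<delta> ` A \<subseteq> A \<and> (\<forall>c. \<forall>x\<in>A. \<delta> (scl c x) = scl c (\<delta> x)) \<and>
    (\<forall>x\<in>A. \<forall>y\<in>A. \<delta> (x + y) = \<delta> x + \<delta> y \<and> \<delta> (x * y) = \<sigma> x * \<delta> y + \<delta> x * y)"

definition free_left_basis_powers :: "'h::ring_1 set \<Rightarrow> 'h set \<Rightarrow> 'h \<Rightarrow> bool"
  where "free_left_basis_powers A B X \<longleftrightarrow>
    bij_betw (\<lambda>f. \<Sum>n | f n \<noteq> 0. f n * X ^ n)
      {f :: nat \<Rightarrow> 'h. range f \<subseteq> A \<and> finite {n. f n \<noteq> 0}} B"

definition ore_extension ::
  "('k::field \<Rightarrow> 'h::ring_1 \<Rightarrow> 'h) \<Rightarrow> 'h set \<Rightarrow> 'h set \<Rightarrow> bool"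
  where "ore_extension scl A B \<longleftrightarrow>
    (\<exists>X \<sigma> \<delta>. algebra_automorphism scl A \<sigma> \<and> skew_derivation scl A \<sigma> \<delta> \<and>
      free_left_basis_powers A B X \<and> (\<forall>r\<in>A. X * r = \<sigma> r * X + \<delta> r))"

text \<open>The Hopf algebra, that is the whole type \<open>'h\<close>, is an IHOE of its Hopf subalgebra \<open>R\<close>.\<close>

definition is_IHOE_of ::
  "('k::field \<Rightarrow> 'h::ring_1 \<Rightarrow> 'h) \<Rightarrow> ('h \<Rightarrow> ('h \<times> 'h \<Rightarrow>\<^sub>0 'k) set) \<Rightarrow> ('h \<Rightarrow> 'h) \<Rightarrow> 'h set \<Rightarrow> bool"
  where "is_IHOE_of scl comult antipode R \<longleftrightarrow>
    (\<exists>(n::nat) A. A 0 = R \<and> A n = UNIV \<and>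
      (\<forall>i\<le>n. hopf_subalgebra scl comult antipode (A i)) \<and>
      (\<forall>i<n. ore_extension scl (A i) (A (Suc i))))"


section \<open>Universal enveloping algebras\<close>

text \<open>
  The free algebra on a set \<open>L\<close> consists of the linear combinations of words over \<open>L\<close>.  For a Lie
  algebra \<open>L\<close> with bracket \<open>br\<close>, the enveloping algebra \<open>U(L) = T(L) / (x y - y x - [x, y])\<close> is the
  free algebra on the set \<open>L\<close> modulo the two-sided ideal generated by the linearity relations
  (which give \<open>T(L)\<close>) and the bracket relations.
\<close>

definition free_algebra :: "'v set \<Rightarrow> ('v list \<Rightarrow>\<^sub>0 'k::field) set"
  where "free_algebra L = {p. Poly_Mapping.keys p \<subseteq> lists L}"

definition env_ideal ::
  "('k::field \<Rightarrow> 'v::ab_group_add \<Rightarrow> 'v) \<Rightarrow> ('v \<Rightarrow> 'v \<Rightarrow> 'v) \<Rightarrow> 'v set \<Rightarrow> ('v list \<Rightarrow>\<^sub>0 'k) set"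
  where "env_ideal scl br L = module.span fscale
    ({gen (u @ [x + y] @ v) - gen (u @ [x] @ v) - gen (u @ [y] @ v) | u v x y.
        u \<in> lists L \<and> v \<in> lists L \<and> x \<in> L \<and> y \<in> L} \<union>
     {gen (u @ [scl c x] @ v) - fscale c (gen (u @ [x] @ v)) | u v c x.
        u \<in> lists L \<and> v \<in> lists L \<and> x \<in> L} \<union>
     {gen (u @ [x, y] @ v) - gen (u @ [y, x] @ v) - gen (u @ [br x y] @ v) | u v x y.
        u \<in> lists L \<and> v \<in> lists L \<and> x \<in> L \<and> y \<in> L})"

definition enveloping_algebra ::
  "('k::field \<Rightarrow> 'v::ab_group_add \<Rightarrow> 'v) \<Rightarrow> ('v \<Rightarrow> 'v \<Rightarrow> 'v) \<Rightarrow> 'v set \<Rightarrow> ('v list \<Rightarrow>\<^sub>0 'k) set set"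
  where "enveloping_algebra scl br L = coset (env_ideal scl br L) ` free_algebra L"

definition commutator :: "'h::ring_1 \<Rightarrow> 'h \<Rightarrow> 'h"
  where "commutator x y = x * y - y * x"

text \<open>
  For a Lie subalgebra \<open>L\<close> of an algebra \<open>H\<close>: the algebra homomorphism \<open>U(L) \<rightarrow> H\<close> induced by the
  inclusion.  Evaluation of words is constant on each coset by the lemma that follows.
\<close>

definition env_map ::
  "('k::field \<Rightarrow> 'h::ring_1 \<Rightarrow> 'h) \<Rightarrow> ('h list \<Rightarrow>\<^sub>0 'k) set \<Rightarrow> 'h"
  where "env_map scl t = the_elem (lin_ext scl prod_list ` t)"


lemma (in hopf_algebra) lin_ext_env_ideal:
  assumes "p - q \<in> env_ideal scl commutator L"
  shows "lin_ext scl prod_list p = lin_ext scl prod_list q"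
proof -
  interpret E: Vector_Spaces.linear fscale scl "lin_ext scl prod_list"
    by (rule linear_lin_ext[OF vector_space_axioms])
  have "module.subspace fscale {r. lin_ext scl prod_list r = 0}"
    by (auto simp: E.vs1.subspace_def E.add E.scale)
  with assms[unfolded env_ideal_def] have "lin_ext scl prod_list (p - q) = 0"
    by (rule E.vs1.span_induct)
      (elim UnE CollectE exE conjE; hypsubst; simp add: E.diff E.add lin_ext_single[OF vector_space_axioms]
        algebra_simps commutator_def scl_mult_left scl_mult_right)+
  then show ?thesis by (simp add: E.diff)
qed


section \<open>PBW generating systems\<close>

text \<open>
  An ordered family is a map \<open>z\<close> on a subset \<open>I\<close> (possibly empty) of a linearly ordered type;
  words are lists.
\<close>

definition word_prod :: "('i \<Rightarrow> 'h::ring_1) \<Rightarrow> 'i list \<Rightarrow> 'h"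
  where "word_prod z W = prod_list (map z W)"

definition word_deg :: "('i \<Rightarrow> nat) \<Rightarrow> 'i list \<Rightarrow> nat"
  where "word_deg d W = sum_list (map d W)"

definition ndec_words :: "'i::linorder set \<Rightarrow> 'i list set"
  where "ndec_words I = {W \<in> lists I. sorted W}"

definition ndec_words_pos :: "'i::linorder set \<Rightarrow> 'i list set"
  where "ndec_words_pos I = ndec_words I - {[]}"

definition less_r :: "'i::linorder list \<Rightarrow> 'i list \<Rightarrow> bool"
  where "less_r U V \<longleftrightarrow>
    (\<exists>W1 W2 W3 \<eta> \<xi>. U = W1 @ [\<eta>] @ W3 \<and> V = W2 @ [\<xi>] @ W3 \<and> \<eta> < \<xi>)"

definition less_rlex :: "'i::linorder list \<Rightarrow> 'i list \<Rightarrow> bool"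
  where "less_rlex U V \<longleftrightarrow> strict_suffix U V \<or> less_r U V"

definition pbw_generating_system ::
  "('k::field \<Rightarrow> 'h::ring_1 \<Rightarrow> 'h) \<Rightarrow> 'i::linorder set \<Rightarrow> ('i \<Rightarrow> 'h) \<Rightarrow> bool"
  where "pbw_generating_system scl I z \<longleftrightarrow>
    inj_on (word_prod z) (ndec_words I) \<and>
    \<not> module.dependent scl (word_prod z ` ndec_words I) \<and>
    module.span scl (word_prod z ` ndec_words I) = UNIV"

definition d_minimal ::
  "('k::field \<Rightarrow> 'h::ring_1 \<Rightarrow> 'h) \<Rightarrow> ('h \<Rightarrow> ('h \<times> 'h \<Rightarrow>\<^sub>0 'k) set) \<Rightarrow>
    'i::linorder set \<Rightarrow> ('i \<Rightarrow> 'h) \<Rightarrow> ('i \<Rightarrow> nat) \<Rightarrow> bool"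
  where "d_minimal scl comult I z d \<longleftrightarrow>
    (\<forall>\<xi>\<in>I. {z \<xi> + s | s. s \<in> module.span scl
        {word_prod z W | W. W \<in> ndec_words_pos I \<and> word_deg d W \<le> d \<xi> \<and> less_rlex W [\<xi>]}}
      \<inter> corad_filt scl comult (d \<xi> - 1) = {})"

definition d_triangular ::
  "('k::field \<Rightarrow> 'h::ring_1 \<Rightarrow> 'h) \<Rightarrow> 'i::linorder set \<Rightarrow> ('i \<Rightarrow> 'h) \<Rightarrow> ('i \<Rightarrow> nat) \<Rightarrow> bool"
  where "d_triangular scl I z d \<longleftrightarrow>
    (\<forall>\<eta>\<in>I. \<forall>\<xi>\<in>I. \<eta> < \<xi> \<longrightarrow>
      z \<xi> * z \<eta> \<in> {scl c (z \<eta> * z \<xi>) + s | c s. c \<noteq> 0 \<and> s \<in> module.span scl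
        {word_prod z W | W. W \<in> ndec_words_pos I \<and> word_deg d W \<le> word_deg d [\<eta>, \<xi>] \<and>
          less_rlex W [\<eta>, \<xi>]}})"

definition comult_dominated ::
  "('k::field \<Rightarrow> 'h::ring_1 \<Rightarrow> 'h) \<Rightarrow> ('h \<Rightarrow> ('h \<times> 'h \<Rightarrow>\<^sub>0 'k) set) \<Rightarrow>
    'i::linorder set \<Rightarrow> ('i \<Rightarrow> 'h) \<Rightarrow> ('i \<Rightarrow> nat) \<Rightarrow> bool"
  where "comult_dominated scl comult I z d \<longleftrightarrow>
    (\<forall>\<xi>\<in>I. comult (z \<xi>) \<in>
      {tensor scl (gen (1, z \<xi>) + gen (z \<xi>, 1) + s) | s. s \<in> module.span fscale
        {gen (word_prod z P, word_prod z Q) | P Q. P \<in> ndec_words_pos I \<and> Q \<in> ndec_words_pos I \<and>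
          word_deg d (P @ Q) \<le> d \<xi> \<and> less_r P [\<xi>] \<and> less_r Q [\<xi>]}})"

definition order_preserving :: "'i::linorder set \<Rightarrow> ('i \<Rightarrow> nat) \<Rightarrow> bool"
  where "order_preserving I d \<longleftrightarrow> (\<forall>\<eta>\<in>I. \<forall>\<xi>\<in>I. \<eta> < \<xi> \<longrightarrow> d \<eta> \<le> d \<xi>)"

definition corad_deg ::
  "('k::field \<Rightarrow> 'h::ring_1 \<Rightarrow> 'h) \<Rightarrow> ('h \<Rightarrow> ('h \<times> 'h \<Rightarrow>\<^sub>0 'k) set) \<Rightarrow>
    ('i \<Rightarrow> 'h) \<Rightarrow> 'i \<Rightarrow> nat"
  where "corad_deg scl comult z \<xi> = (LEAST m. m \<ge> 1 \<and> z \<xi> \<in> corad_filt scl comult m)"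

end

theory Submission
  imports Defs
begin

text \<open>
  Let \<open>H\<^sup>J\<close> be the span of the sorted words over an initial segment \<open>J\<close> of the letters.  Triangularity
  makes \<open>H\<^sup>J\<close> a subalgebra, and adding the next letter \<open>t\<close> gives an Ore extension: the
  commutation rule is \<open>z\<^sub>t r = \<sigma>(r) z\<^sub>t + \<delta>(r)\<close>, and \<open>\<sigma>\<close> is bijective because it is surjective on each
  of the finite dimensional pieces of the filtration by \<open>d\<close>.  Domination makes \<open>H\<^sup>J\<close> a subcoalgebra, and
  the antipode axiom, read along the same filtration, makes it stable under the antipode.  So the
  extensions from \<open>J\<^sub>1 = {\<xi>. d(\<xi>) = 1}\<close> (an initial segment, as \<open>d\<close> is monotone) to all letters form the
  chain, and it remains to identify \<open>H\<close> of \<open>J\<^sub>1\<close> with \<open>U(P(H))\<close>.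

  The point is that \<open>P(H)\<close> is spanned by the \<open>z\<^sub>\<xi>\<close> with \<open>\<xi> \<in> J\<^sub>1\<close>.  Let \<open>x\<close> be primitive with largest letter
  \<open>t\<close> and leading term \<open>a z\<^sub>t\<^sup>n\<close>.  A component of \<open>\<Delta>(x)\<close> equals \<open>n a\<close>, and in characteristic zero this
  bounds the degree of the leading term, except when \<open>n = 1\<close> and \<open>a\<close> is a scalar; then minimality of
  \<open>z\<^sub>t\<close> forces \<open>d(t) = 1\<close>.  For the induction on letters to work, primitivity has to be relaxed to hold
  modulo tensors of bounded degree.  Given this, the words in \<open>U(P(H))\<close> straighten to sorted words, whose images are
  linearly independent.
\<close>

interpretation free: vector_space "fscale :: 'k::field \<Rightarrow> ('x \<Rightarrow>\<^sub>0 'k) \<Rightarrow> ('x \<Rightarrow>\<^sub>0 'k)"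
  by (rule vector_space_fscale)

section \<open>Tensors and bilinear maps\<close>

text \<open>Works on representatives: \<open>p \<in> tensor_in scl A\<close> says that the coset of
  \<open>p\<close> lies in \<open>tensor_span scl A\<close>. On formal sums this is an ordinary
  subspace, so span arguments apply.\<close>

definition tensor_in ::
  "('k::field \<Rightarrow> 'v::ab_group_add \<Rightarrow> 'v) \<Rightarrow> ('v \<times> 'v) set \<Rightarrow> ('v \<times> 'v \<Rightarrow>\<^sub>0 'k) set"
  where "tensor_in scl A = {p. \<exists>q\<in>free.span (gen ` A). p - q \<in> tensor2_rel scl}"

lemma subspace_tensor2_rel: "free.subspace (tensor2_rel scl)"
  unfolding tensor2_rel_def by (rule free.subspace_span)

lemma subspace_tensor_in: "free.subspace (tensor_in scl A)"
proof (rule free.subspaceI)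
  show "0 \<in> tensor_in scl A"
    unfolding tensor_in_def using free.span_zero free.subspace_0[OF subspace_tensor2_rel] by force
next
  fix p q assume "p \<in> tensor_in scl A" "q \<in> tensor_in scl A"
  then obtain p' q' where *: "p' \<in> free.span (gen ` A)" "p - p' \<in> tensor2_rel scl"
    "q' \<in> free.span (gen ` A)" "q - q' \<in> tensor2_rel scl" by (auto simp: tensor_in_def)
  have "(p + q) - (p' + q') \<in> tensor2_rel scl"
    using free.subspace_add[OF subspace_tensor2_rel *(2,4)] by (simp add: algebra_simps)
  then show "p + q \<in> tensor_in scl A"
    using free.span_add[OF *(1,3)] by (auto simp: tensor_in_def)
next
  fix c p assume "p \<in> tensor_in scl A"
  then obtain p' where *: "p' \<in> free.span (gen ` A)" "p - p' \<in> tensor2_rel scl"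
    by (auto simp: tensor_in_def)
  have "fscale c p - fscale c p' \<in> tensor2_rel scl"
    using free.subspace_scale[OF subspace_tensor2_rel *(2), of c] by (simp add: free.scale_right_diff_distrib)
  then show "fscale c p \<in> tensor_in scl A"
    using free.span_scale[OF *(1)] by (auto simp: tensor_in_def)
qed

lemma span_gen_subset_tensor_in: "free.span (gen ` A) \<subseteq> tensor_in scl A"
  unfolding tensor_in_def using free.subspace_0[OF subspace_tensor2_rel] by force

lemma gen_in_tensor_in: "(a, b) \<in> A \<Longrightarrow> gen (a, b) \<in> tensor_in scl A"
  by (rule subsetD[OF span_gen_subset_tensor_in]) (auto intro: free.span_base)

lemma tensor_in_mono: "A \<subseteq> B \<Longrightarrow> tensor_in scl A \<subseteq> tensor_in scl B"
  unfolding tensor_in_def using free.span_mono[OF image_mono] by blast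

lemma gen_rel:
  "gen (x + x', y) - gen (x, y) - gen (x', y) \<in> tensor2_rel scl"
  "gen (x, y + y') - gen (x, y) - gen (x, y') \<in> tensor2_rel scl"
  "gen (scl c x, y) - fscale c (gen (x, y)) \<in> tensor2_rel scl"
  "gen (x, scl c y) - fscale c (gen (x, y)) \<in> tensor2_rel scl"
  unfolding tensor2_rel_def
     apply (rule free.span_base, (rule UnI1)+, blast)
    apply (rule free.span_base, rule UnI1, rule UnI1, rule UnI2, blast)
   apply (rule free.span_base, rule UnI1, rule UnI2, blast)
  apply (rule free.span_base, rule UnI2, blast)
  done

interpretation lin_ext_free: Vector_Spaces.linear
  "fscale :: 'k::field \<Rightarrow> ('x \<Rightarrow>\<^sub>0 'k) \<Rightarrow> ('x \<Rightarrow>\<^sub>0 'k)" "fscale :: 'k \<Rightarrow> ('y \<Rightarrow>\<^sub>0 'k) \<Rightarrow> ('y \<Rightarrow>\<^sub>0 'k)" "lin_ext fscale f"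
  for f by (rule linear_lin_ext[OF vector_space_fscale])

lemmas lin_ext_free_single = lin_ext_single[OF vector_space_fscale]

lemma tensor_mult_gen: "tensor_mult (gen (a, b)) (gen (c, d)) = gen (a * c, b * d)"
  by (simp add: tensor_mult_def lin_ext_free_single)

lemma tensor_mult_add_left: "tensor_mult (p + p') q = tensor_mult p q + tensor_mult p' q"
  unfolding tensor_mult_def by (rule lin_ext_free.add)

lemma tensor_mult_scale_left: "tensor_mult (fscale c p) q = fscale c (tensor_mult p q)"
  unfolding tensor_mult_def by (rule lin_ext_free.scale)

lemma tensor_mult_zero_left: "tensor_mult 0 q = 0"
  by (simp add: tensor_mult_def lin_ext_free.zero)

lemma lin_ext_add_fun:
  assumes "vector_space scl"
  shows "lin_ext scl (\<lambda>x. f x + g x) p = lin_ext scl f p + lin_ext scl g p"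
proof -
  interpret vector_space scl by fact
  show ?thesis by (simp add: lin_ext_def scale_right_distrib sum.distrib)
qed

lemma tensor_mult_add_right: "tensor_mult p (q + q') = tensor_mult p q + tensor_mult p q'"
  unfolding tensor_mult_def
  by (simp only: lin_ext_free.add case_prod_beta' lin_ext_add_fun[OF vector_space_fscale])

lemma lin_ext_scale_fun:
  assumes "vector_space scl"
  shows "lin_ext scl (\<lambda>x. scl c (f x)) p = scl c (lin_ext scl f p)"
proof -
  interpret vector_space scl by fact
  show ?thesis by (simp add: lin_ext_def scale_sum_right mult.commute)
qed

lemma tensor_mult_scale_right: "tensor_mult p (fscale c q) = fscale c (tensor_mult p q)"
  unfolding tensor_mult_def
  by (simp only: lin_ext_free.scale case_prod_beta' lin_ext_scale_fun[OF vector_space_fscale])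

lemma tensor_mult_zero_right: "tensor_mult p 0 = 0"
  using tensor_mult_scale_right[of p 0 0] by simp

lemma tensor_mult_span:
  assumes "p \<in> free.span (gen ` A)" "q \<in> free.span (gen ` B)"
    and C: "\<And>a b c d. (a, b) \<in> A \<Longrightarrow> (c, d) \<in> B \<Longrightarrow> (a * c, b * d) \<in> C"
  shows "tensor_mult p q \<in> free.span (gen ` C)"
proof -
  have *: "tensor_mult (gen (a, b)) q \<in> free.span (gen ` C)" if ab: "(a, b) \<in> A" for a b
    using assms(2)
  proof (rule free.span_induct)
    show "free.subspace {q. tensor_mult (gen (a, b)) q \<in> free.span (gen ` C)}"
      by (auto simp: free.subspace_def tensor_mult_add_right tensor_mult_scale_right
          tensor_mult_zero_right free.span_zero intro: free.span_add free.span_scale)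
  qed (use C[OF ab] in \<open>auto simp: tensor_mult_gen intro!: free.span_base\<close>)
  show ?thesis
    using assms(1)
  proof (rule free.span_induct)
    show "free.subspace {p. tensor_mult p q \<in> free.span (gen ` C)}"
      by (auto simp: free.subspace_def tensor_mult_add_left tensor_mult_scale_left
          tensor_mult_zero_left free.span_zero intro: free.span_add free.span_scale)
  qed (use * in auto)
qed

text \<open>Phrased on pairs to match the hypotheses of \<open>lin_ext_tensor2_rel\<close>
  literally.\<close>

definition bilin ::
  "('k::field \<Rightarrow> 'v::ab_group_add \<Rightarrow> 'v) \<Rightarrow> ('v \<times> 'v \<Rightarrow> 'v) \<Rightarrow> bool"
  where "bilin scl f \<longleftrightarrow>
    (\<forall>x x' y. f (x + x', y) = f (x, y) + f (x', y)) \<and>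
    (\<forall>x y y'. f (x, y + y') = f (x, y) + f (x, y')) \<and>
    (\<forall>c x y. f (scl c x, y) = scl c (f (x, y))) \<and>
    (\<forall>c x y. f (x, scl c y) = scl c (f (x, y)))"

section \<open>Representatives of coproducts and the subspaces they cut out\<close>

context hopf_algebra
begin

lemma vs: "vector_space scl" ..

interpretation lin_ext: Vector_Spaces.linear
  "fscale :: 'k \<Rightarrow> ('x \<Rightarrow>\<^sub>0 'k) \<Rightarrow> ('x \<Rightarrow>\<^sub>0 'k)" scl "lin_ext scl f" for f
  by (rule linear_lin_ext[OF vs])

lemma comult_eq_tensor: "p \<in> comult x \<Longrightarrow> comult x = tensor scl p"
proof -
  assume p: "p \<in> comult x"
  obtain p0 where p0: "comult x = tensor scl p0" using comult_tensor by blast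
  with p have "p - p0 \<in> tensor2_rel scl" by (simp add: tensor_def coset_def)
  then have "q - p0 \<in> tensor2_rel scl \<longleftrightarrow> q - p \<in> tensor2_rel scl" for q
    using free.subspace_add[OF subspace_tensor2_rel, of "q - p" scl "p - p0"]
      free.subspace_diff[OF subspace_tensor2_rel, of "q - p0" scl "p - p0"] by auto
  then show ?thesis by (simp add: p0 tensor_def coset_def)
qed

lemma tensor_self: "p \<in> tensor scl p"
  using free.subspace_0[OF subspace_tensor2_rel] by (simp add: tensor_def coset_def)

lemma comult_nonempty: obtains p where "p \<in> comult x"
  using comult_tensor[of x] tensor_self by auto

lemma comult_diff_rel: "p \<in> comult x \<Longrightarrow> q \<in> comult x \<Longrightarrow> p - q \<in> tensor2_rel scl"
  using comult_eq_tensor[of q x] unfolding tensor_def coset_def by blast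

lemma comult_tensor_span_iff:
  assumes p: "p \<in> comult x"
  shows "comult x \<in> tensor_span scl A \<longleftrightarrow> p \<in> tensor_in scl A"
proof
  assume "comult x \<in> tensor_span scl A"
  then obtain q where q: "q \<in> free.span (gen ` A)" "comult x = tensor scl q"
    by (auto simp: tensor_span_def)
  then have "p - q \<in> tensor2_rel scl" using comult_diff_rel[OF p] tensor_self by metis
  then show "p \<in> tensor_in scl A" using q by (auto simp: tensor_in_def)
next
  assume "p \<in> tensor_in scl A"
  then obtain q where q: "q \<in> free.span (gen ` A)" "p - q \<in> tensor2_rel scl"
    by (auto simp: tensor_in_def)
  then have "q - p \<in> tensor2_rel scl"
    using free.subspace_neg[OF subspace_tensor2_rel q(2)] by simp
  then have "q \<in> comult x" by (simp add: comult_eq_tensor[OF p] tensor_def coset_def)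
  from comult_eq_tensor[OF this] q(1) show "comult x \<in> tensor_span scl A"
    by (auto simp: tensor_span_def)
qed

text \<open>Bounds on coproducts are stated as membership in such a set. These are subspaces
  compatible with products, so a bound need only be checked on algebra generators.\<close>

definition comult_preimage :: "('h \<times> 'h) set \<Rightarrow> 'h set"
  where "comult_preimage A = {x. comult x \<in> tensor_span scl A}"

lemma comult_preimageI: "p \<in> comult x \<Longrightarrow> p \<in> tensor_in scl A \<Longrightarrow> x \<in> comult_preimage A"
  unfolding comult_preimage_def using comult_tensor_span_iff by blast

lemma comult_preimageD: "x \<in> comult_preimage A \<Longrightarrow> p \<in> comult x \<Longrightarrow> p \<in> tensor_in scl A"
  unfolding comult_preimage_def using comult_tensor_span_iff by blast

lemma comult_preimageE:
  assumes "x \<in> comult_preimage A"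
  obtains p where "p \<in> comult x" "p \<in> free.span (gen ` A)"
  using assms tensor_self by (auto simp: comult_preimage_def tensor_span_def)

lemma subspace_comult_preimage: "subspace (comult_preimage A)"
proof -
  note T = subspace_tensor_in[of scl A]
  have sc: "scl c x \<in> comult_preimage A" if "x \<in> comult_preimage A" for c x
  proof -
    obtain p where "p \<in> comult x" using comult_nonempty by blast
    then show ?thesis using that by (meson comult_preimageI comult_preimageD comult_scl free.subspace_scale[OF T])
  qed
  have ad: "x + y \<in> comult_preimage A" if "x \<in> comult_preimage A" "y \<in> comult_preimage A" for x y
  proof -
    obtain p q where "p \<in> comult x" "q \<in> comult y" using comult_nonempty by metis
    then show ?thesis using that by (meson comult_preimageI comult_preimageD comult_add free.subspace_add[OF T])
  qed
  \<comment> \<open>Scaling an arbitrary representative by 0 makes the zero formal sum a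
    representative of \<open>comult 0\<close>.\<close>
  obtain p where "p \<in> comult 0" using comult_nonempty by blast
  from comult_scl[OF this, of 0] have "0 \<in> comult 0" by simp
  then have "0 \<in> comult_preimage A" by (rule comult_preimageI) (rule free.subspace_0[OF T])
  with sc ad show ?thesis by (auto intro: subspaceI)
qed

lemma comult_preimage_mono: "A \<subseteq> B \<Longrightarrow> comult_preimage A \<subseteq> comult_preimage B"
proof
  fix x assume "A \<subseteq> B" and x: "x \<in> comult_preimage A"
  obtain p where p: "p \<in> comult x" using comult_nonempty by blast
  with x tensor_in_mono[OF \<open>A \<subseteq> B\<close>, of scl] show "x \<in> comult_preimage B"
    by (meson comult_preimageI comult_preimageD subsetD)
qed

lemma comult_preimage_mult:
  assumes "x \<in> comult_preimage A" "y \<in> comult_preimage B"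
    and "\<And>a b c d. (a, b) \<in> A \<Longrightarrow> (c, d) \<in> B \<Longrightarrow> (a * c, b * d) \<in> C"
  shows "x * y \<in> comult_preimage C"
proof -
  obtain p q where "p \<in> comult x" "p \<in> free.span (gen ` A)" "q \<in> comult y" "q \<in> free.span (gen ` B)"
    using assms(1,2) by (metis comult_preimageE)
  note pq = this
  have "tensor_mult p q \<in> free.span (gen ` C)"
    using pq(2,4) assms(3) by (rule tensor_mult_span)
  then have "tensor_mult p q \<in> tensor_in scl C" using span_gen_subset_tensor_in by blast
  with comult_mult[OF pq(1,3)] show ?thesis by (rule comult_preimageI)
qed

lemma one_in_comult_preimage: "(1, 1) \<in> A \<Longrightarrow> 1 \<in> comult_preimage A"
  by (rule comult_preimageI[of "gen (1, 1)"]) (auto simp: comult_one tensor_self gen_in_tensor_in)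

text \<open>For bilinear \<open>f\<close> the map \<open>conv f\<close> is \<open>f \<circ> \<Delta>\<close>.\<close>

definition conv :: "('h \<times> 'h \<Rightarrow> 'h) \<Rightarrow> 'h \<Rightarrow> 'h"
  where "conv f x = lin_ext scl f (SOME p. p \<in> comult x)"

text \<open>A bilinear map respects the relations \<open>tensor2_rel\<close>, so the representative
  chosen by \<open>SOME\<close> is immaterial.\<close>

lemma conv_eq:
  assumes "bilin scl f" "p \<in> comult x"
  shows "conv f x = lin_ext scl f p"
  unfolding conv_def
proof (rule lin_ext_tensor2_rel[OF vs])
  show "(SOME p. p \<in> comult x) - p \<in> tensor2_rel scl"
    using assms(2) by (intro comult_diff_rel[of _ x]) (auto intro: someI)
qed (use assms(1) in \<open>auto simp: bilin_def\<close>)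

lemma conv_add: "bilin scl f \<Longrightarrow> conv f (x + y) = conv f x + conv f y"
proof -
  assume f: "bilin scl f"
  obtain p q where "p \<in> comult x" "q \<in> comult y" using comult_nonempty by metis
  then show ?thesis by (simp add: conv_eq[OF f comult_add] conv_eq[OF f] lin_ext.add)
qed

lemma lin_ext_in_subspace:
  assumes "p \<in> free.span (gen ` A)" "subspace S" "\<And>a b. (a, b) \<in> A \<Longrightarrow> f (a, b) \<in> S"
  shows "lin_ext scl f p \<in> S"
  using assms(1)
proof (rule free.span_induct)
  show "free.subspace {p. lin_ext scl f p \<in> S}"
    using assms(2) by (auto simp: free.subspace_def subspace_def lin_ext.add lin_ext.scale lin_ext.zero)
qed (use assms(3) in \<open>auto simp: lin_ext_single[OF vs]\<close>)

lemma conv_in_subspace: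
  assumes "bilin scl f" "x \<in> comult_preimage A" "subspace S" "\<And>a b. (a, b) \<in> A \<Longrightarrow> f (a, b) \<in> S"
  shows "conv f x \<in> S"
proof -
  obtain p where "p \<in> comult x" "p \<in> free.span (gen ` A)" using assms(2) by (rule comult_preimageE)
  with lin_ext_in_subspace[OF _ assms(3), of p A f] assms(4) show ?thesis
    by (simp add: conv_eq[OF assms(1)])
qed

lemma counit_add: "counit (x + y) = counit x + counit y"
  and counit_scl: "counit (scl c x) = c * counit x"
proof -
  interpret c: Vector_Spaces.linear scl "(*)" counit by (rule counit_linear)
  show "counit (x + y) = counit x + counit y" "counit (scl c x) = c * counit x"
    by (rule c.add, rule c.scale)
qed

lemma antipode_scl: "antipode (scl c x) = scl c (antipode x)"
proof -
  interpret s: Vector_Spaces.linear scl scl antipode by (rule antipode_linear)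
  show ?thesis by (rule s.scale)
qed

end


section \<open>Filtrations by PBW words\<close>

lemma word_prod_simps [simp]:
  "word_prod z [] = 1" "word_prod z (x # W) = z x * word_prod z W"
  "word_prod z (U @ W) = word_prod z U * word_prod z W"
  "word_prod z (replicate n x) = z x ^ n"
  by (induction n) (simp_all add: word_prod_def)

lemma word_deg_simps [simp]:
  "word_deg w [] = 0" "word_deg w (x # W) = w x + word_deg w W"
  "word_deg w (U @ W) = word_deg w U + word_deg w W"
  "word_deg w (replicate n x) = n * w x"
  by (simp_all add: word_deg_def sum_list_replicate)

lemma word_deg_zero: "(\<And>x. x \<in> set W \<Longrightarrow> w x = 0) \<Longrightarrow> word_deg w W = 0"
  by (induction W) auto

lemma ndec_words_mono: "J \<subseteq> K \<Longrightarrow> ndec_words J \<subseteq> ndec_words K"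
  by (auto simp: ndec_words_def)

lemma Nil_in_ndec_words [simp]: "[] \<in> ndec_words J"
  by (simp add: ndec_words_def)

lemma ndec_words_append_replicate:
  assumes "U \<in> ndec_words J" "\<forall>x\<in>J. x < t"
  shows "U @ replicate k t \<in> ndec_words (insert t J)"
  using assms by (fastforce simp: ndec_words_def sorted_append)

text \<open>In a sorted word all copies of the largest letter stand at the end. Elements on
  \<open>insert t J\<close> thus become polynomials in \<open>z t\<close>, with coefficients on
  \<open>J\<close> written to the left.\<close>

lemma ndec_words_insertE:
  assumes "W \<in> ndec_words (insert t J)" "\<forall>x\<in>J. x < t"
  obtains U k where "U \<in> ndec_words J" "W = U @ replicate k t"
proof -
  have "\<exists>U k. U \<in> ndec_words J \<and> W = U @ replicate k t"
    using assms(1)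
  proof (induction W)
    case Nil
    show ?case by (intro exI[of _ "[]"] exI[of _ 0]) simp
  next
    case (Cons x W)
    then obtain U k where U: "U \<in> ndec_words J" "W = U @ replicate k t"
      by (auto simp: ndec_words_def)
    show ?case
    proof (cases "x = t")
      case True
      with Cons.prems U assms(2) have "U = []"
        by (cases U) (fastforce simp: ndec_words_def)+
      with True U show ?thesis by (intro exI[of _ "[]"] exI[of _ "Suc k"]) simp
    next
      case False
      with Cons.prems U have "x # U \<in> ndec_words J" by (auto simp: ndec_words_def)
      with U show ?thesis by (intro exI[of _ "x # U"] exI[of _ k]) simp
    qed
  qed
  with that show thesis by blast
qed

text \<open>Against a one-letter word the common suffix is empty, so the last letter of
  \<open>P\<close> is below \<xi>, and sortedness carries this to all its letters.\<close>

lemma less_r_singleton: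
  assumes "less_r P [\<xi>]" "P \<in> ndec_words I"
  shows "P \<in> ndec_words (I \<inter> {..<\<xi>})"
proof -
  from assms(1) obtain W1 W2 W3 \<eta> \<xi>' where *: "P = W1 @ [\<eta>] @ W3" "[\<xi>] = W2 @ [\<xi>'] @ W3" "\<eta> < \<xi>'"
    by (auto simp: less_r_def)
  from *(2) have "W3 = []" "\<xi>' = \<xi>" by (cases W2; auto)+
  with * assms(2) show ?thesis by (fastforce simp: ndec_words_def sorted_append)
qed

text \<open>Here \<open>d\<close> is any positive order-preserving degree for which the three
  conditions hold; the final theorem instantiates it with \<open>corad_deg\<close>.\<close>

locale pbw_hopf = hopf_algebra scl comult counit antipode
  for scl :: "'k::field_char_0 \<Rightarrow> 'h::ring_1 \<Rightarrow> 'h" and comult counit antipode +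
  fixes I :: "'i::linorder set" and z :: "'i \<Rightarrow> 'h" and d :: "'i \<Rightarrow> nat"
  assumes finite_I: "finite I"
    and pbw: "pbw_generating_system scl I z"
    and minimal: "d_minimal scl comult I z d"
    and triangular: "d_triangular scl I z d"
    and dominated: "comult_dominated scl comult I z d"
    and d_mono: "order_preserving I d"
    and d_pos: "\<xi> \<in> I \<Longrightarrow> 0 < d \<xi>"
begin

definition filt :: "('i \<Rightarrow> nat) \<Rightarrow> 'i set \<Rightarrow> nat \<Rightarrow> 'h set"
  where "filt w J m = span (word_prod z ` {W \<in> ndec_words J. word_deg w W \<le> m})"

definition down :: "'i set \<Rightarrow> bool"
  where "down J \<longleftrightarrow> J \<subseteq> I \<and> (\<forall>\<xi>\<in>J. \<forall>\<eta>\<in>I. \<eta> < \<xi> \<longrightarrow> \<eta> \<in> J)"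

text \<open>
  The weights in use: \<open>d\<close>, the zero weight (for which \<open>filt\<close> is the whole span of the sorted words on
  \<open>J\<close>), and the weight that counts the occurrences of the largest letter of \<open>J\<close>.
\<close>

definition admissible :: "'i set \<Rightarrow> ('i \<Rightarrow> nat) \<Rightarrow> bool"
  where "admissible J w \<longleftrightarrow> down J \<and> (w = d \<or> (\<forall>\<xi>\<in>J. \<forall>\<eta>\<in>J. \<eta> < \<xi> \<longrightarrow> w \<eta> = 0))"

lemma subspace_filt: "subspace (filt w J m)"
  by (simp add: filt_def subspace_span)

lemma word_prod_in_filt: "W \<in> ndec_words J \<Longrightarrow> word_deg w W \<le> m \<Longrightarrow> word_prod z W \<in> filt w J m"
  unfolding filt_def by (intro span_base imageI) simp

lemma filt_subsetI:
  assumes "subspace S" "\<And>W. W \<in> ndec_words J \<Longrightarrow> word_deg w W \<le> m \<Longrightarrow> word_prod z W \<in> S"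
  shows "filt w J m \<subseteq> S"
  unfolding filt_def by (rule span_minimal) (use assms in auto)

lemma filt_weight_mono:
  assumes "J \<subseteq> K"
    "\<And>W. W \<in> ndec_words J \<Longrightarrow> word_deg w W \<le> m \<Longrightarrow> word_deg w' W \<le> n"
  shows "filt w J m \<subseteq> filt w' K n"
  using assms ndec_words_mono[OF assms(1)]
  by (intro filt_subsetI subspace_filt word_prod_in_filt) auto

lemma filt_mono: "J \<subseteq> K \<Longrightarrow> m \<le> n \<Longrightarrow> filt w J m \<subseteq> filt w K n"
  by (rule filt_weight_mono) auto

lemma one_in_filt: "1 \<in> filt w J m"
  using word_prod_in_filt[of "[]"] by simp

lemma gen_in_filt: "\<xi> \<in> J \<Longrightarrow> w \<xi> \<le> m \<Longrightarrow> z \<xi> \<in> filt w J m"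
  using word_prod_in_filt[of "[\<xi>]"] by (simp add: ndec_words_def)

lemma down_Int: "down J \<Longrightarrow> \<xi> \<in> J \<Longrightarrow> J \<inter> {..<\<xi>} = I \<inter> {..<\<xi>}"
  by (auto simp: down_def)

lemma down_remove_max: "down (insert t J) \<Longrightarrow> (\<forall>x\<in>J. x < t) \<Longrightarrow> down J"
  unfolding down_def using order.strict_trans by blast

lemma down_I: "down I"
  by (auto simp: down_def)

lemma admissible_remove_max: "admissible (insert t J) w \<Longrightarrow> (\<forall>x\<in>J. x < t) \<Longrightarrow> admissible J w"
  unfolding admissible_def using down_remove_max by blast

lemma admissible_zero: "down J \<Longrightarrow> admissible J (\<lambda>_. 0)"
  by (simp add: admissible_def)

lemma admissible_d: "down J \<Longrightarrow> admissible J d"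
  by (simp add: admissible_def)

text \<open>Makes the normal form \<open>a * x + b\<close> of a commutation rule accessible to span
  arguments.\<close>

lemma subspace_add_mult:
  assumes "subspace A" "subspace B"
  shows "subspace {a * x + b | a b. a \<in> A \<and> b \<in> B}"
proof (rule subspaceI)
  show "0 \<in> {a * x + b | a b. a \<in> A \<and> b \<in> B}"
    using subspace_0[OF assms(1)] subspace_0[OF assms(2)] by force
next
  fix u v assume "u \<in> {a * x + b | a b. a \<in> A \<and> b \<in> B}" "v \<in> {a * x + b | a b. a \<in> A \<and> b \<in> B}"
  then obtain a b a' b' where *: "u = a * x + b" "v = a' * x + b'" "a \<in> A" "b \<in> B" "a' \<in> A" "b' \<in> B"
    by blast
  then have "u + v = (a + a') * x + (b + b')" by (simp add: algebra_simps)
  with * show "u + v \<in> {a * x + b | a b. a \<in> A \<and> b \<in> B}"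
    using subspace_add[OF assms(1)] subspace_add[OF assms(2)] by blast
next
  fix c u assume "u \<in> {a * x + b | a b. a \<in> A \<and> b \<in> B}"
  then obtain a b where *: "u = a * x + b" "a \<in> A" "b \<in> B" by blast
  then have "scl c u = scl c a * x + scl c b" by (simp add: scale_right_distrib scl_mult_left)
  with * show "scl c u \<in> {a * x + b | a b. a \<in> A \<and> b \<in> B}"
    using subspace_scale[OF assms(1)] subspace_scale[OF assms(2)] by blast
qed

lemma subspace_left_mult: "subspace S \<Longrightarrow> subspace {x. a * x \<in> S}"
  and subspace_right_mult: "subspace S \<Longrightarrow> subspace {x. x * a \<in> S}"
  by (auto simp: subspace_def distrib_left distrib_right scl_mult_left scl_mult_right)

text \<open>A correction word below \<eta>\<xi> either ends in \<xi>, preceded only by letters below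
  \<eta>, or has all its letters below \<xi>. The first kind is collected in
  \<open>a * z \<xi>\<close>, the second in \<open>b\<close>, which is the shape of an Ore
  commutation rule.\<close>

lemma triangular_d:
  assumes "\<eta> \<in> I" "\<xi> \<in> I" "\<eta> < \<xi>"
  shows "\<exists>c a b. c \<noteq> 0 \<and> a \<in> filt d (I \<inter> {..<\<eta>}) (d \<eta>) \<and> b \<in> filt d (I \<inter> {..<\<xi>}) (d \<eta> + d \<xi>) \<and>
    z \<xi> * z \<eta> = (scl c (z \<eta>) + a) * z \<xi> + b"
proof -
  let ?S = "{a * z \<xi> + b | a b. a \<in> filt d (I \<inter> {..<\<eta>}) (d \<eta>) \<and> b \<in> filt d (I \<inter> {..<\<xi>}) (d \<eta> + d \<xi>)}"
  let ?T = "{word_prod z W | W. W \<in> ndec_words_pos I \<and> word_deg d W \<le> word_deg d [\<eta>, \<xi>] \<and>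
          less_rlex W [\<eta>, \<xi>]}"
  obtain c s where cs: "c \<noteq> 0" "s \<in> span ?T" "z \<xi> * z \<eta> = scl c (z \<eta> * z \<xi>) + s"
    using triangular assms unfolding d_triangular_def by blast
  have "?T \<subseteq> ?S"
  proof
    fix x assume "x \<in> ?T"
    then obtain W where W: "x = word_prod z W" "W \<in> ndec_words I" "W \<noteq> []"
      "word_deg d W \<le> d \<eta> + d \<xi>" "less_rlex W [\<eta>, \<xi>]" by (auto simp: ndec_words_pos_def)
    consider "strict_suffix W [\<eta>, \<xi>]" | "less_r W [\<eta>, \<xi>]" using W(5) by (auto simp: less_rlex_def)
    then show "x \<in> ?S"
    proof cases
      case 1
      with W(3) have "W = [\<xi>]"
        by (auto simp: strict_suffix_def suffix_Cons)
      with W(1) have "x = 1 * z \<xi> + 0" by simp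
      then show ?thesis using one_in_filt subspace_0[OF subspace_filt] by blast
    next
      case 2
      then obtain W1 W2 W3 \<eta>' \<xi>' where *: "W = W1 @ [\<eta>'] @ W3" "[\<eta>, \<xi>] = W2 @ [\<xi>'] @ W3" "\<eta>' < \<xi>'"
        by (auto simp: less_r_def)
      \<comment> \<open>The first difference, read from the right, occurs at \<xi> or at
        \<eta>.\<close>
      from *(2) consider "W3 = []" "\<xi>' = \<xi>" | "W3 = [\<xi>]" "\<xi>' = \<eta>"
        by (auto simp: Cons_eq_append_conv)
      then show ?thesis
      proof cases
        case 1
        with * W have "W \<in> ndec_words (I \<inter> {..<\<xi>})" by (fastforce simp: ndec_words_def sorted_append)
        with W have "x = 0 * z \<xi> + x" "x \<in> filt d (I \<inter> {..<\<xi>}) (d \<eta> + d \<xi>)"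
          by (auto intro: word_prod_in_filt)
        then show ?thesis using subspace_0[OF subspace_filt] by blast
      next
        case 2
        with * W have "W1 @ [\<eta>'] \<in> ndec_words (I \<inter> {..<\<eta>})" "word_deg d (W1 @ [\<eta>']) \<le> d \<eta>"
          by (fastforce simp: ndec_words_def sorted_append)+
        then have "word_prod z (W1 @ [\<eta>']) \<in> filt d (I \<inter> {..<\<eta>}) (d \<eta>)" by (rule word_prod_in_filt)
        moreover have "x = word_prod z (W1 @ [\<eta>']) * z \<xi> + 0" using * W 2 by (simp add: mult.assoc)
        ultimately show ?thesis using subspace_0[OF subspace_filt] by blast
      qed
    qed
  qed
  then have "span ?T \<subseteq> ?S" by (rule span_minimal[OF _ subspace_add_mult[OF subspace_filt subspace_filt]])
  from subsetD[OF this cs(2)]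
  obtain a b where ab: "s = a * z \<xi> + b" "a \<in> filt d (I \<inter> {..<\<eta>}) (d \<eta>)"
    "b \<in> filt d (I \<inter> {..<\<xi>}) (d \<eta> + d \<xi>)" by blast
  then have "z \<xi> * z \<eta> = (scl c (z \<eta>) + a) * z \<xi> + b"
    using cs(3) by (simp add: distrib_right scl_mult_left algebra_simps)
  with cs(1) ab show ?thesis by blast
qed

text \<open>For a weight other than \<open>d\<close>, every letter below a letter of
  \<open>J\<close> has weight 0, so the degree bounds on the corrections hold trivially.\<close>

lemma triangular_admissible:
  assumes J: "admissible J w" and "\<eta> \<in> J" "\<xi> \<in> J" "\<eta> < \<xi>"
  shows "\<exists>c a b. c \<noteq> 0 \<and> a \<in> filt w (J \<inter> {..<\<eta>}) (w \<eta>) \<and> b \<in> filt w (J \<inter> {..<\<xi>}) (w \<eta> + w \<xi>) \<and>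
    z \<xi> * z \<eta> = (scl c (z \<eta>) + a) * z \<xi> + b"
proof -
  have JI: "down J" "J \<subseteq> I" using J by (auto simp: admissible_def down_def)
  have mono: "filt d (I \<inter> {..<\<zeta>}) m \<subseteq> filt w (J \<inter> {..<\<zeta>}) n" if "\<zeta> \<in> J" "w = d \<Longrightarrow> m \<le> n" for \<zeta> m n
  proof (rule filt_weight_mono)
    show "I \<inter> {..<\<zeta>} \<subseteq> J \<inter> {..<\<zeta>}" using down_Int[OF JI(1) that(1)] by simp
    fix W assume W: "W \<in> ndec_words (I \<inter> {..<\<zeta>})" "word_deg d W \<le> m"
    show "word_deg w W \<le> n"
    proof (cases "w = d")
      case False
      with J have "\<And>\<eta>. \<eta> \<in> J \<Longrightarrow> \<eta> < \<zeta> \<Longrightarrow> w \<eta> = 0" using that(1) by (auto simp: admissible_def)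
      moreover have "set W \<subseteq> J \<inter> {..<\<zeta>}" using W(1) down_Int[OF JI(1) that(1)] by (auto simp: ndec_words_def)
      ultimately show ?thesis using word_deg_zero[of W w] by fastforce
    qed (use W that in auto)
  qed
  show ?thesis
    using triangular_d[of \<eta> \<xi>] mono[of \<eta> "d \<eta>" "w \<eta>"] mono[of \<xi> "d \<eta> + d \<xi>" "w \<eta> + w \<xi>"] assms(2-) JI(2) by blast
qed

lemma dominated_admissible:
  assumes J: "admissible J w" and "\<xi> \<in> J"
  shows "\<exists>s\<in>free.span (gen ` {(word_prod z P, word_prod z Q) | P Q.
      P \<in> ndec_words (J \<inter> {..<\<xi>}) \<and> P \<noteq> [] \<and> Q \<in> ndec_words (J \<inter> {..<\<xi>}) \<and> Q \<noteq> [] \<and>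
      word_deg w P + word_deg w Q \<le> w \<xi>}).
    gen (1, z \<xi>) + gen (z \<xi>, 1) + s \<in> comult (z \<xi>)"
proof -
  let ?A = "{gen (word_prod z P, word_prod z Q) | P Q. P \<in> ndec_words_pos I \<and> Q \<in> ndec_words_pos I \<and>
          word_deg d (P @ Q) \<le> d \<xi> \<and> less_r P [\<xi>] \<and> less_r Q [\<xi>]} :: ('h \<times> 'h \<Rightarrow>\<^sub>0 'k) set"
  let ?B = "{(word_prod z P, word_prod z Q) | P Q.
      P \<in> ndec_words (J \<inter> {..<\<xi>}) \<and> P \<noteq> [] \<and> Q \<in> ndec_words (J \<inter> {..<\<xi>}) \<and> Q \<noteq> [] \<and>
      word_deg w P + word_deg w Q \<le> w \<xi>}"
  have JI: "down J" "\<xi> \<in> I" using assms by (auto simp: admissible_def down_def)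
  obtain s where s: "s \<in> free.span ?A" "comult (z \<xi>) = tensor scl (gen (1, z \<xi>) + gen (z \<xi>, 1) + s)"
    using dominated JI(2) unfolding comult_dominated_def by blast
  have "?A \<subseteq> gen ` ?B"
  proof
    fix x :: "'h \<times> 'h \<Rightarrow>\<^sub>0 'k" assume "x \<in> ?A"
    then obtain P Q where PQ: "x = gen (word_prod z P, word_prod z Q)" "P \<in> ndec_words I" "P \<noteq> []"
      "Q \<in> ndec_words I" "Q \<noteq> []" "word_deg d P + word_deg d Q \<le> d \<xi>" "less_r P [\<xi>]" "less_r Q [\<xi>]"
      by (auto simp: ndec_words_pos_def)
    have *: "P \<in> ndec_words (J \<inter> {..<\<xi>})" "Q \<in> ndec_words (J \<inter> {..<\<xi>})"
      using PQ by (simp_all add: less_r_singleton down_Int[OF JI(1) assms(2)])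
    have "word_deg w P + word_deg w Q \<le> w \<xi>"
    proof (cases "w = d")
      case False
      with J have "\<And>\<eta>. \<eta> \<in> J \<Longrightarrow> \<eta> < \<xi> \<Longrightarrow> w \<eta> = 0" using assms(2) by (auto simp: admissible_def)
      with * have "word_deg w P = 0" "word_deg w Q = 0"
        by (auto simp: ndec_words_def intro!: word_deg_zero)
      then show ?thesis by simp
    qed (use PQ in simp)
    with * PQ show "x \<in> gen ` ?B" by blast
  qed
  with s free.span_mono tensor_self show ?thesis by blast
qed

lemma filt_times_power:
  assumes "a \<in> filt w J i" "\<forall>x\<in>J. x < t" "i + k * w t \<le> m"
  shows "a * z t ^ k \<in> filt w (insert t J) m"
proof -
  have "subspace {a. a * z t ^ k \<in> filt w (insert t J) m}"
    by (rule subspace_right_mult[OF subspace_filt])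
  moreover have "word_prod z U * z t ^ k \<in> filt w (insert t J) m" if "U \<in> ndec_words J" "word_deg w U \<le> i" for U
    using word_prod_in_filt[OF ndec_words_append_replicate[OF that(1) assms(2), where k = k], where w = w and m = m]
      that assms(3) by simp
  ultimately have "filt w J i \<subseteq> {a. a * z t ^ k \<in> filt w (insert t J) m}" by (intro filt_subsetI) auto
  with assms(1) show ?thesis by blast
qed

text \<open>The standard reduction when the top letter \<open>t\<close> is adjoined: a containment
  is checked on the spanning products \<open>a * z t ^ k\<close>.\<close>

lemma filt_insert_subsetI:
  assumes "subspace S" "\<forall>x\<in>J. x < t"
    and "\<And>a i k. a \<in> filt w J i \<Longrightarrow> i + k * w t \<le> m \<Longrightarrow> a * z t ^ k \<in> S"
  shows "filt w (insert t J) m \<subseteq> S"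
proof (rule filt_subsetI[OF assms(1)])
  fix W assume W: "W \<in> ndec_words (insert t J)" "word_deg w W \<le> m"
  from ndec_words_insertE[OF this(1) assms(2)] obtain U k where U: "U \<in> ndec_words J" "W = U @ replicate k t" by blast
  with W show "word_prod z W \<in> S"
    using assms(3)[OF word_prod_in_filt[OF U(1) order_refl], of k] by simp
qed

lemma finite_down: "down J \<Longrightarrow> finite J"
  using finite_I finite_subset by (auto simp: down_def)

text \<open>\<open>z t\<close> is moved past the letters of a word one at a time; each move produces
  new coefficients on \<open>J\<close> only. Closure of the filtration on \<open>J\<close> under
  products is a hypothesis because the lemma is used inside the induction that proves it.\<close>

lemma swap_generator:
  assumes J: "admissible (insert t J) w" and lt: "\<forall>x\<in>J. x < t"
    and closed: "\<forall>i j. \<forall>x\<in>filt w J i. \<forall>y\<in>filt w J j. x * y \<in> filt w J (i + j)"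
    and a: "a \<in> filt w J i"
  shows "\<exists>a'\<in>filt w J i. \<exists>b'\<in>filt w J (i + w t). z t * a = a' * z t + b'"
proof -
  have mult: "x * y \<in> filt w J (i + j)" if "x \<in> filt w J i" "y \<in> filt w J j" for i j x y
    using closed that by blast
  have tJ: "insert t J \<inter> {..<t} = J" using lt by auto
  let ?S = "\<lambda>i. {a * z t + b | a b. a \<in> filt w J i \<and> b \<in> filt w J (i + w t)}"
  have word: "z t * word_prod z W \<in> ?S (word_deg w W)" if "W \<in> ndec_words J" for W
    using that
  proof (induction W)
    case Nil
    have "z t * word_prod z [] = 1 * z t + 0" by simp
    then show ?case using one_in_filt subspace_0[OF subspace_filt] by blast
  next
    case (Cons x W)
    then have x: "x \<in> J" "W \<in> ndec_words J" by (auto simp: ndec_words_def)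
    from Cons.IH[OF x(2)] obtain a' b' where IH: "z t * word_prod z W = a' * z t + b'"
      "a' \<in> filt w J (word_deg w W)" "b' \<in> filt w J (word_deg w W + w t)" by blast
    obtain c a b where cab: "a \<in> filt w (insert t J \<inter> {..<x}) (w x)" "b \<in> filt w J (w x + w t)"
      "z t * z x = (scl c (z x) + a) * z t + b"
      using triangular_admissible[OF J, of x t] x(1) lt tJ by auto
    have sub: "insert t J \<inter> {..<x} \<subseteq> J" using lt x(1) by auto
    have a: "scl c (z x) + a \<in> filt w J (w x)"
      using cab(1) filt_mono[OF sub order_refl] gen_in_filt[OF x(1)]
      by (blast intro: subspace_add[OF subspace_filt] subspace_scale[OF subspace_filt])
    have W: "word_prod z W \<in> filt w J (word_deg w W)" by (rule word_prod_in_filt[OF x(2)]) simp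
    have "z t * word_prod z (x # W) = (z t * z x) * word_prod z W"
      by (simp add: mult.assoc)
    also have "\<dots> = (scl c (z x) + a) * (z t * word_prod z W) + b * word_prod z W"
      by (simp add: cab(3) distrib_right mult.assoc)
    also have "\<dots> = ((scl c (z x) + a) * a') * z t + ((scl c (z x) + a) * b' + b * word_prod z W)"
      unfolding IH(1) by (simp only: distrib_left mult.assoc add.assoc)
    finally have eq: "z t * word_prod z (x # W) =
      ((scl c (z x) + a) * a') * z t + ((scl c (z x) + a) * b' + b * word_prod z W)" .
    have "(scl c (z x) + a) * a' \<in> filt w J (word_deg w (x # W))"
      using mult[OF a IH(2)] by simp
    moreover have "(scl c (z x) + a) * b' \<in> filt w J (word_deg w (x # W) + w t)"
      using mult[OF a IH(3)] by (simp add: add.assoc)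
    moreover have "b * word_prod z W \<in> filt w J (word_deg w (x # W) + w t)"
      using mult[OF cab(2) W] by (simp add: add_ac)
    ultimately show ?case
      unfolding eq using subspace_add[OF subspace_filt] by blast
  qed
  have "subspace {a. z t * a \<in> ?S i}"
    by (rule subspace_left_mult) (rule subspace_add_mult[OF subspace_filt subspace_filt])
  moreover have "z t * word_prod z W \<in> ?S i" if "W \<in> ndec_words J" "word_deg w W \<le> i" for W
    using word[OF that(1)] filt_mono[OF order_refl that(2), of w J] that(2)
      filt_mono[OF order_refl, of "word_deg w W + w t" "i + w t" w J] by fastforce
  ultimately have "filt w J i \<subseteq> {a. z t * a \<in> ?S i}" by (intro filt_subsetI) auto
  with a show ?thesis by blast
qed

text \<open>Induction on the top letter. In \<open>(a * z t ^ k) * (b * z t ^ l)\<close> the power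
  \<open>z t ^ k\<close> is moved past \<open>b\<close> by repeated swaps; what remains is
  multiplication by \<open>a\<close> on the left and by \<open>z t ^ l\<close> on the right, both
  compatible with the normal form.\<close>

lemma filt_mult:
  assumes "admissible J w" "x \<in> filt w J i" "y \<in> filt w J j"
  shows "x * y \<in> filt w J (i + j)"
proof -
  have "finite J" using assms(1) finite_down by (auto simp: admissible_def)
  then show ?thesis using assms
  proof (induction J arbitrary: x y i j rule: finite_linorder_max_induct)
    case empty
    have "filt w {} i = span {1}" for i
    proof -
      have "{W \<in> ndec_words {}. word_deg w W \<le> i} = {[]}" by (auto simp: ndec_words_def)
      then show ?thesis by (simp add: filt_def)
    qed
    with empty show ?case by (auto simp: span_singleton scl_mult_left)
  next
    case (insert t J)
    have lt: "\<forall>x\<in>J. x < t" by (rule insert.hyps(2))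
    have JJ: "admissible J w" by (rule admissible_remove_max[OF insert.prems(1) lt])
    note mult = insert.IH[OF JJ]
    then have closed: "\<forall>i j. \<forall>x\<in>filt w J i. \<forall>y\<in>filt w J j. x * y \<in> filt w J (i + j)" by blast
    let ?F = "filt w (insert t J)"
    note F = subspace_filt[of w "insert t J"]
    have left: "a * x \<in> ?F (i + j)" if "a \<in> filt w J i" "x \<in> ?F j" for a x i j
    proof -
      have "subspace {x. a * x \<in> ?F (i + j)}"
        by (rule subspace_left_mult[OF F])
      then have "?F j \<subseteq> {x. a * x \<in> ?F (i + j)}"
      proof (rule filt_insert_subsetI[OF _ lt])
        fix a' i' k assume "a' \<in> filt w J i'" "i' + k * w t \<le> j"
        then show "a' * z t ^ k \<in> {x. a * x \<in> ?F (i + j)}"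
          using filt_times_power[OF mult[OF that(1)] lt, of a' i' k "i + j"] by (simp add: mult.assoc)
      qed
      with that show ?thesis by blast
    qed
    have right: "x * z t ^ k \<in> ?F (i + k * w t)" if "x \<in> ?F i" for x i k
    proof -
      have "subspace {x. x * z t ^ k \<in> ?F (i + k * w t)}"
        by (rule subspace_right_mult[OF F])
      then have "?F i \<subseteq> {x. x * z t ^ k \<in> ?F (i + k * w t)}"
      proof (rule filt_insert_subsetI[OF _ lt])
        fix a' i' k' assume "a' \<in> filt w J i'" "i' + k' * w t \<le> i"
        then show "a' * z t ^ k' \<in> {x. x * z t ^ k \<in> ?F (i + k * w t)}"
          using filt_times_power[OF _ lt, of a' w i' "k' + k" "i + k * w t"]
          by (simp add: mult.assoc power_add add_mult_distrib)
      qed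
      with that show ?thesis by blast
    qed
    have pow: "z t ^ k * a \<in> ?F (i + k * w t)" if "a \<in> filt w J i" for a i k
      using that
    proof (induction k arbitrary: a i)
      case 0
      then show ?case using filt_mono[of J "insert t J" i i w] by auto
    next
      case (Suc k)
      from swap_generator[OF insert.prems(1) lt closed Suc.prems] obtain a' b' where
        ab: "a' \<in> filt w J i" "b' \<in> filt w J (i + w t)" "z t * a = a' * z t + b'" by blast
      have "z t ^ Suc k * a = z t ^ k * a' * z t ^ 1 + z t ^ k * b'"
        by (simp only: power_Suc2 mult.assoc ab(3) distrib_left power_one_right)
      moreover have "z t ^ k * a' * z t ^ 1 \<in> ?F (i + Suc k * w t)"
        using right[OF Suc.IH[OF ab(1)], of 1] by (simp add: add_ac)
      moreover have "z t ^ k * b' \<in> ?F (i + Suc k * w t)"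
        using Suc.IH[OF ab(2)] by (simp add: add_ac)
      ultimately show ?case using subspace_add[OF F] by simp
    qed
    have "subspace {x. x * y \<in> ?F (i + j)}"
      by (rule subspace_right_mult[OF F])
    then have "?F i \<subseteq> {x. x * y \<in> ?F (i + j)}"
    proof (rule filt_insert_subsetI[OF _ lt])
      fix a i' k assume a: "a \<in> filt w J i'" "i' + k * w t \<le> i"
      have "subspace {y. a * z t ^ k * y \<in> ?F (i + j)}"
        by (rule subspace_left_mult[OF F])
      then have "?F j \<subseteq> {y. a * z t ^ k * y \<in> ?F (i + j)}"
      proof (rule filt_insert_subsetI[OF _ lt])
        fix b j' l assume b: "b \<in> filt w J j'" "j' + l * w t \<le> j"
        have "a * (z t ^ k * b * z t ^ l) \<in> ?F (i' + (j' + k * w t + l * w t))"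
          by (rule left[OF a(1) right[OF pow[OF b(1)]]])
        also have "\<dots> \<subseteq> ?F (i + j)" using a b by (intro filt_mono) auto
        finally show "b * z t ^ l \<in> {y. a * z t ^ k * y \<in> ?F (i + j)}" by (simp add: mult.assoc)
      qed
      with insert.prems(3) show "a * z t ^ k \<in> {x. x * y \<in> ?F (i + j)}" by blast
    qed
    with insert.prems(2) show ?case by blast
  qed
qed

section \<open>The induced filtration on tensors, given by its generating pairs\<close>

definition tfilt :: "('i \<Rightarrow> nat) \<Rightarrow> 'i set \<Rightarrow> nat \<Rightarrow> ('h \<times> 'h) set"
  where "tfilt w J m = {(a, b). \<exists>i j. i + j \<le> m \<and> a \<in> filt w J i \<and> b \<in> filt w J j}"

lemma tfiltI: "a \<in> filt w J i \<Longrightarrow> b \<in> filt w J j \<Longrightarrow> i + j \<le> m \<Longrightarrow> (a, b) \<in> tfilt w J m"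
  unfolding tfilt_def by blast

lemma tfilt_mono: "J \<subseteq> K \<Longrightarrow> m \<le> n \<Longrightarrow> tfilt w J m \<subseteq> tfilt w K n"
  using filt_mono[of J K, OF _ order_refl] by (auto simp: tfilt_def) (meson order_trans subsetD)

lemma tfilt_mult:
  "admissible J w \<Longrightarrow> (a, b) \<in> tfilt w J m \<Longrightarrow> (a', b') \<in> tfilt w J n \<Longrightarrow> (a * a', b * b') \<in> tfilt w J (m + n)"
proof -
  assume J: "admissible J w" and "(a, b) \<in> tfilt w J m" "(a', b') \<in> tfilt w J n"
  then obtain i j i' j' where *: "i + j \<le> m" "a \<in> filt w J i" "b \<in> filt w J j"
    "i' + j' \<le> n" "a' \<in> filt w J i'" "b' \<in> filt w J j'" by (auto simp: tfilt_def)
  show ?thesis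
    by (rule tfiltI[OF filt_mult[OF J *(2,5)] filt_mult[OF J *(3,6)]]) (use * in simp)
qed

lemma comult_generator:
  assumes "admissible J w" "\<xi> \<in> J"
  shows "z \<xi> \<in> comult_preimage (tfilt w J (w \<xi>))"
proof -
  from dominated_admissible[OF assms] obtain s where s:
    "s \<in> free.span (gen ` {(word_prod z P, word_prod z Q) | P Q.
      P \<in> ndec_words (J \<inter> {..<\<xi>}) \<and> P \<noteq> [] \<and> Q \<in> ndec_words (J \<inter> {..<\<xi>}) \<and> Q \<noteq> [] \<and>
      word_deg w P + word_deg w Q \<le> w \<xi>})" (is "s \<in> free.span (gen ` ?B)")
    "gen (1, z \<xi>) + gen (z \<xi>, 1) + s \<in> comult (z \<xi>)" by blast
  have "?B \<subseteq> tfilt w J (w \<xi>)"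
    using ndec_words_mono[of "J \<inter> {..<\<xi>}" J] by (auto intro!: tfiltI word_prod_in_filt)
  from subsetD[OF tensor_in_mono[OF this] subsetD[OF span_gen_subset_tensor_in s(1)]]
  have "s \<in> tensor_in scl (tfilt w J (w \<xi>))" .
  moreover have "gen (1, z \<xi>) \<in> tensor_in scl (tfilt w J (w \<xi>))" "gen (z \<xi>, 1) \<in> tensor_in scl (tfilt w J (w \<xi>))"
    using tfiltI[OF one_in_filt[of w J 0] gen_in_filt[OF assms(2) order_refl]]
      tfiltI[OF gen_in_filt[OF assms(2) order_refl] one_in_filt[of w J 0]]
    by (simp_all add: gen_in_tensor_in)
  ultimately show ?thesis
    by (intro comult_preimageI[OF s(2)] free.subspace_add[OF subspace_tensor_in])
qed

text \<open>Domination gives the bound on each generator, and multiplicativity of the coproduct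
  extends it to words.\<close>

lemma comult_filt:
  assumes "admissible J w"
  shows "filt w J m \<subseteq> comult_preimage (tfilt w J m)"
proof (rule filt_subsetI[OF subspace_comult_preimage])
  fix W assume W: "W \<in> ndec_words J" "word_deg w W \<le> m"
  have "word_prod z W \<in> comult_preimage (tfilt w J (word_deg w W))"
    using W(1)
  proof (induction W)
    case Nil
    show ?case by (auto intro!: one_in_comult_preimage tfiltI[of _ _ _ 0 _ 0] one_in_filt)
  next
    case (Cons x W)
    then have "x \<in> J" "W \<in> ndec_words J" by (auto simp: ndec_words_def)
    then show ?case
      using comult_preimage_mult[OF comult_generator[OF assms] Cons.IH tfilt_mult[OF assms]] by simp
  qed
  then show "word_prod z W \<in> comult_preimage (tfilt w J m)"
    using comult_preimage_mono[OF tfilt_mono[OF order_refl W(2)]] by blast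
qed

end


section \<open>Coefficients and primitive elements\<close>

lemma (in hopf_algebra) one_neq_zero_hopf: "(1::'h) \<noteq> 0"
  using counit_one counit_scl[of 0 0] by auto

lemma (in hopf_algebra) comult_rel_closed: "p \<in> comult x \<Longrightarrow> q - p \<in> tensor2_rel scl \<Longrightarrow> q \<in> comult x"
  using comult_eq_tensor[of p x] unfolding tensor_def coset_def by blast

section \<open>Coefficient maps for the PBW basis\<close>

context pbw_hopf
begin

text \<open>The target is left general: it is \<open>H\<close> itself for the coefficient maps and
  the free vector space on words when the map from the enveloping algebra is shown to be
  injective.\<close>

lemma ex_linear_on_basis:
  assumes "vector_space s"
  shows "\<exists>g. Vector_Spaces.linear scl s g \<and> (\<forall>W\<in>ndec_words I. g (word_prod z W) = f W)"
proof -
  interpret vector_space_pair scl s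
    by (intro vector_space_pair.intro vs assms)
  have inj: "inj_on (word_prod z) (ndec_words I)" and ind: "independent (word_prod z ` ndec_words I)"
    using pbw by (auto simp: pbw_generating_system_def)
  obtain g where "Vector_Spaces.linear scl s g"
    "\<forall>x\<in>word_prod z ` ndec_words I. g x = f (the_inv_into (ndec_words I) (word_prod z) x)"
    using linear_independent_extend[OF ind, of "\<lambda>x. f (the_inv_into (ndec_words I) (word_prod z) x)"] by blast
  then show ?thesis by (auto simp: the_inv_into_f_f[OF inj] intro!: exI[of _ g])
qed

text \<open>\<open>coeff t n\<close> is the coefficient of \<open>z t ^ n\<close> on the span of the sorted words with letters up to \<open>t\<close>, and
  vanishes on the other basis words.\<close>

definition coeff :: "'i \<Rightarrow> nat \<Rightarrow> 'h \<Rightarrow> 'h"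
  where "coeff t n = (SOME g. Vector_Spaces.linear scl scl g \<and> (\<forall>W\<in>ndec_words I. g (word_prod z W) =
    (if set W \<subseteq> {..t} \<and> count_list W t = n then word_prod z (filter (\<lambda>x. x \<noteq> t) W) else 0)))"

lemma coeff_spec: "Vector_Spaces.linear scl scl (coeff t n) \<and> (\<forall>W\<in>ndec_words I. coeff t n (word_prod z W) =
    (if set W \<subseteq> {..t} \<and> count_list W t = n then word_prod z (filter (\<lambda>x. x \<noteq> t) W) else 0))"
  unfolding coeff_def by (rule someI_ex[OF ex_linear_on_basis[OF vs]])

lemma coeff_word: "W \<in> ndec_words I \<Longrightarrow> coeff t n (word_prod z W) =
    (if set W \<subseteq> {..t} \<and> count_list W t = n then word_prod z (filter (\<lambda>x. x \<noteq> t) W) else 0)"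
  using coeff_spec by blast

lemma linear_coeff: "Vector_Spaces.linear scl scl (coeff t n)"
  using coeff_spec by blast

lemma coeff_add: "coeff t n (x + y) = coeff t n x + coeff t n y"
  and coeff_scl: "coeff t n (scl c x) = scl c (coeff t n x)"
  and coeff_zero: "coeff t n 0 = 0"
proof -
  interpret c: Vector_Spaces.linear scl scl "coeff t n" by (rule linear_coeff)
  show "coeff t n (x + y) = coeff t n x + coeff t n y" "coeff t n (scl c x) = scl c (coeff t n x)"
    "coeff t n 0 = 0"
    by (rule c.add, rule c.scale, rule c.zero)
qed

lemma coeff_one: "coeff t n 1 = (if n = 0 then 1 else 0)"
  using coeff_word[of "[]" t n] by auto

lemma coeff_times_power:
  assumes "insert t J \<subseteq> I" "\<forall>x\<in>J. x < t" "a \<in> filt w J i"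
  shows "coeff t n (a * z t ^ k) = (if k = n then a else 0)"
proof -
  have "subspace {a. coeff t n (a * z t ^ k) = (if k = n then a else 0)}"
    by (auto simp: subspace_def coeff_add coeff_scl coeff_zero distrib_right scl_mult_left)
  moreover have "coeff t n (word_prod z U * z t ^ k) = (if k = n then word_prod z U else 0)"
    if U: "U \<in> ndec_words J" for U
  proof -
    have "U @ replicate k t \<in> ndec_words I"
      using ndec_words_append_replicate[OF U assms(2)] ndec_words_mono[OF assms(1)] by blast
    moreover have "set U \<subseteq> {..<t}" using U assms(2) by (auto simp: ndec_words_def)
    moreover from this have "count_list U t = 0" "filter (\<lambda>x. x \<noteq> t) U = U"
      by (auto simp: count_list_0_iff filter_id_conv)
    moreover have "count_list (replicate k t) t = k" by (induction k) auto
    ultimately show ?thesis using coeff_word[of "U @ replicate k t" t n]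
      by (auto simp: less_imp_le subset_iff)
  qed
  ultimately have "filt w J i \<subseteq> {a. coeff t n (a * z t ^ k) = (if k = n then a else 0)}"
    by (intro filt_subsetI) auto
  with assms(3) show ?thesis by blast
qed

text \<open>Deleting \<open>n\<close> copies of \<open>t\<close> lowers the weight by
  \<open>n * w t\<close>. The case split guards against truncated subtraction: a word of weight
  below \<open>n * w t\<close> cannot contain \<open>n\<close> copies.\<close>

lemma coeff_filt:
  assumes "x \<in> filt w I m"
  shows "coeff t n x \<in> (if n * w t \<le> m then filt w (I \<inter> {..<t}) (m - n * w t) else {0})"
proof -
  let ?S = "if n * w t \<le> m then filt w (I \<inter> {..<t}) (m - n * w t) else {0}"
  have S: "subspace ?S" using subspace_filt by (simp add: subspace_0)
  have "subspace {x. coeff t n x \<in> ?S}"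
    using subspace_0[OF S] subspace_add[OF S] subspace_scale[OF S]
    by (simp only: subspace_def mem_Collect_eq coeff_add coeff_scl coeff_zero) blast
  moreover have "coeff t n (word_prod z W) \<in> ?S" if W: "W \<in> ndec_words I" "word_deg w W \<le> m" for W
  proof (cases "set W \<subseteq> {..t} \<and> count_list W t = n")
    case True
    have "word_deg w W = word_deg w (filter (\<lambda>x. x \<noteq> t) W) + count_list W t * w t"
      by (induction W) auto
    with True W have "n * w t \<le> m" "word_deg w (filter (\<lambda>x. x \<noteq> t) W) \<le> m - n * w t" by auto
    moreover have "filter (\<lambda>x. x \<noteq> t) W \<in> ndec_words (I \<inter> {..<t})"
      using W True by (auto simp: ndec_words_def sorted_filter[of "\<lambda>x. x" for x, simplified]
          order.strict_iff_order)
    ultimately show ?thesis using True by (simp add: coeff_word[OF W(1)] word_prod_in_filt)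
  next
    case False
    then show ?thesis using subspace_0[OF S] by (simp only: coeff_word[OF W(1)] if_False)
  qed
  ultimately have "filt w I m \<subseteq> {x. coeff t n x \<in> ?S}" by (intro filt_subsetI) auto
  with assms show ?thesis by blast
qed

text \<open>Powers of \<open>z t\<close> stand on the right in the normal form, so right
  multiplication by \<open>z t\<close> shifts the exponent without any straightening.\<close>

lemma coeff_times_generator:
  assumes "insert t J \<subseteq> I" "\<forall>x\<in>J. x < t" "x \<in> filt w (insert t J) m"
  shows "coeff t n (x * z t) = (if n = 0 then 0 else coeff t (n - 1) x)"
proof -
  have "subspace {x. coeff t n (x * z t) = (if n = 0 then 0 else coeff t (n - 1) x)}"
    by (auto simp: subspace_def coeff_add coeff_scl coeff_zero distrib_right scl_mult_left)
  then have "filt w (insert t J) m \<subseteq> {x. coeff t n (x * z t) = (if n = 0 then 0 else coeff t (n - 1) x)}"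
  proof (rule filt_insert_subsetI[OF _ assms(2)])
    fix a i k assume a: "a \<in> filt w J i" "i + k * w t \<le> m"
    have "a * z t ^ k * z t = a * z t ^ Suc k"
      by (simp only: mult.assoc power_Suc2)
    then show "a * z t ^ k \<in> {x. coeff t n (x * z t) = (if n = 0 then 0 else coeff t (n - 1) x)}"
      by (auto simp: coeff_times_power[OF assms(1,2) a(1)] simp del: power_Suc)
  qed
  with assms(3) show ?thesis by blast
qed

text \<open>By induction the counit kills the left factors of the correction terms, which are
  nonempty words in smaller letters. The counit axiom then reads
  \<open>z \<xi> = z \<xi> + scl (counit (z \<xi>)) 1\<close>.\<close>

lemma counit_generator: "\<xi> \<in> I \<Longrightarrow> counit (z \<xi>) = 0"
\<comment> \<open>The order on the letter type need not be well-founded, so the induction counts the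
  smaller letters in the finite set \<open>I\<close>.\<close>
proof (induction "card (I \<inter> {..<\<xi>})" arbitrary: \<xi> rule: less_induct)
  case less
  have IH: "counit (z \<eta>) = 0" if "\<eta> \<in> I" "\<eta> < \<xi>" for \<eta>
  proof (rule less.hyps[OF _ that(1)])
    have "I \<inter> {..<\<eta>} \<subset> I \<inter> {..<\<xi>}" using that by (auto dest: order.strict_trans)
    then show "card (I \<inter> {..<\<eta>}) < card (I \<inter> {..<\<xi>})" using finite_I by (intro psubset_card_mono) auto
  qed
  from dominated_admissible[OF admissible_d[OF down_I] less.prems] obtain s where s:
    "s \<in> free.span (gen ` {(word_prod z P, word_prod z Q) | P Q.
      P \<in> ndec_words (I \<inter> {..<\<xi>}) \<and> P \<noteq> [] \<and> Q \<in> ndec_words (I \<inter> {..<\<xi>}) \<and> Q \<noteq> [] \<and>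
      word_deg d P + word_deg d Q \<le> d \<xi>})"
    "gen (1, z \<xi>) + gen (z \<xi>, 1) + s \<in> comult (z \<xi>)" by blast
  interpret le: Vector_Spaces.linear fscale scl "lin_ext scl (\<lambda>(a, b). scl (counit a) b)"
    by (rule linear_lin_ext[OF vs])
  have "lin_ext scl (\<lambda>(a, b). scl (counit a) b) s \<in> {0}"
    by (rule lin_ext_in_subspace[OF s(1)])
      (auto simp: subspace_0 neq_Nil_conv ndec_words_def counit_mult IH)
  with counit_left[OF s(2)] have "scl (counit (z \<xi>)) 1 = 0"
    by (simp add: le.add lin_ext_single[OF vs] counit_one)
  then show ?case using one_neq_zero_hopf by simp
qed

text \<open>Terms with a positive power of \<open>z t\<close> vanish under the multiplicative
  counit.\<close>

lemma counit_coeff_zero: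
  assumes "insert t J \<subseteq> I" "\<forall>x\<in>J. x < t" "x \<in> filt w (insert t J) m"
  shows "counit (coeff t 0 x) = counit x"
proof -
  have "subspace {x. counit (coeff t 0 x) = counit x}"
    using counit_scl[of 0 0] by (auto simp: subspace_def coeff_add coeff_scl coeff_zero counit_add counit_scl)
  then have "filt w (insert t J) m \<subseteq> {x. counit (coeff t 0 x) = counit x}"
  proof (rule filt_insert_subsetI[OF _ assms(2)])
    fix a i k assume a: "a \<in> filt w J i" "i + k * w t \<le> m"
    have "counit (a * z t ^ k) = (if k = 0 then counit a else 0)"
      using counit_generator[of t] assms(1) by (cases k) (auto simp: counit_mult)
    then show "a * z t ^ k \<in> {x. counit (coeff t 0 x) = counit x}"
      using counit_scl[of 0 0] by (auto simp: coeff_times_power[OF assms(1,2) a(1)])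
  qed
  with assms(3) show ?thesis by blast
qed

section \<open>Reading off a leading coefficient from the coproduct\<close>

definition letter_weight :: "'i \<Rightarrow> 'i \<Rightarrow> nat"
  where "letter_weight t x = (if x = t then 1 else 0)"

lemma admissible_letter_weight:
  "down (insert t J) \<Longrightarrow> \<forall>x\<in>J. x < t \<Longrightarrow> admissible (insert t J) (letter_weight t)"
  by (auto simp: admissible_def letter_weight_def)

lemma filt_letter_weight: "\<forall>x\<in>J. x < t \<Longrightarrow> filt (letter_weight t) J i = filt (\<lambda>_. 0) J 0"
proof -
  assume "\<forall>x\<in>J. x < t"
  then have "word_deg (letter_weight t) W = 0" if "W \<in> ndec_words J" for W
    using that by (auto simp: ndec_words_def letter_weight_def intro!: word_deg_zero)
  then show ?thesis by (intro antisym filt_weight_mono) (auto simp: word_deg_zero)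
qed

text \<open>The filtration by any weight is exhaustive.\<close>

lemma filt_zero_obtain_degree:
  assumes "x \<in> filt (\<lambda>_. 0) J 0"
  obtains n where "x \<in> filt w J n"
proof -
  have mono: "filt w J m \<subseteq> filt w J (m + n)" "filt w J n \<subseteq> filt w J (m + n)" for m n
    by (rule filt_mono; simp)+
  have "subspace {x. \<exists>n. x \<in> filt w J n}"
  proof (rule subspaceI)
    fix x y assume "x \<in> {x. \<exists>n. x \<in> filt w J n}" "y \<in> {x. \<exists>n. x \<in> filt w J n}"
    then obtain m n where "x \<in> filt w J m" "y \<in> filt w J n" by blast
    then have "x + y \<in> filt w J (m + n)"
      by (intro subspace_add[OF subspace_filt] subsetD[OF mono(1)] subsetD[OF mono(2)])
    then show "x + y \<in> {x. \<exists>n. x \<in> filt w J n}" by blast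
  next
    show "0 \<in> {x. \<exists>n. x \<in> filt w J n}"
      using subspace_0[OF subspace_filt[of w J 0]] by blast
  next
    fix c x assume "x \<in> {x. \<exists>n. x \<in> filt w J n}"
    then show "scl c x \<in> {x. \<exists>n. x \<in> filt w J n}"
      using subspace_scale[OF subspace_filt[of w J]] by blast
  qed
  then have "filt (\<lambda>_. 0) J 0 \<subseteq> {x. \<exists>n. x \<in> filt w J n}"
    by (rule filt_subsetI) (use word_prod_in_filt in blast)
  with assms that show thesis by blast
qed

lemma filt_subset_zero: "filt w J m \<subseteq> filt (\<lambda>_. 0) J 0"
  by (intro filt_weight_mono) (auto simp: word_deg_zero)

lemma remove_leading_term:
  assumes "insert t J \<subseteq> I" "\<forall>x\<in>J. x < t" "x \<in> filt (letter_weight t) (insert t J) (Suc n)"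
  shows "x - coeff t (Suc n) x * z t ^ Suc n \<in> filt (letter_weight t) (insert t J) n"
proof -
  let ?F = "filt (letter_weight t) (insert t J) n"
  have "subspace {x. x - coeff t (Suc n) x * z t ^ Suc n \<in> ?F}"
  proof (rule subspaceI)
    fix x y assume "x \<in> {x. x - coeff t (Suc n) x * z t ^ Suc n \<in> ?F}" "y \<in> {x. x - coeff t (Suc n) x * z t ^ Suc n \<in> ?F}"
    then have "(x - coeff t (Suc n) x * z t ^ Suc n) + (y - coeff t (Suc n) y * z t ^ Suc n) \<in> ?F"
      by (auto intro: subspace_add[OF subspace_filt])
    then show "x + y \<in> {x. x - coeff t (Suc n) x * z t ^ Suc n \<in> ?F}"
      by (simp add: coeff_add distrib_right algebra_simps)
  next
    fix c x assume "x \<in> {x. x - coeff t (Suc n) x * z t ^ Suc n \<in> ?F}"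
    then have "scl c (x - coeff t (Suc n) x * z t ^ Suc n) \<in> ?F"
      by (auto intro: subspace_scale[OF subspace_filt])
    then show "scl c x \<in> {x. x - coeff t (Suc n) x * z t ^ Suc n \<in> ?F}"
      by (simp add: coeff_scl scale_right_diff_distrib scl_mult_left)
  qed (simp add: coeff_zero subspace_0[OF subspace_filt])
  then have "filt (letter_weight t) (insert t J) (Suc n) \<subseteq> {x. x - coeff t (Suc n) x * z t ^ Suc n \<in> ?F}"
  proof (rule filt_insert_subsetI[OF _ assms(2)])
    fix a i k assume a: "a \<in> filt (letter_weight t) J i" "i + k * letter_weight t t \<le> Suc n"
    show "a * z t ^ k \<in> {x. x - coeff t (Suc n) x * z t ^ Suc n \<in> ?F}"
    proof (cases "k = Suc n")
      case True
      then show ?thesis by (simp add: coeff_times_power[OF assms(1,2) a(1)] subspace_0[OF subspace_filt] del: power_Suc)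
    next
      case False
      have "a \<in> filt (letter_weight t) J 0" using a(1) by (simp add: filt_letter_weight[OF assms(2)])
      from filt_times_power[OF this assms(2)] have "a * z t ^ k \<in> ?F"
        using False a(2) by (simp add: letter_weight_def)
      with False show ?thesis by (simp add: coeff_times_power[OF assms(1,2) a(1)] del: power_Suc)
    qed
  qed
  with assms(3) show ?thesis by blast
qed

text \<open>
  Modulo terms of smaller total degree in \<open>z t\<close>, \<open>\<Delta>(a z\<^sup>n) = \<Delta>(a) (1 \<otimes> z + z \<otimes> 1)\<^sup>n\<close>.  Applying
  (the coefficient of the word \<open>t\<close>) \<open>\<otimes>\<close> (the coefficient of \<open>z\<^sup>n\<^sup>-\<^sup>1\<close>) therefore returns \<open>n a\<close>, which
  recovers the leading coefficient of an element from its comultiplication in characteristic zero.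
\<close>

definition leading_form :: "'i \<Rightarrow> nat \<Rightarrow> 'h \<times> 'h \<Rightarrow> 'h"
  where "leading_form t n = (\<lambda>(a, b). scl (counit (coeff t 1 a)) (coeff t n b))"

lemma bilin_leading_form: "bilin scl (leading_form t n)"
  by (simp add: bilin_def leading_form_def coeff_add coeff_scl counit_add counit_scl
      scale_left_distrib scale_right_distrib mult.commute)

lemma counit_zero: "counit 0 = 0"
  using counit_scl[of 0 0] by simp

text \<open>One \<open>t\<close> is taken from the left factor and \<open>n\<close> from the right,
  which costs \<open>Suc n * w t\<close> in total. If one of the factors has too little weight, its
  coefficient vanishes.\<close>

lemma leading_form_tfilt:
  assumes "(a, b) \<in> tfilt w I m"
  shows "leading_form t n (a, b) \<in>
    (if Suc n * w t \<le> m then filt w (I \<inter> {..<t}) (m - Suc n * w t) else {0})"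
proof -
  obtain i j where ij: "i + j \<le> m" "a \<in> filt w I i" "b \<in> filt w I j"
    using assms by (auto simp: tfilt_def)
  note a = coeff_filt[OF ij(2), of t 1] and b = coeff_filt[OF ij(3), of t n]
  show ?thesis
  proof (cases "w t \<le> i \<and> n * w t \<le> j")
    case True
    with ij(1) have "Suc n * w t \<le> m" "j - n * w t \<le> m - Suc n * w t" by auto
    moreover from True b filt_mono[OF order_refl this(2), of w "I \<inter> {..<t}"]
    have "coeff t n b \<in> filt w (I \<inter> {..<t}) (m - Suc n * w t)" by auto
    ultimately show ?thesis by (simp add: leading_form_def subspace_scale[OF subspace_filt])
  next
    case False
    with a b have "coeff t 1 a = 0 \<or> coeff t n b = 0" by auto
    then have "leading_form t n (a, b) = 0" by (auto simp: leading_form_def counit_zero)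
    then show ?thesis using subspace_0[OF subspace_filt] by simp
  qed
qed

lemma leading_form_letter_weight:
  assumes "(a, b) \<in> tfilt (letter_weight t) J n" "J \<subseteq> I"
  shows "leading_form t n (a, b) = 0"
proof -
  have "(a, b) \<in> tfilt (letter_weight t) I n" using assms tfilt_mono[of J I n n] by blast
  from leading_form_tfilt[OF this, of t n] show ?thesis by (simp add: letter_weight_def)
qed

text \<open>Multiply the coproduct of \<open>x\<close> by
  \<open>1 \<otimes> z t + z t \<otimes> 1 + s\<close>. The term \<open>1 \<otimes> z t\<close>
  lowers the index of the form by one; \<open>z t \<otimes> 1\<close> turns the left factor into its
  counit, which gives \<open>coeff t n x\<close>; and \<open>s\<close> contributes nothing, since it
  contains no \<open>t\<close>.\<close>

lemma conv_leading_form_times_generator: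
  assumes J: "down (insert t J)" "\<forall>x\<in>J. x < t" and x: "x \<in> filt (letter_weight t) (insert t J) n"
  shows "conv (leading_form t n) (x * z t) =
    coeff t n x + (if n = 0 then 0 else conv (leading_form t (n - 1)) x)"
proof -
  let ?w = "letter_weight t" and ?J = "insert t J"
  have JI: "?J \<subseteq> I" using J(1) by (simp add: down_def)
  note adm = admissible_letter_weight[OF J]
  obtain p where p: "p \<in> comult x" "p \<in> free.span (gen ` tfilt ?w ?J n)"
    using comult_filt[OF adm] x comult_preimageE by blast
  from dominated_admissible[OF adm, of t] obtain s where s:
    "s \<in> free.span (gen ` {(word_prod z P, word_prod z Q) | P Q.
      P \<in> ndec_words (?J \<inter> {..<t}) \<and> P \<noteq> [] \<and> Q \<in> ndec_words (?J \<inter> {..<t}) \<and> Q \<noteq> [] \<and>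
      word_deg ?w P + word_deg ?w Q \<le> ?w t})" (is "s \<in> free.span (gen ` ?B)")
    "gen (1, z t) + gen (z t, 1) + s \<in> comult (z t)" by blast
  let ?q = "gen (1, z t) + gen (z t, 1) + s :: 'h \<times> 'h \<Rightarrow>\<^sub>0 'k"
  interpret f: Vector_Spaces.linear fscale scl "lin_ext scl g" for g :: "'h \<times> 'h \<Rightarrow> 'h"
    by (rule linear_lin_ext[OF vs])
  have B: "?B \<subseteq> tfilt ?w ?J 0"
  proof (clarify)
    fix P Q assume PQ: "P \<in> ndec_words (?J \<inter> {..<t})" "Q \<in> ndec_words (?J \<inter> {..<t})"
    then have "word_deg ?w P = 0" "word_deg ?w Q = 0"
      by (auto simp: ndec_words_def letter_weight_def intro!: word_deg_zero)
    moreover have "P \<in> ndec_words ?J" "Q \<in> ndec_words ?J"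
      using PQ ndec_words_mono[of "?J \<inter> {..<t}" ?J] by blast+
    ultimately show "(word_prod z P, word_prod z Q) \<in> tfilt ?w ?J 0"
      by (intro tfiltI[of _ _ _ 0 _ 0] word_prod_in_filt) auto
  qed
  \<comment> \<open>Kept linear in the representative \<open>p\<close> for the span induction; only
    afterwards does the counit axiom collapse the first summand to
    \<open>coeff t n x\<close>.\<close>
  have "lin_ext scl (leading_form t n) (tensor_mult p ?q) =
    coeff t n (lin_ext scl (\<lambda>(a, b). scl (counit a) b) p) +
    (if n = 0 then 0 else lin_ext scl (leading_form t (n - 1)) p)" (is "?P p")
    using p(2)
  proof (rule free.span_induct)
    show "free.subspace {p. ?P p}"
      by (auto simp: free.subspace_def tensor_mult_add_left tensor_mult_scale_left tensor_mult_zero_left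
          f.add f.scale f.zero coeff_add coeff_scl coeff_zero scale_right_distrib)
  next
    fix u :: "'h \<times> 'h \<Rightarrow>\<^sub>0 'k" assume "u \<in> gen ` tfilt ?w ?J n"
    then obtain a b where u: "u = gen (a, b)" and ab: "(a, b) \<in> tfilt ?w ?J n" by auto
    then obtain i j where ij: "i + j \<le> n" "a \<in> filt ?w ?J i" "b \<in> filt ?w ?J j"
      by (auto simp: tfilt_def)
    have "tensor_mult (gen (a, b)) s \<in> free.span (gen ` tfilt ?w ?J n)"
    proof (rule tensor_mult_span[OF _ s(1)])
      show "gen (a, b) \<in> free.span (gen ` {(a, b)})" by (rule free.span_base) simp
      fix a' b' a'' b'' assume "(a', b') \<in> {(a, b)}" "(a'', b'') \<in> ?B"
      then show "(a' * a'', b' * b'') \<in> tfilt ?w ?J n"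
        using tfilt_mult[OF adm ab, of a'' b'' 0] B by auto
    qed
    then have s0: "lin_ext scl (leading_form t n) (tensor_mult (gen (a, b)) s) \<in> {0}"
      by (rule lin_ext_in_subspace) (auto simp: subspace_0 leading_form_letter_weight[OF _ JI])
    have "leading_form t n (a, b * z t) = (if n = 0 then 0 else leading_form t (n - 1) (a, b))"
      by (simp add: leading_form_def coeff_times_generator[OF JI J(2) ij(3)])
    moreover have "leading_form t n (a * z t, b) = coeff t n (scl (counit a) b)"
      by (simp add: leading_form_def coeff_times_generator[OF JI J(2) ij(2)]
          counit_coeff_zero[OF JI J(2) ij(2)] coeff_scl)
    ultimately show "?P u"
      using s0 by (simp add: u tensor_mult_add_right tensor_mult_gen f.add lin_ext_single[OF vs])
  qed
  then show ?thesis
    using conv_eq[OF bilin_leading_form comult_mult[OF p(1) s(2)]] counit_left[OF p(1)]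
      conv_eq[OF bilin_leading_form p(1)] by simp
qed

text \<open>Each further factor \<open>z t\<close> contributes one more copy of
  \<open>a\<close>.\<close>

lemma conv_leading_form_power:
  assumes J: "down (insert t J)" "\<forall>x\<in>J. x < t" and a: "a \<in> filt (\<lambda>_. 0) J 0"
  shows "conv (leading_form t n) (a * z t ^ Suc n) = scl (of_nat (Suc n)) a"
proof (induction n)
  case 0
  have "a \<in> filt (letter_weight t) (insert t J) 0"
    using a filt_letter_weight[OF J(2), of 0] filt_mono[of J "insert t J" 0 0] by blast
  moreover have "coeff t 0 a = a"
    using coeff_times_power[OF _ J(2) a, of 0 0] J(1) by (simp add: down_def)
  ultimately show ?case using conv_leading_form_times_generator[OF J] by simp
next
  case (Suc n)
  have "a \<in> filt (letter_weight t) J 0" using a by (simp add: filt_letter_weight[OF J(2)])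
  from filt_times_power[OF this J(2), of "Suc n" "Suc n"]
  have "a * z t ^ Suc n \<in> filt (letter_weight t) (insert t J) (Suc n)" by (simp add: letter_weight_def)
  from conv_leading_form_times_generator[OF J this]
  have "conv (leading_form t (Suc n)) (a * z t ^ Suc n * z t) =
    coeff t (Suc n) (a * z t ^ Suc n) + scl (of_nat (Suc n)) a"
    using Suc.IH by simp
  moreover have "coeff t (Suc n) (a * z t ^ Suc n) = a"
    using coeff_times_power[OF _ J(2) a, of "Suc n" "Suc n"] J(1) by (simp add: down_def)
  moreover have "a * z t ^ Suc n * z t = a * z t ^ Suc (Suc n)"
    by (simp only: mult.assoc power_Suc2)
  moreover have "scl (of_nat (Suc (Suc n))) a = a + scl (of_nat (Suc n)) a"
    using scale_left_distrib[of 1 "of_nat (Suc n)" a] by simp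
  ultimately show ?case by simp
qed

lemma conv_leading_form_zero:
  assumes J: "down (insert t J)" "\<forall>x\<in>J. x < t" and x: "x \<in> filt (letter_weight t) (insert t J) n"
  shows "conv (leading_form t n) x = 0"
proof -
  have "insert t J \<subseteq> I" using J(1) by (simp add: down_def)
  then have "conv (leading_form t n) x \<in> {0}"
    using comult_filt[OF admissible_letter_weight[OF J]] x
    by (intro conv_in_subspace[OF bilin_leading_form])
      (auto simp: subspace_0 leading_form_letter_weight)
  then show ?thesis by simp
qed

text \<open>After the leading term is removed, the rest has degree at most \<open>n\<close> in
  \<open>t\<close>, while the form needs \<open>Suc n\<close> copies; so only the leading term
  contributes.\<close>

lemma conv_leading_form:
  assumes J: "down (insert t J)" "\<forall>x\<in>J. x < t" and x: "x \<in> filt (letter_weight t) (insert t J) (Suc n)"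
  shows "conv (leading_form t n) x = scl (of_nat (Suc n)) (coeff t (Suc n) x)"
proof -
  have JI: "insert t J \<subseteq> I" using J(1) by (simp add: down_def)
  have eq: "I \<inter> {..<t} = J" using down_Int[OF J(1), of t] J(2) by auto
  have "x \<in> filt (letter_weight t) I (Suc n)" using x filt_mono[OF JI order_refl] by blast
  from coeff_filt[OF this, of t "Suc n"] have a: "coeff t (Suc n) x \<in> filt (\<lambda>_. 0) J 0"
    by (simp add: letter_weight_def eq filt_letter_weight[OF J(2)])
  have "conv (leading_form t n) x = conv (leading_form t n)
      ((x - coeff t (Suc n) x * z t ^ Suc n) + coeff t (Suc n) x * z t ^ Suc n)" by simp
  also have "\<dots> = conv (leading_form t n) (x - coeff t (Suc n) x * z t ^ Suc n) +
      conv (leading_form t n) (coeff t (Suc n) x * z t ^ Suc n)"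
    by (rule conv_add[OF bilin_leading_form])
  also have "\<dots> = scl (of_nat (Suc n)) (coeff t (Suc n) x)"
    unfolding conv_leading_form_power[OF J a]
      conv_leading_form_zero[OF J remove_leading_term[OF JI J(2) x]] by simp
  finally show ?thesis .
qed

end

section \<open>The unit, primitive elements and the coradical filtration\<close>

context hopf_algebra
begin

lemma subspace_coradical: "subspace (coradical scl comult)"
  unfolding coradical_def by (rule subspace_span)

text \<open>The line through 1 is a subcoalgebra, and it is simple because it is
  one-dimensional.\<close>

lemma one_in_coradical: "1 \<in> coradical scl comult"
proof -
  have "span {1} \<subseteq> comult_preimage (span {1} \<times> span {1})"
    by (rule span_minimal[OF _ subspace_comult_preimage]) (auto intro: one_in_comult_preimage span_base)
  then have "subcoalgebra scl comult (span {1})"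
    by (auto simp: subcoalgebra_def comult_preimage_def)
  moreover have "span {1} \<noteq> {0::'h}" using span_base[of 1 "{1}"] one_neq_zero_hopf by auto
  moreover have "B = {0} \<or> B = span {1}" if B: "subcoalgebra scl comult B" "B \<subseteq> span {1}" for B
  proof (cases "B \<subseteq> {0}")
    case True
    with B subspace_0[of B] show ?thesis by (auto simp: subcoalgebra_def)
  next
    case False
    then obtain x where "x \<in> B" "x \<noteq> 0" by blast
    with B(2) obtain c where c: "c \<noteq> 0" "scl c 1 \<in> B" by (force simp: span_singleton)
    have S: "subspace B" using B(1) by (simp add: subcoalgebra_def)
    from subspace_scale[OF S c(2), of "inverse c"] c(1) have "1 \<in> B" by simp
    then have "span {1} \<subseteq> B" by (intro span_minimal S) auto
    with B(2) show ?thesis by blast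
  qed
  ultimately have "simple_subcoalgebra scl comult (span {1})"
    by (auto simp: simple_subcoalgebra_def)
  then show ?thesis unfolding coradical_def by (intro span_base) (auto intro: span_base)
qed

lemma corad_filt_Suc_eq: "corad_filt scl comult (Suc m) =
    comult_preimage (UNIV \<times> corad_filt scl comult m \<union> coradical scl comult \<times> UNIV)"
  by (simp add: comult_preimage_def)

lemma subspace_corad_filt: "subspace (corad_filt scl comult m)"
  by (cases m) (simp_all only: corad_filt.simps(1) subspace_coradical corad_filt_Suc_eq subspace_comult_preimage)

lemma one_in_corad_filt: "1 \<in> corad_filt scl comult m"
proof (cases m)
  case 0
  then show ?thesis by (simp add: one_in_coradical)
next
  case (Suc k)
  show ?thesis unfolding Suc corad_filt_Suc_eq
    by (rule one_in_comult_preimage) (simp add: one_in_coradical)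
qed

lemma primitive_iff: "x \<in> primitives scl comult \<longleftrightarrow> gen (1, x) + gen (x, 1) \<in> comult x"
  using comult_eq_tensor tensor_self by (auto simp: primitives_def)

lemma subspace_primitives: "subspace (primitives scl comult)"
proof (rule subspaceI)
  note R = subspace_tensor2_rel[of scl]
  obtain p where "p \<in> comult 0" using comult_nonempty by blast
  from comult_scl[OF this, of 0] have 0: "0 \<in> comult 0" by simp
  \<comment> \<open>The formal generator \<open>gen (1, 0)\<close> is not zero; the additivity
    relation for \<open>0 + 0\<close> puts its negative among the relations, and likewise for
    \<open>gen (0, 1)\<close>.\<close>
  have "(gen (1, 0) - gen (1, 0) - gen (1, 0)) + (gen (0, 1) - gen (0, 1) - gen (0, 1)) \<in> tensor2_rel scl"
    using gen_rel(2)[of 1 0 0 scl] gen_rel(1)[of 0 0 1 scl] by (intro free.subspace_add[OF R]) simp_all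
  from free.subspace_neg[OF R this] have "(gen (1, 0) + gen (0, 1)) - 0 \<in> tensor2_rel scl" by (simp add: add.commute)
  then show "0 \<in> primitives scl comult"
    unfolding primitive_iff by (rule comult_rel_closed[OF 0])
next
  fix x y assume "x \<in> primitives scl comult" "y \<in> primitives scl comult"
  note xy = this[unfolded primitive_iff]
  have "(gen (1, x + y) - gen (1, x) - gen (1, y)) + (gen (x + y, 1) - gen (x, 1) - gen (y, 1)) \<in> tensor2_rel scl"
    by (rule free.subspace_add[OF subspace_tensor2_rel gen_rel(2) gen_rel(1)])
  then have "(gen (1, x + y) + gen (x + y, 1)) - (gen (1, x) + gen (x, 1) + (gen (1, y) + gen (y, 1))) \<in> tensor2_rel scl"
    by (simp add: algebra_simps)
  then show "x + y \<in> primitives scl comult"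
    unfolding primitive_iff by (rule comult_rel_closed[OF comult_add[OF xy]])
next
  fix c x assume "x \<in> primitives scl comult"
  note x = this[unfolded primitive_iff]
  have "(gen (1, scl c x) - fscale c (gen (1, x))) + (gen (scl c x, 1) - fscale c (gen (x, 1))) \<in> tensor2_rel scl"
    by (rule free.subspace_add[OF subspace_tensor2_rel gen_rel(4) gen_rel(3)])
  then have "(gen (1, scl c x) + gen (scl c x, 1)) - fscale c (gen (1, x) + gen (x, 1)) \<in> tensor2_rel scl"
    by (simp add: algebra_simps free.scale_right_distrib)
  then show "scl c x \<in> primitives scl comult"
    unfolding primitive_iff by (rule comult_rel_closed[OF comult_scl[OF x]])
qed

text \<open>The mixed terms \<open>x \<otimes> y\<close> and \<open>y \<otimes> x\<close> occur in
  the coproducts of both products and cancel.\<close>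

lemma commutator_primitive:
  assumes "x \<in> primitives scl comult" "y \<in> primitives scl comult"
  shows "commutator x y \<in> primitives scl comult"
proof -
  note x = assms(1)[unfolded primitive_iff] and y = assms(2)[unfolded primitive_iff]
  have xy: "gen (1, x * y) + gen (y, x) + (gen (x, y) + gen (x * y, 1)) \<in> comult (x * y)"
    using comult_mult[OF x y] by (simp add: tensor_mult_add_left tensor_mult_add_right tensor_mult_gen algebra_simps)
  have yx: "gen (1, y * x) + gen (x, y) + (gen (y, x) + gen (y * x, 1)) \<in> comult (y * x)"
    using comult_mult[OF y x] by (simp add: tensor_mult_add_left tensor_mult_add_right tensor_mult_gen algebra_simps)
  have *: "gen (1, x * y) + gen (y, x) + (gen (x, y) + gen (x * y, 1)) +
      fscale (-1) (gen (1, y * x) + gen (x, y) + (gen (y, x) + gen (y * x, 1))) \<in> comult (x * y + scl (-1) (y * x))"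
    by (rule comult_add[OF xy comult_scl[OF yx]])
  have minus: "fscale (-1) p = - p" for p :: "'h \<times> 'h \<Rightarrow>\<^sub>0 'k" by (simp only: free.scale_minus_left free.scale_one)
  have c: "x * y + scl (-1) (y * x) = commutator x y" by (simp add: commutator_def)
  \<comment> \<open>Additivity at \<open>(x * y - y * x) + y * x\<close> stands in for a relation
    for differences.\<close>
  have r: "gen (1, x * y - y * x + y * x) - gen (1, x * y - y * x) - gen (1, y * x) \<in> tensor2_rel scl"
    "gen (x * y - y * x + y * x, 1) - gen (x * y - y * x, 1) - gen (y * x, 1) \<in> tensor2_rel scl"
    by (rule gen_rel)+
  from free.subspace_neg[OF subspace_tensor2_rel free.subspace_add[OF subspace_tensor2_rel r]]
  have "(gen (1, commutator x y) + gen (commutator x y, 1)) -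
    (gen (1, x * y) + gen (y, x) + (gen (x, y) + gen (x * y, 1)) +
      fscale (-1) (gen (1, y * x) + gen (x, y) + (gen (y, x) + gen (y * x, 1)))) \<in> tensor2_rel scl"
    unfolding minus commutator_def by (simp add: algebra_simps)
  from comult_rel_closed[OF *[unfolded c] this] show ?thesis by (simp only: primitive_iff)
qed

lemma counit_primitive: "x \<in> primitives scl comult \<Longrightarrow> counit x = 0"
proof -
  assume "x \<in> primitives scl comult"
  then have "gen (1, x) + gen (x, 1) \<in> comult x" by (simp only: primitive_iff)
  from counit_left[OF this] have "scl (counit x) 1 = 0"
    by (simp add: Vector_Spaces.linear_iff[THEN iffD1, OF linear_lin_ext[OF vs]] lin_ext_single[OF vs] counit_one)
  then show ?thesis using one_neq_zero_hopf by simp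
qed

end

section \<open>PBW degree against the coradical filtration, and the space of primitives\<close>

context pbw_hopf
begin

lemma filt_d_zero: "filt d I 0 \<subseteq> span {1}"
proof (rule filt_subsetI[OF subspace_span])
  fix W assume "W \<in> ndec_words I" "word_deg d W \<le> 0"
  then have "W = []" using d_pos by (cases W) (fastforce simp: ndec_words_def)+
  then show "word_prod z W \<in> span {1}" by (simp add: span_base)
qed

lemma span_one_coradical: "span {1} \<subseteq> coradical scl comult"
  by (rule span_minimal[OF _ subspace_coradical]) (simp add: one_in_coradical)

text \<open>In total degree at most \<open>Suc k\<close>, either the left factor has degree 0 and is
  a scalar, or the right factor has degree at most \<open>k\<close>.\<close>

lemma tfilt_corad:
  assumes "filt d I k \<subseteq> corad_filt scl comult k"
  shows "tfilt d I (Suc k) \<subseteq> UNIV \<times> corad_filt scl comult k \<union> coradical scl comult \<times> UNIV"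
proof (intro subrelI UnCI)
  fix a b assume "(a, b) \<in> tfilt d I (Suc k)" and "(a, b) \<notin> coradical scl comult \<times> UNIV"
  then have "(a, b) \<in> tfilt d I (Suc k)" and b: "a \<notin> coradical scl comult" by auto
  then obtain i j where ij: "i + j \<le> Suc k" "a \<in> filt d I i" "b \<in> filt d I j"
    by (auto simp: tfilt_def)
  have "i \<noteq> 0" using b ij(2) filt_d_zero span_one_coradical by (cases "i = 0") auto
  with ij(1) have "j \<le> k" by simp
  from subsetD[OF filt_mono[OF order_refl this] ij(3)] assms show "(a, b) \<in> UNIV \<times> corad_filt scl comult k" by blast
qed

lemma filt_subset_corad_filt: "filt d I m \<subseteq> corad_filt scl comult m"
proof (induction m)
  case 0
  show ?case using filt_d_zero span_one_coradical by simp
next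
  case (Suc k)
  have "filt d I (Suc k) \<subseteq> comult_preimage (tfilt d I (Suc k))"
    by (rule comult_filt[OF admissible_d[OF down_I]])
  also have "\<dots> \<subseteq> corad_filt scl comult (Suc k)"
    unfolding corad_filt_Suc_eq by (rule comult_preimage_mono[OF tfilt_corad[OF Suc.IH]])
  finally show ?case .
qed

text \<open>Primitivity up to tensors of total degree at most \<open>m\<close>, with arbitrary
  elements beside 1. Unlike primitivity, it survives the subtraction of a leading term of bounded
  degree, which is what the induction on letters requires.\<close>

definition almost_primitive :: "nat \<Rightarrow> 'h set"
  where "almost_primitive m = comult_preimage ({1} \<times> UNIV \<union> UNIV \<times> {1} \<union> tfilt d I m)"

lemma subspace_almost_primitive: "subspace (almost_primitive m)"
  unfolding almost_primitive_def by (rule subspace_comult_preimage)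

lemma almost_primitive_mono: "m \<le> n \<Longrightarrow> almost_primitive m \<subseteq> almost_primitive n"
  unfolding almost_primitive_def using tfilt_mono[OF order_refl, of m n d I]
  by (intro comult_preimage_mono) blast

lemma filt_subset_almost_primitive: "filt d I m \<subseteq> almost_primitive m"
  unfolding almost_primitive_def
  using comult_filt[OF admissible_d[OF down_I], of m] comult_preimage_mono[of "tfilt d I m"] by blast

lemma almost_primitive_corad: "almost_primitive (Suc k) \<subseteq> corad_filt scl comult (Suc k)"
  unfolding almost_primitive_def corad_filt_Suc_eq
  using tfilt_corad[OF filt_subset_corad_filt, of k] one_in_coradical one_in_corad_filt[of k]
  by (intro comult_preimage_mono) blast

text \<open>Splits off the empty word, since minimality speaks of nonempty words only.\<close>

lemma filt_decompose_one:
  assumes "x \<in> filt w J m"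
  shows "\<exists>e. \<exists>s\<in>span {word_prod z W | W. W \<in> ndec_words J \<and> W \<noteq> [] \<and> word_deg w W \<le> m}. x = scl e 1 + s"
proof -
  let ?S = "span {word_prod z W | W. W \<in> ndec_words J \<and> W \<noteq> [] \<and> word_deg w W \<le> m}"
  let ?T = "span (insert 1 {word_prod z W | W. W \<in> ndec_words J \<and> W \<noteq> [] \<and> word_deg w W \<le> m})"
  have "filt w J m \<subseteq> ?T"
  proof (rule filt_subsetI[OF subspace_span])
    fix W assume "W \<in> ndec_words J" "word_deg w W \<le> m"
    then show "word_prod z W \<in> ?T" by (cases "W = []") (auto intro!: span_base)
  qed
  with assms have "x \<in> ?T" by blast
  then obtain e where "x - scl e 1 \<in> ?S" by (auto simp: span_insert)
  then show ?thesis by (intro exI[of _ e] bexI[of _ "x - scl e 1"]) auto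
qed

text \<open>Otherwise \<open>z t + y\<close> would lie in the coradical layer
  \<open>d t - 1\<close>. Subtracting the scalar part of \<open>y\<close>, which lies in every
  layer, would then contradict minimality at \<open>t\<close>.\<close>

lemma generator_not_almost_primitive:
  assumes "t \<in> I" "y \<in> filt d (I \<inter> {..<t}) (d t)" "1 \<le> m" "m < d t"
  shows "z t + y \<notin> almost_primitive m"
proof
  assume y: "z t + y \<in> almost_primitive m"
  \<comment> \<open>From \<open>1 \<le> m < d t\<close> the layer index \<open>d t - 1\<close> is
    positive, as \<open>almost_primitive_corad\<close> requires.\<close>
  obtain k where k: "d t - 1 = Suc k" using assms(3,4) by (cases "d t - 1") auto
  have le: "m \<le> Suc k" using k assms(4) by simp
  obtain e s where es: "s \<in> span {word_prod z W | W. W \<in> ndec_words (I \<inter> {..<t}) \<and> W \<noteq> [] \<and> word_deg d W \<le> d t}"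
    "y = scl e 1 + s" using filt_decompose_one[OF assms(2)] by blast
  have "z t + y \<in> corad_filt scl comult (Suc k)"
    using y almost_primitive_mono[OF le] almost_primitive_corad by blast
  then have "(z t + y) - scl e 1 \<in> corad_filt scl comult (Suc k)"
    by (intro subspace_diff[OF subspace_corad_filt] subspace_scale[OF subspace_corad_filt] one_in_corad_filt)
  moreover have "(z t + y) - scl e 1 = z t + s" by (simp add: es(2))
  ultimately have zs: "z t + s \<in> corad_filt scl comult (d t - 1)" by (simp only: k)
  have "{word_prod z W | W. W \<in> ndec_words (I \<inter> {..<t}) \<and> W \<noteq> [] \<and> word_deg d W \<le> d t} \<subseteq>
    {word_prod z W | W. W \<in> ndec_words_pos I \<and> word_deg d W \<le> d t \<and> less_rlex W [t]}"
  proof clarify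
    fix W assume W: "W \<in> ndec_words (I \<inter> {..<t})" "W \<noteq> []" "word_deg d W \<le> d t"
    have "less_r W [t]" unfolding less_r_def
      using W by (intro exI[of _ "butlast W"] exI[of _ "[]"] exI[of _ "last W"] exI[of _ t])
        (auto simp: ndec_words_def dest: last_in_set)
    with W show "\<exists>W'. word_prod z W = word_prod z W' \<and> W' \<in> ndec_words_pos I \<and> word_deg d W' \<le> d t \<and> less_rlex W' [t]"
      by (intro exI[of _ W]) (auto simp: ndec_words_pos_def ndec_words_def less_rlex_def)
  qed
  from span_mono[OF this] es(1) zs minimal assms(1) show False
    unfolding d_minimal_def by blast
qed

text \<open>The core of the argument: an outer induction on the top letter \<open>t\<close> and an
  inner one on the degree in \<open>t\<close>. The leading form evaluates to \<open>Suc n\<close>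
  times the leading coefficient, while almost primitivity confines the same value to a small space.
  The level \<open>m\<close> varies in the outer induction because it is raised to
  \<open>d t\<close> in the last case.\<close>

lemma almost_primitive_filt:
  assumes "down J" "1 \<le> m" "x \<in> filt (\<lambda>_. 0) J 0" "x \<in> almost_primitive m"
  shows "x \<in> filt d J m"
proof -
  have "finite J" using assms(1) by (rule finite_down)
  then show ?thesis using assms
  proof (induction J arbitrary: x m rule: finite_linorder_max_induct)
    case empty
    have "filt (\<lambda>_. 0) {} 0 \<subseteq> filt d {} m"
      by (rule filt_weight_mono) (auto simp: ndec_words_def)
    with empty show ?case by blast
  next
    case (insert t J)
    have J: "down (insert t J)" "\<forall>x\<in>J. x < t" by (fact insert.prems(1)) (fact insert.hyps(2))
    have t: "t \<in> I" and JI: "insert t J \<subseteq> I" using J(1) by (auto simp: down_def)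
    have downJ: "down J" by (rule down_remove_max[OF J])
    have eq: "I \<inter> {..<t} = J" using down_Int[OF J(1), of t] J(2) by auto
    have step: "x \<in> filt d (insert t J) m"
      if "x \<in> filt (letter_weight t) (insert t J) n" "x \<in> almost_primitive m" for n x
      using that
    proof (induction n arbitrary: x)
      case 0
      have "x \<in> filt (\<lambda>_. 0) J 0"
      proof -
        have "filt (letter_weight t) (insert t J) 0 \<subseteq> filt (\<lambda>_. 0) J 0"
          by (rule filt_insert_subsetI[OF subspace_filt J(2)])
            (auto simp: letter_weight_def filt_letter_weight[OF J(2)])
        with 0 show ?thesis by blast
      qed
      from insert.IH[OF downJ insert.prems(2) this 0(2)] show ?case
        using filt_mono[of J "insert t J" m m d] by blast
    next
      case (Suc n)
      let ?a = "coeff t (Suc n) x"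
      let ?x' = "x - ?a * z t ^ Suc n"
      \<comment> \<open>Where the leading form can take its values: \<open>1 \<otimes> H\<close>
        contributes 0, \<open>H \<otimes> 1\<close> contributes a scalar and only for
        \<open>n = 0\<close>, and the tensors of degree at most \<open>m\<close> are handled by
        \<open>leading_form_tfilt\<close>.\<close>
      let ?S = "if Suc n * d t \<le> m then filt d J (m - Suc n * d t) else if n = 0 then span {1} else {0}"
      have x': "?x' \<in> filt (letter_weight t) (insert t J) n"
        by (rule remove_leading_term[OF JI J(2) Suc.prems(1)])
      have S: "subspace ?S" by (simp add: subspace_filt subspace_span subspace_0)
      have "conv (leading_form t n) x \<in> ?S"
      proof (rule conv_in_subspace[OF bilin_leading_form _ S])
        show "x \<in> comult_preimage ({1} \<times> UNIV \<union> UNIV \<times> {1} \<union> tfilt d I m)"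
          using Suc.prems(2) by (simp only: almost_primitive_def)
        fix a b assume "(a, b) \<in> {1} \<times> UNIV \<union> UNIV \<times> {1} \<union> tfilt d I m"
        then consider "a = 1" | "b = 1" | "(a, b) \<in> tfilt d I m" by blast
        then show "leading_form t n (a, b) \<in> ?S"
        proof cases
          case 1
          then have "leading_form t n (a, b) = 0" by (simp add: leading_form_def coeff_one counit_zero)
          then show ?thesis using subspace_0[OF S] by simp
        next
          case 2
          show ?thesis
          proof (cases "n = 0")
            case True
            then have "leading_form t n (a, b) = scl (counit (coeff t 1 a)) 1"
              using 2 by (simp add: leading_form_def coeff_one)
            with True show ?thesis
              by (simp add: subspace_scale[OF subspace_filt] one_in_filt span_scale span_base)
          next
            case False
            then have "leading_form t n (a, b) = 0" using 2 by (simp add: leading_form_def coeff_one)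
            then show ?thesis using subspace_0[OF S] by simp
          qed
        next
          case 3
          from leading_form_tfilt[OF this, of t n] show ?thesis
            unfolding eq using span_zero by (auto split: if_splits)
        qed
      qed
      then have "scl (of_nat (Suc n)) ?a \<in> ?S" by (simp only: conv_leading_form[OF J Suc.prems(1)])
      \<comment> \<open>Division by \<open>Suc n\<close> uses characteristic zero.\<close>
      from subspace_scale[OF S this, of "inverse (of_nat (Suc n))"] have a: "?a \<in> ?S"
        by (simp add: field_simps del: of_nat_Suc)
      consider "Suc n * d t \<le> m" | "\<not> Suc n * d t \<le> m" "?a = 0" | "n = 0" "m < d t" "?a \<noteq> 0"
        using a by (cases "n = 0"; cases "?a = 0"; cases "Suc n * d t \<le> m"; simp)
      then show ?case
      proof cases
        case 1
        with a have "?a \<in> filt d J (m - Suc n * d t)" by simp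
        from filt_times_power[OF this J(2), of "Suc n" m] 1
        have az: "?a * z t ^ Suc n \<in> filt d (insert t J) m" by simp
        then have "?a * z t ^ Suc n \<in> almost_primitive m"
          using filt_mono[OF JI order_refl, of d m] filt_subset_almost_primitive by blast
        from subspace_diff[OF subspace_almost_primitive Suc.prems(2) this]
        have "?x' \<in> filt d (insert t J) m" by (rule Suc.IH[OF x'])
        from subspace_add[OF subspace_filt this az] show ?thesis by simp
      next
        case 2
        with x' Suc.IH Suc.prems(2) show ?thesis by simp
      next
        case 3
        \<comment> \<open>The exceptional case: \<open>x\<close> is a nonzero multiple of
          \<open>z t\<close> plus terms on \<open>J\<close>, although \<open>m < d t\<close>. It is
          refuted by minimality.\<close>
        with a have "?a \<in> span {1}" by simp
        then obtain c where c: "?a = scl c 1" by (auto simp: span_singleton)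
        with 3 have c0: "c \<noteq> 0" by auto
        have x'J: "?x' \<in> filt (\<lambda>_. 0) J 0"
        proof -
          have "filt (letter_weight t) (insert t J) 0 \<subseteq> filt (\<lambda>_. 0) J 0"
            by (rule filt_insert_subsetI[OF subspace_filt J(2)])
              (auto simp: letter_weight_def filt_letter_weight[OF J(2)])
          with x' 3(1) show ?thesis by blast
        qed
        have eqx: "?x' = x - scl c (z t)" using 3(1) c by (simp add: scl_mult_left)
        \<comment> \<open>Subtracting the multiple of \<open>z t\<close> leaves an element known to
          be almost primitive only at level \<open>d t\<close>, so the outer hypothesis is applied
          at that level.\<close>
        have "z t \<in> almost_primitive (d t)"
          using gen_in_filt[OF t, of d "d t"] filt_subset_almost_primitive by blast
        then have "?x' \<in> almost_primitive (d t)" unfolding eqx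
          using Suc.prems(2) almost_primitive_mono[of m "d t"] 3(2)
          by (intro subspace_diff[OF subspace_almost_primitive] subspace_scale[OF subspace_almost_primitive]) auto
        then have "?x' \<in> filt d J (d t)"
          using insert.IH[OF downJ _ x'J, of "d t"] d_pos[OF t] by simp
        then have "scl (inverse c) ?x' \<in> filt d (I \<inter> {..<t}) (d t)"
          unfolding eq by (rule subspace_scale[OF subspace_filt])
        from generator_not_almost_primitive[OF t this insert.prems(2) 3(2)]
        have "z t + scl (inverse c) ?x' \<notin> almost_primitive m" .
        moreover have "z t + scl (inverse c) ?x' = scl (inverse c) x"
          unfolding eqx using c0 by (simp add: scale_right_diff_distrib)
        ultimately show ?thesis using subspace_scale[OF subspace_almost_primitive Suc.prems(2)] by simp
      qed
    qed
    obtain n where "x \<in> filt (letter_weight t) (insert t J) n"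
      using filt_zero_obtain_degree[OF insert.prems(3)] by blast
    from step[OF this insert.prems(4)] show ?case .
  qed
qed

definition primitive_letters :: "'i set"
  where "primitive_letters = {\<xi> \<in> I. d \<xi> = 1}"

lemma down_primitive_letters: "down primitive_letters"
proof -
  have "d \<eta> = 1" if "\<eta> \<in> I" "\<xi> \<in> I" "\<eta> < \<xi>" "d \<xi> = 1" for \<eta> \<xi>
    using d_mono that d_pos[OF that(1)] by (fastforce simp: order_preserving_def)
  then show ?thesis by (auto simp: down_def primitive_letters_def)
qed

text \<open>Two nonempty words have total degree at least 2, so no correction term fits into degree
  1.\<close>

lemma generator_primitive:
  assumes "\<xi> \<in> primitive_letters"
  shows "z \<xi> \<in> primitives scl comult"
proof -
  have xi: "\<xi> \<in> I" "d \<xi> = 1" using assms by (auto simp: primitive_letters_def)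
  from dominated_admissible[OF admissible_d[OF down_I] xi(1)] obtain s where s:
    "s \<in> free.span (gen ` {(word_prod z P, word_prod z Q) | P Q.
      P \<in> ndec_words (I \<inter> {..<\<xi>}) \<and> P \<noteq> [] \<and> Q \<in> ndec_words (I \<inter> {..<\<xi>}) \<and> Q \<noteq> [] \<and>
      word_deg d P + word_deg d Q \<le> d \<xi>})" (is "s \<in> free.span (gen ` ?B)")
    "gen (1, z \<xi>) + gen (z \<xi>, 1) + s \<in> comult (z \<xi>)" by blast
  have pos: "0 < word_deg d P" if "P \<in> ndec_words (I \<inter> {..<\<xi>})" "P \<noteq> []" for P
    using that d_pos by (cases P) (auto simp: ndec_words_def)
  have "?B = {}"
  proof -
    have "\<not> word_deg d P + word_deg d Q \<le> d \<xi>"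
      if "P \<in> ndec_words (I \<inter> {..<\<xi>})" "P \<noteq> []" "Q \<in> ndec_words (I \<inter> {..<\<xi>})" "Q \<noteq> []" for P Q
      using pos[OF that(1,2)] pos[OF that(3,4)] xi(2) by simp
    then show ?thesis by blast
  qed
  with s(1) have "s = 0" by (simp only: image_empty free.span_empty singleton_iff)
  with s(2) show ?thesis by (simp add: primitive_iff)
qed

text \<open>A primitive element is almost primitive at level 1, hence a combination of words of
  degree at most 1. These are the empty word and the letters of degree 1, and the counit excludes
  the empty word.\<close>

lemma primitives_eq: "primitives scl comult = span (z ` primitive_letters)"
proof
  show "span (z ` primitive_letters) \<subseteq> primitives scl comult"
    by (rule span_minimal[OF _ subspace_primitives]) (auto simp: generator_primitive)
  show "primitives scl comult \<subseteq> span (z ` primitive_letters)"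
  proof
    fix x assume x: "x \<in> primitives scl comult"
    then have p: "gen (1, x) + gen (x, 1) \<in> comult x" by (simp only: primitive_iff)
    have "x \<in> almost_primitive 1"
      unfolding almost_primitive_def
      by (rule comult_preimageI[OF p]) (intro free.subspace_add[OF subspace_tensor_in] gen_in_tensor_in; simp)
    moreover have "x \<in> filt (\<lambda>_. 0) I 0"
      using pbw by (auto simp: filt_def word_deg_zero pbw_generating_system_def)
    ultimately have "x \<in> filt d I 1" by (intro almost_primitive_filt[OF down_I]) simp_all
    from filt_decompose_one[OF this] obtain e s where es: "x = scl e 1 + s"
      "s \<in> span {word_prod z W | W. W \<in> ndec_words I \<and> W \<noteq> [] \<and> word_deg d W \<le> 1}" (is "s \<in> span ?T") by blast
    have T: "?T \<subseteq> z ` primitive_letters"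
    proof clarify
      fix W assume W: "W \<in> ndec_words I" "W \<noteq> []" "word_deg d W \<le> 1"
      then obtain \<xi> V where V: "W = \<xi> # V" "\<xi> \<in> I" "set V \<subseteq> I" by (cases W) (auto simp: ndec_words_def)
      with W(3) d_pos[OF V(2)] have "d \<xi> = 1" "word_deg d V = 0" by auto
      moreover from this V(3) have "V = []" using d_pos by (cases V) fastforce+
      ultimately show "word_prod z W \<in> z ` primitive_letters"
        using V by (simp add: primitive_letters_def)
    qed
    then have s: "s \<in> span (z ` primitive_letters)" using es(2) span_mono by blast
    then have "s \<in> primitives scl comult"
      using span_minimal[OF _ subspace_primitives, of "z ` primitive_letters"] generator_primitive by blast
    with x es(1) have "e = 0" using counit_primitive[of x] counit_primitive[of s]
      by (simp add: counit_add counit_scl counit_one)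
    with es(1) s show "x \<in> span (z ` primitive_letters)" by simp
  qed
qed

end


section \<open>Iterated Hopf Ore extensions\<close>

text \<open>Dimension count: the span of \<open>f\<close>
  B\<open>contains the independent set\<close>B\<open>, so\<close>f \<open>B\<close> has as many
  elements as \<open>B\<close> and is itself independent.\<close>

lemma (in vector_space) finite_independent_surj_imp_inj_on_span:
  assumes "Vector_Spaces.linear scale scale f" "finite B" "independent B" "B \<subseteq> f ` span B"
  shows "inj_on f (span B)"
proof -
  interpret f: Vector_Spaces.linear scale scale f by fact
  have B: "B \<subseteq> span (f ` B)" using assms(4) by (simp add: f.span_image)
  have fin: "finite (f ` B)" using assms(2) by simp
  have "card B \<le> card (f ` B)" using independent_span_bound[OF fin assms(3) B] by simp
  then have card: "card (f ` B) = card B" using card_image_le[OF assms(2), of f] by simp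
  have "independent (f ` B)"
  proof
    assume "dependent (f ` B)"
    then obtain a where a: "a \<in> f ` B" "a \<in> span (f ` B - {a})" by (auto simp: dependent_def)
    have "x \<in> span (f ` B - {a})" if "x \<in> f ` B" for x
      by (cases "x = a") (use a(2) that in \<open>simp_all add: span_base\<close>)
    then have "f ` B \<subseteq> span (f ` B - {a})" by blast
    then have "span (f ` B) \<subseteq> span (f ` B - {a})" by (rule span_minimal) (rule subspace_span)
    with B have "B \<subseteq> span (f ` B - {a})" by blast
    with independent_span_bound[OF _ assms(3), of "f ` B - {a}"] fin
    have "card B \<le> card (f ` B - {a})" by simp
    also have "\<dots> < card (f ` B)" using fin a(1) by (rule card_Diff1_less)
    finally show False using card by simp
  qed
  moreover have "inj_on f B" using card assms(2) by (rule eq_card_imp_inj_on[rotated])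
  ultimately show ?thesis by (rule f.inj_on_span_independent_image)
qed

section \<open>Initial segments of letters give Hopf subalgebras\<close>

context pbw_hopf
begin

abbreviation word_span :: "'i set \<Rightarrow> 'h set"
  where "word_span J \<equiv> filt (\<lambda>_. 0) J 0"

lemma word_span_mult: "down J \<Longrightarrow> x \<in> word_span J \<Longrightarrow> y \<in> word_span J \<Longrightarrow> x * y \<in> word_span J"
  using filt_mult[OF admissible_zero, of J x 0 y 0] by simp

lemma word_span_mono: "J \<subseteq> K \<Longrightarrow> word_span J \<subseteq> word_span K"
  by (rule filt_mono) simp_all

lemma antipode_one: "antipode 1 = 1"
proof -
  have "gen (1, 1) \<in> comult 1" by (simp add: comult_one tensor_self)
  from antipode_left[OF this] show ?thesis by (simp add: lin_ext_single[OF vs] counit_one)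
qed

text \<open>
  Since \<open>\<Delta> x\<close> is \<open>x \<otimes> 1\<close> up to terms whose first factor has smaller degree, the antipode axiom
  expresses \<open>S x\<close> through values of \<open>S\<close> in smaller degree.
\<close>

lemma antipode_filt:
  assumes "down J" "x \<in> filt d J m"
  shows "antipode x \<in> word_span J"
  using assms(2)
proof (induction m arbitrary: x)
  case 0
  have "filt d J 0 \<subseteq> span {1}" using filt_d_zero filt_mono[of J I 0 0 d] assms(1) by (auto simp: down_def)
  with 0 obtain c where "x = scl c 1" by (auto simp: span_singleton)
  then show ?case by (simp add: antipode_scl antipode_one subspace_scale[OF subspace_filt] one_in_filt)
next
  case (Suc m)
  let ?A = "lin_ext scl (\<lambda>(a, b). antipode a * b)" and ?E = "lin_ext scl (\<lambda>(a, b). scl (counit b) a)"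
  interpret le: Vector_Spaces.linear fscale scl "lin_ext scl g" for g :: "'h \<times> 'h \<Rightarrow> 'h"
    by (rule linear_lin_ext[OF vs])
  interpret S: Vector_Spaces.linear scl scl antipode by (rule antipode_linear)
  note H = subspace_filt[of "\<lambda>_. 0" J 0]
  obtain p where p: "p \<in> comult x" "p \<in> free.span (gen ` tfilt d J (Suc m))"
    using comult_filt[OF admissible_d[OF assms(1)], of "Suc m"] Suc.prems comult_preimageE by blast
  \<comment> \<open>By the axioms \<open>?A p\<close> is the scalar \<open>counit x\<close> and
    \<open>?E p\<close> is \<open>x\<close>. On a pure tensor the induction hypothesis covers a left
    factor of degree at most \<open>m\<close>; otherwise the right factor is a scalar and the
    difference vanishes.\<close>
  have "?A p - antipode (?E p) \<in> word_span J" (is "?P p")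
    using p(2)
  proof (rule free.span_induct)
    show "free.subspace {p. ?P p}"
    proof (rule free.subspaceI)
      fix p q assume "p \<in> {p. ?P p}" "q \<in> {p. ?P p}"
      then have "(?A p - antipode (?E p)) + (?A q - antipode (?E q)) \<in> word_span J"
        by (auto intro: subspace_add[OF H])
      then show "p + q \<in> {p. ?P p}" by (simp add: le.add S.add algebra_simps)
    next
      fix c p assume "p \<in> {p. ?P p}"
      then have "scl c (?A p - antipode (?E p)) \<in> word_span J" by (auto intro: subspace_scale[OF H])
      then show "fscale c p \<in> {p. ?P p}" by (simp add: le.scale S.scale scale_right_diff_distrib)
    qed (simp add: le.zero S.zero subspace_0[OF H])
  next
    fix u :: "'h \<times> 'h \<Rightarrow>\<^sub>0 'k" assume "u \<in> gen ` tfilt d J (Suc m)"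
    then obtain a b i j where u: "u = gen (a, b)" "i + j \<le> Suc m" "a \<in> filt d J i" "b \<in> filt d J j"
      by (auto simp: tfilt_def)
    have eq: "?A u - antipode (?E u) = antipode a * b - scl (counit b) (antipode a)"
      by (simp add: u(1) lin_ext_single[OF vs] antipode_scl)
    show "?P u"
    proof (cases "i \<le> m")
      case True
      then have "antipode a \<in> word_span J" using Suc.IH filt_mono[OF order_refl True] u(3) by blast
      moreover have "b \<in> word_span J" using u(4) filt_subset_zero by blast
      ultimately show ?thesis unfolding eq
        by (intro subspace_diff[OF H] subspace_scale[OF H] word_span_mult[OF assms(1)])
    next
      case False
      with u(2) have "j = 0" by simp
      have "filt d J 0 \<subseteq> span {1}" using filt_d_zero filt_mono[of J I 0 0 d] assms(1) by (auto simp: down_def)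
      with u(4) \<open>j = 0\<close> obtain c where "b = scl c 1" by (auto simp: span_singleton)
      then show ?thesis unfolding eq by (simp add: counit_scl counit_one scl_mult_right subspace_0[OF H])
    qed
  qed
  then have "scl (counit x) 1 - antipode x \<in> word_span J"
    by (simp only: antipode_left[OF p(1)] counit_right[OF p(1)])
  from subspace_diff[OF H subspace_scale[OF H one_in_filt[of _ J 0], of "counit x"] this]
  show ?case by simp
qed

lemma hopf_subalgebra_word_span:
  assumes "down J"
  shows "hopf_subalgebra scl comult antipode (word_span J)"
  unfolding hopf_subalgebra_def subalgebra_def subcoalgebra_def
proof (intro conjI ballI)
  show "antipode ` word_span J \<subseteq> word_span J"
  proof clarify
    fix x assume "x \<in> word_span J"
    then obtain m where "x \<in> filt d J m" by (rule filt_zero_obtain_degree)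
    then show "antipode x \<in> word_span J" by (rule antipode_filt[OF assms])
  qed
  fix x assume x: "x \<in> word_span J"
  have "tfilt (\<lambda>_. 0) J 0 \<subseteq> word_span J \<times> word_span J"
    by (auto simp: tfilt_def)
  with x comult_filt[OF admissible_zero[OF assms], of 0] comult_preimage_mono
  have "x \<in> comult_preimage (word_span J \<times> word_span J)" by blast
  then show "comult x \<in> tensor_span scl (word_span J \<times> word_span J)" by (simp add: comult_preimage_def)
  show "x * y \<in> word_span J" if "y \<in> word_span J" for y by (rule word_span_mult[OF assms x that])
qed (simp_all add: subspace_filt one_in_filt)

lemma subspace_word_span: "subspace (word_span J)"
  by (rule subspace_filt)

lemma coeff_in_word_span:
  assumes "down (insert t J)" "\<forall>x\<in>J. x < t"
  shows "coeff t n x \<in> word_span J"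
proof -
  have "I \<inter> {..<t} = J" using down_Int[OF assms(1), of t] assms(2) by auto
  moreover have "x \<in> word_span I" using pbw by (auto simp: filt_def word_deg_zero pbw_generating_system_def)
  ultimately show ?thesis using coeff_filt[of x "\<lambda>_. 0" 0 t n] by simp
qed

lemma coeff_sum: "coeff t n (sum f A) = (\<Sum>k\<in>A. coeff t n (f k))"
proof -
  interpret c: Vector_Spaces.linear scl scl "coeff t n" by (rule linear_coeff)
  show ?thesis by (rule c.sum)
qed

text \<open>The maps \<open>coeff t k\<close> recover the coefficients of a polynomial in
  \<open>z t\<close>, giving injectivity; surjectivity is the expansion of \<open>x\<close> with
  these coefficients, finite because \<open>x\<close> has bounded degree in
  \<open>t\<close>.\<close>

lemma free_left_basis_powers_word_span:
  assumes J: "down (insert t J)" "\<forall>x\<in>J. x < t"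
  shows "free_left_basis_powers (word_span J) (word_span (insert t J)) (z t)"
  unfolding free_left_basis_powers_def bij_betw_def
proof
  have JI: "insert t J \<subseteq> I" using J(1) by (simp add: down_def)
  let ?F = "{f :: nat \<Rightarrow> 'h. range f \<subseteq> word_span J \<and> finite {n. f n \<noteq> 0}}"
  let ?s = "\<lambda>f :: nat \<Rightarrow> 'h. \<Sum>n | f n \<noteq> 0. f n * z t ^ n"
  have coeff_s: "coeff t k (?s f) = f k" if f: "f \<in> ?F" for f k
  proof -
    have fJ: "f n \<in> word_span J" for n using f by blast
    have "coeff t k (?s f) = (\<Sum>n | f n \<noteq> 0. if n = k then f n else 0)"
      by (simp add: coeff_sum coeff_times_power[OF JI J(2) fJ])
    also have "\<dots> = f k" using f by (simp add: sum.delta)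
    finally show ?thesis .
  qed
  show "inj_on ?s ?F"
  proof (rule inj_onI, rule ext)
    fix f g k assume "f \<in> ?F" "g \<in> ?F" "?s f = ?s g"
    then show "f k = g k" using coeff_s[of f k] coeff_s[of g k] by simp
  qed
  show "?s ` ?F = word_span (insert t J)"
  proof
    show "?s ` ?F \<subseteq> word_span (insert t J)"
    proof clarify
      fix f :: "nat \<Rightarrow> 'h" assume f: "range f \<subseteq> word_span J"
      show "?s f \<in> word_span (insert t J)"
        using f by (intro subspace_sum[OF subspace_word_span] filt_times_power[where i = 0 and w = "\<lambda>_. 0"])
          (auto simp: J(2))
    qed
    show "word_span (insert t J) \<subseteq> ?s ` ?F"
    proof
      fix x assume x: "x \<in> word_span (insert t J)"
      then obtain n where n: "x \<in> filt (letter_weight t) (insert t J) n" by (rule filt_zero_obtain_degree)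
      let ?f = "\<lambda>k. coeff t k x"
      have zero: "?f k = 0" if "k > n" for k
      proof -
        have "x \<in> filt (letter_weight t) I n" using n filt_mono[OF JI order_refl] by blast
        from coeff_filt[OF this, of t k] that show ?thesis by (simp add: letter_weight_def)
      qed
      have sub: "{k. ?f k \<noteq> 0} \<subseteq> {..n}" using zero by (auto simp: not_less[symmetric])
      have "subspace {x. (\<Sum>k\<le>n. coeff t k x * z t ^ k) = x}"
        by (auto simp: subspace_def coeff_zero coeff_add coeff_scl distrib_right scl_mult_left
            sum.distrib scale_sum_right[symmetric])
      then have "filt (letter_weight t) (insert t J) n \<subseteq> {x. (\<Sum>k\<le>n. coeff t k x * z t ^ k) = x}"
      proof (rule filt_insert_subsetI[OF _ J(2)])
        fix a i l assume a: "a \<in> filt (letter_weight t) J i" "i + l * letter_weight t t \<le> n"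
        have "(\<Sum>k\<le>n. coeff t k (a * z t ^ l) * z t ^ k) = (\<Sum>k\<le>n. if k = l then a * z t ^ l else 0)"
          by (rule sum.cong) (auto simp: coeff_times_power[OF JI J(2) a(1)])
        also have "\<dots> = a * z t ^ l" using a(2) by (simp add: letter_weight_def)
        finally show "a * z t ^ l \<in> {x. (\<Sum>k\<le>n. coeff t k x * z t ^ k) = x}" by simp
      qed
      with n have "x = (\<Sum>k\<le>n. ?f k * z t ^ k)" by auto
      also have "\<dots> = ?s ?f" using sub by (intro sum.mono_neutral_right) auto
      finally have "x = ?s ?f" .
      moreover have "?f \<in> ?F"
        using sub finite_subset coeff_in_word_span[OF J] by blast
      ultimately show "x \<in> ?s ` ?F" by (rule image_eqI)
    qed
  qed
qed

section \<open>The automorphism and the skew derivation attached to the top letter\<close>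

context
  fixes t J
  assumes J: "down (insert t J)" "\<forall>x\<in>J. x < t"
begin

text \<open>\<open>twist\<close> and \<open>twist_der\<close> are the maps \<sigma> and \<delta> of
  the Ore extension. Defined through \<open>coeff\<close>, they are linear on all of
  \<open>H\<close>, but they have this meaning only on \<open>word_span J\<close>.\<close>

definition twist :: "'h \<Rightarrow> 'h" where "twist r = coeff t 1 (z t * r)"

definition twist_der :: "'h \<Rightarrow> 'h" where "twist_der r = coeff t 0 (z t * r)"

lemma insert_subset_I: "insert t J \<subseteq> I"
  using J(1) by (simp add: down_def)

lemma down_J: "down J"
  by (rule down_remove_max[OF J])

text \<open>Uniqueness of the normal form; the product rules for \<open>twist\<close> and
  \<open>twist_der\<close> follow by comparing two normal forms.\<close>

lemma twist_unique:
  assumes "a \<in> word_span J" "b \<in> word_span J" "z t * r = a * z t + b"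
  shows "twist r = a" "twist_der r = b"
  using coeff_times_power[OF insert_subset_I J(2) assms(1), of _ 1]
    coeff_times_power[OF insert_subset_I J(2) assms(2), of _ 0]
  by (simp_all add: twist_def twist_der_def assms(3) coeff_add)

lemma twist_filt:
  assumes "admissible (insert t J) w" "r \<in> filt w J m"
  shows "z t * r = twist r * z t + twist_der r \<and> twist r \<in> filt w J m \<and> twist_der r \<in> word_span J"
proof -
  have "\<forall>i j. \<forall>x\<in>filt w J i. \<forall>y\<in>filt w J j. x * y \<in> filt w J (i + j)"
    using filt_mult[OF admissible_remove_max[OF assms(1) J(2)]] by blast
  from swap_generator[OF assms(1) J(2) this assms(2)]
  obtain a b where ab: "a \<in> filt w J m" "b \<in> filt w J (m + w t)" "z t * r = a * z t + b" by blast
  then have "a \<in> word_span J" "b \<in> word_span J" using filt_subset_zero by blast+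
  from twist_unique[OF this ab(3)] ab \<open>b \<in> word_span J\<close> show ?thesis by simp
qed

lemma twist_word_span:
  assumes "r \<in> word_span J"
  shows "z t * r = twist r * z t + twist_der r" "twist r \<in> word_span J" "twist_der r \<in> word_span J"
  using twist_filt[OF admissible_zero[OF J(1)] assms] by auto

lemma twist_mult:
  assumes x: "x \<in> word_span J" and y: "y \<in> word_span J"
  shows "twist (x * y) = twist x * twist y" "twist_der (x * y) = twist x * twist_der y + twist_der x * y"
proof -
  note x' = twist_word_span[OF x] and y' = twist_word_span[OF y]
  have "z t * (x * y) = (twist x * z t + twist_der x) * y"
    by (simp only: x'(1)[symmetric] mult.assoc)
  also have "\<dots> = twist x * (z t * y) + twist_der x * y" by (simp only: distrib_right mult.assoc)
  also have "\<dots> = twist x * twist y * z t + (twist x * twist_der y + twist_der x * y)"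
    unfolding y'(1) by (simp only: distrib_left mult.assoc add.assoc)
  finally have eq: "z t * (x * y) = twist x * twist y * z t + (twist x * twist_der y + twist_der x * y)" .
  have "twist x * twist y \<in> word_span J" "twist x * twist_der y + twist_der x * y \<in> word_span J"
    using x' y' x y by (auto intro!: subspace_add[OF subspace_word_span] word_span_mult[OF down_J])
  from twist_unique[OF this eq] show "twist (x * y) = twist x * twist y"
    "twist_der (x * y) = twist x * twist_der y + twist_der x * y" by auto
qed

lemma linear_twist: "Vector_Spaces.linear scl scl twist"
  by (rule Vector_Spaces.linear.intro[OF vs vs], unfold_locales)
    (simp_all add: twist_def distrib_left scl_mult_right coeff_add coeff_scl)

lemma twist_one: "twist 1 = 1"
  using twist_unique(1)[of 1 0 1] one_in_filt subspace_0[OF subspace_word_span] by simp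

text \<open>Induction on the top letter \<open>u\<close> of \<open>K\<close>. By triangularity
  \<open>twist (z u)\<close> is a nonzero multiple of \<open>z u\<close> plus an element on smaller
  letters. That element already has a preimage of the same degree, so \<open>z u\<close> has one
  too, and products of preimages give the rest.\<close>

lemma filt_subset_twist_image:
  assumes "down K" "K \<subseteq> J"
  shows "filt d K m \<subseteq> twist ` filt d K m"
proof -
  interpret tw: Vector_Spaces.linear scl scl twist by (rule linear_twist)
  have "finite K" using assms(1) by (rule finite_down)
  then show ?thesis using assms
  proof (induction K arbitrary: m rule: finite_linorder_max_induct)
    case empty
    have "filt d {} m = span {1}"
    proof -
      have "{W \<in> ndec_words {}. word_deg d W \<le> m} = {[]}" by (auto simp: ndec_words_def)
      then show ?thesis by (simp add: filt_def)
    qed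
    then show ?case by (simp add: tw.span_image[symmetric] twist_one)
  next
    case (insert u K)
    have K: "down (insert u K)" "\<forall>x\<in>K. x < u" by (fact insert.prems(1)) (fact insert.hyps(2))
    have u: "u \<in> J" "u < t" using insert.prems(2) J(2) by auto
    have KI: "insert t J \<inter> {..<u} = K"
      using down_Int[OF J(1), of u] down_Int[OF K(1), of u] u(1) K(2) by auto
    have adm: "admissible (insert u K) d" by (rule admissible_d[OF K(1)])
    have sub: "filt d K m \<subseteq> filt d (insert u K) n" if "m \<le> n" for m n
      by (rule filt_mono) (use that in auto)
    have IH: "filt d K m \<subseteq> twist ` filt d K m" for m
      using insert.IH[OF down_remove_max[OF K]] insert.prems(2) by simp
    have in_span: "x \<in> word_span J" if "x \<in> filt d (insert u K) n" for x n
      by (rule subsetD[OF word_span_mono[OF insert.prems(2)] subsetD[OF filt_subset_zero that]])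
    obtain c a b where cab: "c \<noteq> 0" "a \<in> filt d K (d u)" "b \<in> filt d (insert t J \<inter> {..<t}) (d u + d t)"
      "z t * z u = (scl c (z u) + a) * z t + b"
      using triangular_admissible[OF admissible_d[OF J(1)], of u t] u KI by auto
    have "insert t J \<inter> {..<t} \<subseteq> J" by auto
    from subsetD[OF filt_subset_zero subsetD[OF filt_mono[OF this order_refl] cab(3)]]
    have b: "b \<in> word_span J" .
    have zu: "z u \<in> filt d (insert u K) (d u)" by (rule gen_in_filt) auto
    have "scl c (z u) + a \<in> word_span J"
      by (intro subspace_add[OF subspace_word_span] subspace_scale[OF subspace_word_span]
          in_span[OF zu] in_span[OF subsetD[OF sub[OF order_refl] cab(2)]])
    from twist_unique(1)[OF this b cab(4)] have tw_u: "twist (z u) = scl c (z u) + a" .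
    obtain a0 where a0: "a0 \<in> filt d K (d u)" "twist a0 = a" using IH cab(2) by blast
    \<comment> \<open>The preimage of \<open>z u\<close>, obtained by solving
      \<open>twist (z u) = scl c (z u) + twist a0\<close>.\<close>
    let ?v = "scl (inverse c) (z u - a0)"
    have v: "?v \<in> filt d (insert u K) (d u)"
      using zu subsetD[OF sub[OF order_refl] a0(1)]
      by (intro subspace_scale[OF subspace_filt] subspace_diff[OF subspace_filt])
    have tw_v: "twist ?v = z u" using cab(1) by (simp add: tw.scale tw.diff tw_u a0(2))
    have pow: "?v ^ k \<in> filt d (insert u K) (k * d u) \<and> twist (?v ^ k) = z u ^ k" for k
    proof (induction k)
      case 0
      then show ?case by (simp add: one_in_filt twist_one)
    next
      case (Suc k)
      then show ?case using filt_mult[OF adm v, of "?v ^ k" "k * d u"] in_span[OF v]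
        in_span[of "?v ^ k" "k * d u"] twist_mult(1)[of ?v "?v ^ k"] tw_v by simp
    qed
    have "subspace (twist ` filt d (insert u K) m)"
      by (rule tw.subspace_image[OF subspace_filt])
    then show ?case
    proof (rule filt_insert_subsetI[OF _ K(2)])
      fix x i k assume x: "x \<in> filt d K i" "i + k * d u \<le> m"
      then obtain x0 where x0: "x0 \<in> filt d K i" "twist x0 = x" using IH by blast
      have x0': "x0 \<in> filt d (insert u K) i" using subsetD[OF sub[OF order_refl] x0(1)] .
      have "x0 * ?v ^ k \<in> filt d (insert u K) m"
        using filt_mult[OF adm x0' conjunct1[OF pow]] filt_mono[OF order_refl x(2)] by blast
      moreover have "twist (x0 * ?v ^ k) = x * z u ^ k"
        using twist_mult(1)[OF in_span[OF x0'] in_span[OF conjunct1[OF pow]]] x0(2) pow by simp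
      ultimately show "x * z u ^ k \<in> twist ` filt d (insert u K) m" by (metis imageI)
    qed
  qed
qed

lemma finite_words:
  assumes "K \<subseteq> I"
  shows "finite {W \<in> ndec_words K. word_deg d W \<le> m}"
proof (rule finite_subset)
  have "length W \<le> word_deg d W" if "set W \<subseteq> I" for W
    using that
  proof (induction W)
    case (Cons x W)
    then show ?case using d_pos[of x] by auto
  qed simp
  then show "{W \<in> ndec_words K. word_deg d W \<le> m} \<subseteq> {W. set W \<subseteq> I \<and> length W \<le> m}"
    using assms by (fastforce simp: ndec_words_def)
  show "finite {W. set W \<subseteq> I \<and> length W \<le> m}" by (rule finite_lists_length_le[OF finite_I])
qed

text \<open>
  Triangularity makes \<open>twist\<close> surjective in each degree of the filtration by \<open>d\<close>, whose pieces are
  finite dimensional.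
\<close>

lemma bij_betw_twist: "bij_betw twist (word_span J) (word_span J)"
  unfolding bij_betw_def
proof
  show "inj_on twist (word_span J)"
  proof (rule inj_onI)
    fix x y assume xy: "x \<in> word_span J" "y \<in> word_span J" "twist x = twist y"
    obtain m n where mn: "x \<in> filt d J m" "y \<in> filt d J n"
      using xy filt_zero_obtain_degree by metis
    \<comment> \<open>A finite basis of one filtration piece containing both \<open>x\<close> and
      \<open>y\<close>.\<close>
    let ?B = "word_prod z ` {W \<in> ndec_words J. word_deg d W \<le> m + n}"
    have JI: "J \<subseteq> I" using insert_subset_I by blast
    have ind: "independent ?B"
      using pbw ndec_words_mono[OF JI] unfolding pbw_generating_system_def
      by (auto elim!: independent_mono)
    have B: "?B \<subseteq> twist ` span ?B"
      using filt_subset_twist_image[OF down_J order_refl, of "m + n"] span_superset[of ?B]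
      unfolding filt_def by blast
    have "inj_on twist (span ?B)"
      by (rule finite_independent_surj_imp_inj_on_span[OF linear_twist _ ind B])
        (use finite_words[OF JI] in simp)
    moreover have "x \<in> span ?B" "y \<in> span ?B"
      using mn filt_mono[of J J m "m + n" d] filt_mono[of J J n "m + n" d] unfolding filt_def by auto
    ultimately show "x = y" using xy(3) by (auto dest: inj_onD)
  qed
  show "twist ` word_span J = word_span J"
  proof
    show "twist ` word_span J \<subseteq> word_span J" using twist_word_span(2) by blast
    show "word_span J \<subseteq> twist ` word_span J"
    proof
      fix x assume "x \<in> word_span J"
      then obtain m where "x \<in> filt d J m" by (rule filt_zero_obtain_degree)
      then have "x \<in> twist ` filt d J m" using filt_subset_twist_image[OF down_J order_refl] by blast
      then show "x \<in> twist ` word_span J" using filt_subset_zero by blast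
    qed
  qed
qed

lemma ore_extension_word_span: "ore_extension scl (word_span J) (word_span (insert t J))"
  unfolding ore_extension_def
proof (intro exI conjI)
  show "algebra_automorphism scl (word_span J) twist"
    unfolding algebra_automorphism_def
    using bij_betw_twist twist_one twist_mult(1)
    by (simp add: twist_def coeff_add coeff_scl distrib_left scl_mult_right)
  show "skew_derivation scl (word_span J) twist twist_der"
    unfolding skew_derivation_def
    using twist_mult(2) twist_word_span(3)
    by (auto simp: twist_der_def coeff_add coeff_scl distrib_left scl_mult_right)
  show "free_left_basis_powers (word_span J) (word_span (insert t J)) (z t)"
    by (rule free_left_basis_powers_word_span[OF J])
  show "\<forall>r\<in>word_span J. z t * r = twist r * z t + twist_der r"
    using twist_word_span(1) by blast
qed

end

text \<open>Each letter of \<open>J\<close> outside \<open>K\<close> adds one Ore extension at the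
  end of the chain. If the top letter lies in \<open>K\<close>, then \<open>K\<close> is all of
  \<open>J\<close> and the chain has length 0.\<close>

lemma IHOE_chain:
  assumes "down K" "down J" "K \<subseteq> J"
  shows "\<exists>n A. A 0 = word_span K \<and> A n = word_span J \<and>
      (\<forall>i\<le>n. hopf_subalgebra scl comult antipode (A i)) \<and>
      (\<forall>i<n. ore_extension scl (A i) (A (Suc i)))"
proof -
  have "finite J" using assms(2) by (rule finite_down)
  then show ?thesis using assms(2,3)
  proof (induction J rule: finite_linorder_max_induct)
    case empty
    then show ?case using hopf_subalgebra_word_span[of "{}"]
      by (intro exI[of _ "0::nat"] exI[of _ "\<lambda>_. word_span {}"]) auto
  next
    case (insert t J)
    note J = insert.prems(1) insert.hyps(2)
    show ?case
    proof (cases "t \<in> K")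
      case True
      have "insert t J \<subseteq> K"
        using True assms(1) J by (auto simp: down_def)
      with insert.prems(2) have "K = insert t J" by blast
      then show ?thesis using hopf_subalgebra_word_span[OF J(1)]
        by (intro exI[of _ "0::nat"] exI[of _ "\<lambda>_. word_span K"]) auto
    next
      case False
      with insert.prems(2) have "K \<subseteq> J" by blast
      from insert.IH[OF down_remove_max[OF J] this] obtain n A where
        A: "A 0 = word_span K" "A n = word_span J"
        "\<forall>i\<le>n. hopf_subalgebra scl comult antipode (A i)"
        "\<forall>i<n. ore_extension scl (A i) (A (Suc i))" by blast
      let ?A = "\<lambda>i. if i \<le> n then A i else word_span (insert t J)"
      have "?A 0 = word_span K \<and> ?A (Suc n) = word_span (insert t J) \<and>
        (\<forall>i\<le>Suc n. hopf_subalgebra scl comult antipode (?A i)) \<and>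
        (\<forall>i<Suc n. ore_extension scl (?A i) (?A (Suc i)))"
        using A hopf_subalgebra_word_span[OF J(1)] ore_extension_word_span[OF J]
        by (auto simp: less_Suc_eq Suc_le_eq)
      then show ?thesis by (intro exI[of _ "Suc n"] exI[of _ ?A])
    qed
  qed
qed

end


section \<open>Enveloping algebras\<close>

text \<open>The spanning half of the PBW theorem, by induction on word length: letters are expanded
  multilinearly in the \<open>z k\<close>, and the resulting words are sorted, each transposition
  costing a bracket word that is one letter shorter.\<close>

lemma straightening:
  fixes z :: "'i::linorder \<Rightarrow> 'v::ab_group_add" and scl :: "'k::field \<Rightarrow> 'v \<Rightarrow> 'v"
  assumes scl: "vector_space scl" and L: "L = module.span scl (z ` K)"
    and br: "\<And>x y. x \<in> L \<Longrightarrow> y \<in> L \<Longrightarrow> br x y \<in> L" and u: "u \<in> lists L"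
  shows "gen u \<in> {q + r | q r. q \<in> free.span ((\<lambda>W. gen (map z W)) ` ndec_words K) \<and> r \<in> env_ideal scl br L}"
    (is "gen u \<in> ?M")
proof -
  interpret vector_space scl by fact
  have N: "free.subspace (env_ideal scl br L)"
    unfolding env_ideal_def by (rule free.subspace_span)
  define M where "M = ?M"
  have M: "free.subspace M" unfolding M_def by (rule free.subspace_sums[OF free.subspace_span N])
  have "r \<in> M" if "r \<in> env_ideal scl br L" for r
  proof -
    have "r = 0 + r" by simp
    with that show ?thesis unfolding M_def using free.span_zero by blast
  qed
  then have NM: "env_ideal scl br L \<subseteq> M" by blast
  have sorted_M: "gen (map z W) \<in> M" if "W \<in> ndec_words K" for W
  proof -
    have "gen (map z W) = gen (map z W) + 0" by simp
    moreover have "gen (map z W) \<in> free.span ((\<lambda>W. gen (map z W)) ` ndec_words K)"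
      using that by (intro free.span_base imageI)
    ultimately show ?thesis unfolding M_def using free.subspace_0[OF N] by blast
  qed
  have r_add: "gen (u @ [x + y] @ v) - gen (u @ [x] @ v) - gen (u @ [y] @ v) \<in> M"
    if "u \<in> lists L" "v \<in> lists L" "x \<in> L" "y \<in> L" for u v x y
    unfolding env_ideal_def
    by (rule subsetD[OF NM[unfolded env_ideal_def]], rule free.span_base) (use that in blast)
  have r_scl: "gen (u @ [scl c x] @ v) - fscale c (gen (u @ [x] @ v)) \<in> M"
    if "u \<in> lists L" "v \<in> lists L" "x \<in> L" for u v x c
    unfolding env_ideal_def
    by (rule subsetD[OF NM[unfolded env_ideal_def]], rule free.span_base) (use that in blast)
  have r_br: "gen (u @ [x, y] @ v) - gen (u @ [y, x] @ v) - gen (u @ [br x y] @ v) \<in> M"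
    if "u \<in> lists L" "v \<in> lists L" "x \<in> L" "y \<in> L" for u v x y
    unfolding env_ideal_def
    by (rule subsetD[OF NM[unfolded env_ideal_def]], rule free.span_base) (use that in blast)
  have subL: "subspace L" by (simp add: L)
  have zL: "z k \<in> L" if "k \<in> K" for k using that by (simp add: L span_base)
  have subspace_letter: "subspace {x \<in> L. gen (u @ [x] @ v) \<in> M}"
    if uv: "u \<in> lists L" "v \<in> lists L" for u v
  proof (rule subspaceI)
    show "0 \<in> {x \<in> L. gen (u @ [x] @ v) \<in> M}"
      using r_scl[OF uv subspace_0[OF subL], of 0] subspace_0[OF subL] by simp
  next
    fix x y assume xy: "x \<in> {x \<in> L. gen (u @ [x] @ v) \<in> M}" "y \<in> {x \<in> L. gen (u @ [x] @ v) \<in> M}"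
    then have "gen (u @ [x + y] @ v) - gen (u @ [x] @ v) - gen (u @ [y] @ v) \<in> M"
      using r_add[OF uv] by simp
    from free.subspace_add[OF M this, of "gen (u @ [x] @ v) + gen (u @ [y] @ v)"] xy free.subspace_add[OF M]
    have "gen (u @ [x + y] @ v) \<in> M" by simp
    with xy show "x + y \<in> {x \<in> L. gen (u @ [x] @ v) \<in> M}" using subspace_add[OF subL] by blast
  next
    fix c x assume x: "x \<in> {x \<in> L. gen (u @ [x] @ v) \<in> M}"
    then have "gen (u @ [scl c x] @ v) - fscale c (gen (u @ [x] @ v)) \<in> M"
      using r_scl[OF uv] by simp
    moreover have "fscale c (gen (u @ [x] @ v)) \<in> M" using x by (intro free.subspace_scale[OF M]) simp
    ultimately have "(gen (u @ [scl c x] @ v) - fscale c (gen (u @ [x] @ v))) + fscale c (gen (u @ [x] @ v)) \<in> M"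
      by (rule free.subspace_add[OF M])
    then have "gen (u @ [scl c x] @ v) \<in> M" by (simp only: diff_add_cancel)
    with x show "scl c x \<in> {x \<in> L. gen (u @ [x] @ v) \<in> M}" using subspace_scale[OF subL] by blast
  qed
  \<comment> \<open>Letters of \<open>u\<close> are replaced by generators starting from its right
    end, with the total length \<open>n\<close> fixed.\<close>
  have multilinear: "gen (u @ map z W) \<in> M"
    if n: "\<And>W. W \<in> lists K \<Longrightarrow> length W = n \<Longrightarrow> gen (map z W) \<in> M"
      and "u \<in> lists L" "W \<in> lists K" "length u + length W = n" for u W n
    using that(2-)
  proof (induction u arbitrary: W rule: rev_induct)
    case Nil
    then show ?case using n by simp
  next
    case (snoc x u)
    then have u: "u \<in> lists L" and x: "x \<in> L" by auto
    have W: "map z W \<in> lists L" using snoc.prems(2) by (auto simp: in_lists_conv_set intro!: zL)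
    have "z k \<in> {x \<in> L. gen (u @ [x] @ map z W) \<in> M}" if "k \<in> K" for k
      using snoc.IH[OF u, of "k # W"] snoc.prems that zL by simp
    then have "L \<subseteq> {x \<in> L. gen (u @ [x] @ map z W) \<in> M}"
      using span_minimal[OF _ subspace_letter[OF u W], of "z ` K"] by (auto simp: L)
    with x show ?case by auto
  qed
  have main: "gen u \<in> M" if "u \<in> lists L" "length u = n" for u n
    using that
  proof (induction n arbitrary: u rule: less_induct)
    case (less n)
    have swap: "gen (map z (U @ [a, b] @ V)) \<in> M"
      if "gen (map z (U @ [b, a] @ V)) \<in> M" "set (U @ [a, b] @ V) \<subseteq> K" "length (U @ [a, b] @ V) = n" for U a b V
    proof -
      have UV: "map z U \<in> lists L" "map z V \<in> lists L" "z a \<in> L" "z b \<in> L"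
        using that(2) by (auto simp: subset_iff intro!: zL)
      have "gen (map z U @ [br (z a) (z b)] @ map z V) \<in> M"
        by (rule less.IH[OF _ _ refl]) (use UV br that(3) in auto)
      from free.subspace_add[OF M free.subspace_add[OF M r_br[OF UV] this] that(1)]
      show ?thesis by simp
    qed
    \<comment> \<open>Insertion sort read backwards: membership is transferred from the word with
      \<open>x\<close> inserted to the word with \<open>x\<close> in front.\<close>
    have insort: "gen (map z (U @ x # Y)) \<in> M"
      if "gen (map z (U @ insort x Y)) \<in> M" "set (U @ x # Y) \<subseteq> K" "length (U @ x # Y) = n" for U x Y
      using that
    proof (induction Y arbitrary: U)
      case (Cons y Y)
      show ?case
      proof (cases "x \<le> y")
        case False
        with Cons.prems have "gen (map z ((U @ [y]) @ x # Y)) \<in> M"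
          by (intro Cons.IH) simp_all
        then show ?thesis using swap[of U y x Y] Cons.prems(2,3) by simp
      qed (use Cons.prems in simp)
    qed simp
    have sort: "gen (map z (U @ W)) \<in> M"
      if "gen (map z (U @ sort W)) \<in> M" "set (U @ W) \<subseteq> K" "length (U @ W) = n" for U W
      using that
    proof (induction W arbitrary: U)
      case (Cons x W)
      have "gen (map z (U @ x # sort W)) \<in> M"
        by (rule insort) (use Cons.prems in simp_all)
      then show ?case using Cons.IH[of "U @ [x]"] Cons.prems by simp
    qed simp
    have "gen (map z W) \<in> M" if "W \<in> lists K" "length W = n" for W
    proof -
      have "sort W \<in> ndec_words K" using that by (auto simp: ndec_words_def)
      then show ?thesis using sort[of "[]" W] sorted_M that by auto
    qed
    then have "gen (u @ map z []) \<in> M"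
      by (rule multilinear) (use less.prems in auto)
    then show ?case by simp
  qed
  from main[OF u refl] show ?thesis unfolding M_def .
qed

lemma poly_mapping_eq_sum_gen: "p = (\<Sum>x\<in>Poly_Mapping.keys p. fscale (Poly_Mapping.lookup p x) (gen x))"
  by (rule poly_mapping_eqI)
    (auto simp: lookup_sum lookup_single when_def in_keys_iff if_distrib sum.delta cong: if_cong)

lemma subspace_free_algebra: "free.subspace (free_algebra L :: ('v list \<Rightarrow>\<^sub>0 'k::field) set)"
proof (rule free.subspaceI)
  show "p + q \<in> free_algebra L" if "p \<in> free_algebra L" "q \<in> free_algebra L" for p q :: "'v list \<Rightarrow>\<^sub>0 'k"
    using that keys_add[of p q] unfolding free_algebra_def by blast
  show "fscale c p \<in> free_algebra L" if "p \<in> free_algebra L" for c and p :: "'v list \<Rightarrow>\<^sub>0 'k"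
  proof -
    have "Poly_Mapping.keys (fscale c p) \<subseteq> Poly_Mapping.keys p" by (auto simp: in_keys_iff)
    with that show ?thesis unfolding free_algebra_def by blast
  qed
qed (simp add: free_algebra_def)

lemma gen_in_free_algebra: "u \<in> lists L \<Longrightarrow> gen u \<in> free_algebra L"
  by (simp add: free_algebra_def)

section \<open>The enveloping algebra of the primitives inside \<open>H\<close>\<close>

context pbw_hopf
begin

lemma env_map_coset: "env_map scl (coset (env_ideal scl commutator L) p) = lin_ext scl prod_list p"
proof -
  let ?C = "coset (env_ideal scl commutator L) p"
  have "lin_ext scl prod_list ` ?C = (\<lambda>_. lin_ext scl prod_list p) ` ?C"
  proof (rule image_cong[OF refl])
    fix q assume "q \<in> ?C"
    then show "lin_ext scl prod_list q = lin_ext scl prod_list p"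
      by (intro lin_ext_env_ideal) (simp add: coset_def)
  qed
  moreover have "p \<in> ?C" by (simp add: coset_def env_ideal_def free.span_zero)
  ultimately have "lin_ext scl prod_list ` ?C = {lin_ext scl prod_list p}"
    by (simp only: image_constant)
  then show ?thesis by (simp only: env_map_def the_elem_eq)
qed

abbreviation sorted_gens :: "('h list \<Rightarrow>\<^sub>0 'k) set"
  where "sorted_gens \<equiv> (\<lambda>W. gen (map z W)) ` ndec_words primitive_letters"

lemma free_algebra_decompose:
  assumes "p \<in> free_algebra (primitives scl comult)"
  obtains q r where "p = q + r" "q \<in> free.span sorted_gens" "r \<in> env_ideal scl commutator (primitives scl comult)"
proof -
  let ?L = "primitives scl comult"
  let ?M = "{q + r | q r. q \<in> free.span sorted_gens \<and> r \<in> env_ideal scl commutator ?L}"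
  have M: "free.subspace ?M"
    unfolding env_ideal_def by (rule free.subspace_sums[OF free.subspace_span free.subspace_span])
  have "gen u \<in> ?M" if "u \<in> Poly_Mapping.keys p" for u
    by (rule straightening[OF vs primitives_eq])
      (use that assms in \<open>auto simp: free_algebra_def intro: commutator_primitive\<close>)
  then have "(\<Sum>x\<in>Poly_Mapping.keys p. fscale (Poly_Mapping.lookup p x) (gen x)) \<in> ?M"
    by (intro free.subspace_sum[OF M] free.subspace_scale[OF M])
  then have "p \<in> ?M" by (simp only: poly_mapping_eq_sum_gen[symmetric])
  with that show thesis by blast
qed

lemma word_prod_eq: "prod_list (map z W) = word_prod z W"
  by (simp add: word_prod_def)

text \<open>PBW independence supplies a left inverse of evaluation: the linear map \<open>g\<close>
  sending each basis element to its formal word.\<close>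

lemma lin_ext_sorted_gens_inj:
  assumes "q \<in> free.span sorted_gens" "q' \<in> free.span sorted_gens"
    and "lin_ext scl prod_list q = lin_ext scl prod_list q'"
  shows "q = q'"
proof -
  obtain g :: "'h \<Rightarrow> ('h list \<Rightarrow>\<^sub>0 'k)" where g: "Vector_Spaces.linear scl fscale g"
    "\<forall>W\<in>ndec_words I. g (word_prod z W) = gen (map z W)"
    using ex_linear_on_basis[OF vector_space_fscale, of "\<lambda>W. gen (map z W)"] by blast
  interpret g: Vector_Spaces.linear scl fscale g by (rule g(1))
  interpret le: Vector_Spaces.linear fscale scl "lin_ext scl prod_list" by (rule linear_lin_ext[OF vs])
  have sub: "free.subspace {q. g (lin_ext scl prod_list q) = q}"
    by (auto simp: free.subspace_def le.add le.scale le.zero g.add g.scale g.zero)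
  have "primitive_letters \<subseteq> I" by (auto simp: primitive_letters_def)
  from ndec_words_mono[OF this] have "sorted_gens \<subseteq> {q. g (lin_ext scl prod_list q) = q}"
    using g(2) by (auto simp: lin_ext_single[OF vs] word_prod_eq)
  from free.span_minimal[OF this sub] assms show ?thesis by (metis (mono_tags, lifting) mem_Collect_eq subsetD)
qed

lemma lin_ext_sorted_gens: "lin_ext scl prod_list ` free.span sorted_gens = word_span primitive_letters"
proof -
  interpret le: Vector_Spaces.linear fscale scl "lin_ext scl prod_list" by (rule linear_lin_ext[OF vs])
  have "lin_ext scl prod_list ` sorted_gens = word_prod z ` {W \<in> ndec_words primitive_letters. word_deg (\<lambda>_. 0) W \<le> 0}"
    by (auto simp: image_image lin_ext_single[OF vs] word_prod_eq word_deg_zero)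
  then show ?thesis by (simp add: le.span_image[symmetric] filt_def)
qed

lemma lin_ext_env_ideal_zero:
  "r \<in> env_ideal scl commutator L \<Longrightarrow> lin_ext scl prod_list (q + r) = lin_ext scl prod_list q"
  by (rule lin_ext_env_ideal[of _ _ L]) simp

text \<open>Straightening writes both representatives as sorted parts modulo the ideal. Equal values
  force equal sorted parts, so the representatives differ by an element of the ideal.\<close>

lemma inj_env_map: "inj_on (env_map scl) (enveloping_algebra scl commutator (primitives scl comult))"
proof (rule inj_onI)
  let ?N = "env_ideal scl commutator (primitives scl comult)"
  have N: "free.subspace ?N" unfolding env_ideal_def by (rule free.subspace_span)
  fix x y assume "x \<in> enveloping_algebra scl commutator (primitives scl comult)"
    "y \<in> enveloping_algebra scl commutator (primitives scl comult)" and eq: "env_map scl x = env_map scl y"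
  then obtain p p' where p: "p \<in> free_algebra (primitives scl comult)" "x = coset ?N p"
    "p' \<in> free_algebra (primitives scl comult)" "y = coset ?N p'"
    by (auto simp: enveloping_algebra_def)
  obtain q r q' r' where qr: "p = q + r" "q \<in> free.span sorted_gens" "r \<in> ?N"
    "p' = q' + r'" "q' \<in> free.span sorted_gens" "r' \<in> ?N"
    using free_algebra_decompose[OF p(1)] free_algebra_decompose[OF p(3)] by metis
  have "lin_ext scl prod_list q = lin_ext scl prod_list q'"
    using eq lin_ext_env_ideal_zero[OF qr(3)] lin_ext_env_ideal_zero[OF qr(6)]
    by (simp add: p(2,4) env_map_coset qr(1,4))
  with lin_ext_sorted_gens_inj qr have "p - p' = r - r'" by simp
  then have "p - p' \<in> ?N" using free.subspace_diff[OF N qr(3,6)] by simp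
  then have "s - p \<in> ?N \<longleftrightarrow> s - p' \<in> ?N" for s
    using free.subspace_add[OF N, of "s - p" "p - p'"] free.subspace_diff[OF N, of "s - p'" "p - p'"] by auto
  then show "x = y" by (simp add: p(2,4) coset_def)
qed

text \<open>Straightening replaces a formal sum of words by a sorted one with the same
  value.\<close>

lemma image_env_map:
  "env_map scl ` enveloping_algebra scl commutator (primitives scl comult) = word_span primitive_letters"
proof -
  let ?L = "primitives scl comult"
  have "env_map scl ` enveloping_algebra scl commutator ?L = lin_ext scl prod_list ` free_algebra ?L"
    by (simp add: enveloping_algebra_def image_image env_map_coset)
  also have "\<dots> = lin_ext scl prod_list ` free.span sorted_gens"
  proof
    show "lin_ext scl prod_list ` free_algebra ?L \<subseteq> lin_ext scl prod_list ` free.span sorted_gens"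
    proof clarify
      fix p :: "'h list \<Rightarrow>\<^sub>0 'k" assume "p \<in> free_algebra ?L"
      then obtain q r where "p = q + r" "q \<in> free.span sorted_gens" "r \<in> env_ideal scl commutator ?L"
        by (rule free_algebra_decompose)
      then show "lin_ext scl prod_list p \<in> lin_ext scl prod_list ` free.span sorted_gens"
        using lin_ext_env_ideal_zero by blast
    qed
    have "sorted_gens \<subseteq> free_algebra ?L"
      using generator_primitive by (auto simp: ndec_words_def intro!: gen_in_free_algebra)
    then show "lin_ext scl prod_list ` free.span sorted_gens \<subseteq> lin_ext scl prod_list ` free_algebra ?L"
      by (intro image_mono free.span_minimal subspace_free_algebra)
  qed
  finally show ?thesis by (simp only: lin_ext_sorted_gens)
qed

lemma word_span_I: "word_span I = UNIV"
  using pbw by (simp add: filt_def word_deg_zero pbw_generating_system_def)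

lemma is_IHOE_of_primitive_part: "is_IHOE_of scl comult antipode (word_span primitive_letters)"
proof -
  have "primitive_letters \<subseteq> I" by (auto simp: primitive_letters_def)
  from IHOE_chain[OF down_primitive_letters down_I this] show ?thesis
    unfolding is_IHOE_of_def word_span_I .
qed

end

section \<open>Positivity of the coradical degree, and the final instantiation\<close>

lemma (in hopf_algebra) primitive_in_corad_filt:
  assumes "x \<in> primitives scl comult"
  shows "x \<in> corad_filt scl comult (Suc m)"
  unfolding corad_filt_Suc_eq
proof (rule comult_preimageI)
  show "gen (1, x) + gen (x, 1) \<in> comult x" using assms by (simp only: primitive_iff)
  show "gen (1, x) + gen (x, 1) \<in> tensor_in scl (UNIV \<times> corad_filt scl comult m \<union> coradical scl comult \<times> UNIV)"
    by (intro free.subspace_add[OF subspace_tensor_in] gen_in_tensor_in)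
      (simp_all add: one_in_coradical one_in_corad_filt)
qed

text \<open>
  \<^const>\<open>corad_deg\<close> is a \<open>LEAST\<close>, hence positive only where some \<open>z \<xi> \<in> H\<^sub>(\<^sub>m\<^sub>)\<close> with \<open>m \<ge> 1\<close> exists.  The first
  generator is primitive, and monotonicity carries positivity to the others.
\<close>

lemma (in hopf_algebra) corad_deg_pos:
  fixes I :: "'i::linorder set" and z :: "'i \<Rightarrow> 'h"
  assumes "finite I" "comult_dominated scl comult I z d" "order_preserving I (corad_deg scl comult z)" "\<xi> \<in> I"
  shows "0 < corad_deg scl comult z \<xi>"
proof -
  let ?m = "Min I"
  have m: "?m \<in> I" "?m \<le> \<xi>" using assms(1,4) by (auto intro: Min_in)
  \<comment> \<open>No letter lies below the least one, so the correction terms in its coproduct are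
    absent.\<close>
  have no_words: False if "P \<in> ndec_words_pos I" "less_r P [?m]" for P
  proof -
    have "P \<in> ndec_words (I \<inter> {..<?m})" "P \<noteq> []"
      using less_r_singleton[OF that(2)] that(1) by (auto simp: ndec_words_pos_def)
    then obtain x where "x \<in> I" "x < ?m" by (cases P) (auto simp: ndec_words_def)
    with assms(1) show False by (meson Min_le leD)
  qed
  let ?S = "{gen (word_prod z P, word_prod z Q) | P Q. P \<in> ndec_words_pos I \<and> Q \<in> ndec_words_pos I \<and>
          word_deg d (P @ Q) \<le> d ?m \<and> less_r P [?m] \<and> less_r Q [?m]} :: ('h \<times> 'h \<Rightarrow>\<^sub>0 'k) set"
  obtain s where s: "s \<in> free.span ?S" "comult (z ?m) = tensor scl (gen (1, z ?m) + gen (z ?m, 1) + s)"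
    using assms(2) m(1) unfolding comult_dominated_def by blast
  have "?S = {}" using no_words by blast
  with s(1) have "s = 0" by (simp only: free.span_empty singleton_iff)
  with s(2) have "comult (z ?m) = tensor scl (gen (1, z ?m) + gen (z ?m, 1))" by simp
  then have "z ?m \<in> corad_filt scl comult (Suc 0)"
    by (intro primitive_in_corad_filt) (simp add: primitives_def)
  then have "corad_deg scl comult z ?m \<ge> 1"
    using LeastI[of "\<lambda>m. m \<ge> 1 \<and> z ?m \<in> corad_filt scl comult m" "Suc 0"]
    unfolding corad_deg_def by simp
  with m assms(3,4) show ?thesis by (cases "?m = \<xi>") (fastforce simp: order_preserving_def)+
qed

theorem corollary5p17:
  fixes scl :: "'k::field_char_0 \<Rightarrow> 'h::ring_1 \<Rightarrow> 'h"
    and comult :: "'h \<Rightarrow> ('h \<times> 'h \<Rightarrow>\<^sub>0 'k) set"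
    and counit :: "'h \<Rightarrow> 'k"
    and antipode :: "'h \<Rightarrow> 'h"
    and I :: "'i::linorder set"
    and z :: "'i \<Rightarrow> 'h"
  assumes "hopf_algebra scl comult counit antipode"
    and "finite I"
    and "pbw_generating_system scl I z"
    and "d_minimal scl comult I z (corad_deg scl comult z)"
    and "d_triangular scl I z (corad_deg scl comult z)"
    and "comult_dominated scl comult I z (corad_deg scl comult z)"
    and "order_preserving I (corad_deg scl comult z)"
  shows "inj_on (env_map scl) (enveloping_algebra scl commutator (primitives scl comult)) \<and>
    is_IHOE_of scl comult antipode
      (env_map scl ` enveloping_algebra scl commutator (primitives scl comult))"
proof -
  interpret hopf_algebra scl comult counit antipode by fact
  interpret pbw_hopf scl comult counit antipode I z "corad_deg scl comult z"
    by unfold_locales (use assms corad_deg_pos[OF assms(2,6,7)] in auto)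
  show ?thesis using inj_env_map is_IHOE_of_primitive_part by (simp only: image_env_map)
qed

end
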